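(* Let $N\ge 2$, $p,q\in(1,\infty)$, $R>0$, $f\in C[0,R)$, and set $\kappa=\frac{p-1}{q-1}$ and $d=\frac{(N-1)(q-1)}{p-1}+1$. Assume that $v$ is a bounded weak supersolution to $-\kappa\Delta_q^d v\ge f$ in $(0,R)$. Then $u(x):=v_*(|x|)$ is a viscosity supersolution to $-|Du|^{q-2}\Delta_p^N u=f(|x|)$ in $B_R\subset\mathbb{R}^N$.
   Context: $B_R\subset\mathbb{R}^N$ is the open ball of radius $R$ centred at the origin. Weighted spaces. $L^q(r^{d-1},(0,R))$ is the set of measurable $v:(0,R)\to\mathbb{R}$ with $\int_0^R|v|^q r^{d-1}\,dr<\infty$. $W^{1,q}(r^{d-1},(0,R))$ is the set of $v\in L^q(r^{d-1},(0,R))$ whose distributional derivative $v'$ on $(0,R)$ belongs to $L^q(r^{d-1},(0,R))$, with norm $\big(\int_0^R|v|^q r^{d-1}dr+\int_0^R|v'|^q r^{d-1}dr\big)^{1/q}$. Weak supersolutions. Formally $\Delta_q^d v=|v'|^{q-2}\big((q-1)v''+\frac{d-1}{r}v'\big)$. A function $v$ is a weak supersolution to $-\kappa\Delta_q^d v\ge f$ in $(0,R)$ if $v\in W^{1,q}(r^{d-1},(0,R'))$ for all $R'\in(0,R)$ and $$\int_0^R \kappa|v'|^{q-2}v'\varphi' r^{d-1}-\varphi f r^{d-1}\,dr\ge 0$$ for all non-negative $\varphi\in C_0^\infty(-R,R)$ (note: test functions need not vanish at $0$). Lower semicontinuous regularization: $v_*(r):=\lim_{S\to0^+}\operatorname{ess\,inf}_{s\in(r-S,r+S)\cap(0,R)}v(s)$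 for $r\in[0,R]$. Viscosity supersolutions. The normalized $p$-Laplacian is $\Delta_p^N u=\Delta u+\frac{p-2}{|Du|^2}\sum_{i,j=1}^N D_{ij}u\,D_iu\,D_ju$. A function $\varphi$ touches $u$ from below at $x_0\in B_R$ if $\varphi(x_0)=u(x_0)$ and $\varphi(x)<u(x)$ for $x\ne x_0$ in a neighbourhood of $x_0$. A bounded lower semicontinuous $u:B_R\to\mathbb{R}$ is a viscosity supersolution to $-|Du|^{q-2}\Delta_p^N u=f(|x|)$ in $B_R$ if whenever $\varphi$ is $C^2$ near $x_0\in B_R$, touches $u$ from below at $x_0$, and $D\varphi(x)\neq0$ for $x\ne x_0$ near $x_0$, then $$\limsup_{x_0\ne y\to x_0}\big(-|D\varphi(y)|^{q-2}\Delta_p^N\varphi(y)\big)-f(|x_0|)\ge0.$$ *)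

theory Defs
  imports "HOL-Analysis.Analysis" "HOL-Probability.Essential_Supremum"
begin

section \<open>Weighted Sobolev spaces on an interval\<close>

definition test_function :: "real \<Rightarrow> real \<Rightarrow> (real \<Rightarrow> real) \<Rightarrow> bool" where
  "test_function a b \<phi> \<longleftrightarrow>
     (\<forall>n t. (deriv ^^ n) \<phi> field_differentiable at t) \<and>
     compact (closure {t. \<phi> t \<noteq> 0}) \<and> closure {t. \<phi> t \<noteq> 0} \<subseteq> {a<..<b}"

definition locally_integrable :: "real \<Rightarrow> real \<Rightarrow> (real \<Rightarrow> real) \<Rightarrow> bool" where
  "locally_integrable a b v \<longleftrightarrow>
     (\<forall>K. compact K \<and> K \<subseteq> {a<..<b} \<longrightarrow> integrable (lebesgue_on K) v)"

definition distr_deriv :: "real \<Rightarrow> real \<Rightarrow> (real \<Rightarrow> real) \<Rightarrow> (real \<Rightarrow> real) \<Rightarrow> bool" where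
  "distr_deriv a b v w \<longleftrightarrow> locally_integrable a b v \<and> locally_integrable a b w \<and>
     (\<forall>\<phi>. test_function a b \<phi> \<longrightarrow>
        (LINT t|lebesgue_on {a<..<b}. v t * deriv \<phi> t) =
        - (LINT t|lebesgue_on {a<..<b}. w t * \<phi> t))"

definition Lq_weighted :: "real \<Rightarrow> real \<Rightarrow> real \<Rightarrow> (real \<Rightarrow> real) set" where
  "Lq_weighted q d R = {v. v \<in> borel_measurable (lebesgue_on {0<..<R}) \<and>
     integrable (lebesgue_on {0<..<R}) (\<lambda>r. \<bar>v r\<bar> powr q * r powr (d - 1))}"

definition W1q_weighted :: "real \<Rightarrow> real \<Rightarrow> real \<Rightarrow> (real \<Rightarrow> real) set" where
  "W1q_weighted q d R =
     {v \<in> Lq_weighted q d R. \<exists>w \<in> Lq_weighted q d R. distr_deriv 0 R v w}"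

section \<open>Weak supersolutions of the radial equation\<close>

text \<open>The distributional derivative \<open>w\<close> is unique up to null sets, so the existential quantifier
  only gives it a name. Where \<open>w r = 0\<close>, the term \<open>\<bar>w r\<bar> powr (q - 2) * w r\<close> is \<open>0\<close>,
  as it should be also for \<open>q < 2\<close>. The test functions live on \<open>(-R, R)\<close> and need not vanish
  at \<open>0\<close>.\<close>

definition weak_supersolution ::
    "real \<Rightarrow> real \<Rightarrow> real \<Rightarrow> real \<Rightarrow> (real \<Rightarrow> real) \<Rightarrow> (real \<Rightarrow> real) \<Rightarrow> bool" where
  "weak_supersolution \<kappa> q d R f v \<longleftrightarrow>
     (\<forall>R'. 0 < R' \<and> R' < R \<longrightarrow> v \<in> W1q_weighted q d R') \<and>
     (\<exists>w. distr_deriv 0 R v w \<and>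
        (\<forall>\<phi>. test_function (- R) R \<phi> \<and> (\<forall>t. 0 \<le> \<phi> t) \<longrightarrow>
           0 \<le> (LINT r|lebesgue_on {0<..<R}.
                  \<kappa> * (\<bar>w r\<bar> powr (q - 2) * w r) * deriv \<phi> r * r powr (d - 1)
                  - \<phi> r * f r * r powr (d - 1))))"

text \<open>Boundedness of an element of a Sobolev space is understood almost everywhere.\<close>

definition ess_bounded :: "real \<Rightarrow> (real \<Rightarrow> real) \<Rightarrow> bool" where
  "ess_bounded R v \<longleftrightarrow> (\<exists>M. AE r in lebesgue_on {0<..<R}. \<bar>v r\<bar> \<le> M)"

definition essinf :: "'a measure \<Rightarrow> ('a \<Rightarrow> real) \<Rightarrow> ereal" where
  "essinf M v = - esssup M (\<lambda>s. - ereal (v s))"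

definition lsc_regularization :: "real \<Rightarrow> (real \<Rightarrow> real) \<Rightarrow> real \<Rightarrow> ereal" where
  "lsc_regularization R v r =
     Lim (at_right 0) (\<lambda>S. essinf (lebesgue_on ({r - S<..<r + S} \<inter> {0<..<R})) v)"

section \<open>Viscosity supersolutions in a ball\<close>

text \<open>The partial derivatives are those of the Frechet derivative; they are only used for
  functions that are \<open>C\<^sup>2\<close> near the point in question. In \<open>C2_on\<close>, the set is meant to be open.
  Continuity of the first derivatives is part of their differentiability.\<close>

definition partial_deriv :: "'n \<Rightarrow> (real ^ 'n \<Rightarrow> real) \<Rightarrow> real ^ 'n \<Rightarrow> real" where
  "partial_deriv i \<phi> x = frechet_derivative \<phi> (at x) (axis i 1)"

definition C2_on :: "(real ^ 'n) set \<Rightarrow> (real ^ 'n \<Rightarrow> real) \<Rightarrow> bool" where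
  "C2_on U \<phi> \<longleftrightarrow> \<phi> differentiable_on U \<and>
     (\<forall>i. partial_deriv i \<phi> differentiable_on U) \<and>
     (\<forall>i j. continuous_on U (partial_deriv i (partial_deriv j \<phi>)))"

definition grad :: "(real ^ 'n \<Rightarrow> real) \<Rightarrow> real ^ 'n \<Rightarrow> real ^ 'n" where
  "grad \<phi> x = (\<chi> i. partial_deriv i \<phi> x)"

definition laplacian :: "(real ^ 'n \<Rightarrow> real) \<Rightarrow> real ^ 'n \<Rightarrow> real" where
  "laplacian \<phi> x = (\<Sum>i\<in>UNIV. partial_deriv i (partial_deriv i \<phi>) x)"

definition normalized_p_laplacian :: "real \<Rightarrow> (real ^ 'n \<Rightarrow> real) \<Rightarrow> real ^ 'n \<Rightarrow> real" where
  "normalized_p_laplacian p \<phi> x = laplacian \<phi> x + (p - 2) / (norm (grad \<phi> x))\<^sup>2 *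
     (\<Sum>i\<in>UNIV. \<Sum>j\<in>UNIV.
        partial_deriv i (partial_deriv j \<phi>) x * partial_deriv i \<phi> x * partial_deriv j \<phi> x)"

definition touches_below_at ::
    "(real ^ 'n \<Rightarrow> real) \<Rightarrow> (real ^ 'n \<Rightarrow> real) \<Rightarrow> real ^ 'n \<Rightarrow> bool" where
  "touches_below_at \<phi> u x0 \<longleftrightarrow> \<phi> x0 = u x0 \<and> (\<forall>\<^sub>F x in at x0. \<phi> x < u x)"

definition lower_semicontinuous_on :: "'a::topological_space set \<Rightarrow> ('a \<Rightarrow> real) \<Rightarrow> bool" where
  "lower_semicontinuous_on A u \<longleftrightarrow> (\<forall>x\<in>A. \<forall>c < u x. \<forall>\<^sub>F y in at x within A. c < u y)"

definition viscosity_supersolution ::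
    "real \<Rightarrow> real \<Rightarrow> real \<Rightarrow> (real \<Rightarrow> real) \<Rightarrow> (real ^ 'n \<Rightarrow> real) \<Rightarrow> bool" where
  "viscosity_supersolution p q R f u \<longleftrightarrow>
     bounded (u ` ball 0 R) \<and> lower_semicontinuous_on (ball 0 R) u \<and>
     (\<forall>x0 \<in> ball 0 R. \<forall>\<phi>.
        (\<exists>U. open U \<and> x0 \<in> U \<and> C2_on U \<phi>) \<and> touches_below_at \<phi> u x0 \<and>
        (\<forall>\<^sub>F x in at x0. grad \<phi> x \<noteq> 0) \<longrightarrow>
        0 \<le> Limsup (at x0) (\<lambda>y. ereal (- (norm (grad \<phi> y) powr (q - 2)
                                        * normalized_p_laplacian p \<phi> y)))
            - ereal (f (norm x0)))"

end

theory Submission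
  imports Defs "HOL-Real_Asymp.Real_Asymp"
begin

text \<open>Let \<open>w\<close> be the weak derivative of \<open>v\<close> and \<open>F\<close> a primitive of \<open>f r\<^sup>d\<^sup>-\<^sup>1\<close>. The weak inequality
  says that \<open>\<kappa> \<bar>w\<bar>\<^sup>q\<^sup>-\<^sup>2 w r\<^sup>d\<^sup>-\<^sup>1 + F\<close> agrees almost everywhere with a nonincreasing function \<open>H \<le> 0\<close>.
  Let \<open>k C\<close> solve \<open>\<kappa> \<bar>k\<bar>\<^sup>q\<^sup>-\<^sup>2 k r\<^sup>d\<^sup>-\<^sup>1 + F = C\<close> with \<open>C = H r0\<close> (or \<open>C = 0\<close> if \<open>r0 = 0\<close>). Then \<open>w \<le> k C\<close> on
  the right of \<open>r0\<close> and \<open>w \<ge> k C\<close> on the left, so that a primitive of \<open>k C\<close>, a classical radial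
  solution, touches \<open>v\<^sub>*\<close> from above at \<open>r0\<close>. A test function \<open>\<phi>\<close> touching \<open>u\<close> from below at \<open>x0\<close>
  therefore also touches this radial solution from below. After a small change of \<open>C\<close>, the
  difference of the two has a maximum at a point near \<open>x0\<close> but different from it, where the gradient
  of \<open>\<phi>\<close> does not vanish by assumption. At that point the solution is twice differentiable, and
  comparing the Hessians gives the viscosity inequality.\<close>

subsection \<open>Smooth bump functions\<close>

text \<open>The radial problem is one-dimensional, so the weak inequality can be integrated once,
  and comparison with a classical solution becomes monotonicity of a difference. The constants are
  determined by \<kappa> (q - 1) = p - 1 and \<kappa> (d - 1) = N - 1: with them the one-dimensional
  operator is |Du|^(q-2) times the normalized p-Laplacian of a radial function. Changing C changes
  the profile but not the equation that it solves, so moving the touching point costs nothing in the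
  final inequality. Two obstacles shape the rest. The regularization is an infimum over both sides
  of r0, so an inequality for v on one side says nothing about its value at r0 until jumps are
  excluded; for r0 > 0 this uses that H is bounded on both sides near r0. At the origin the weight
  degenerates: only C = 0 gives a profile with bounded slope, while for C < 0 the slope tends to
  -\<infinity> and the profile itself is unbounded if N \<ge> p. Hence the comparison at the origin
  is made with C = 0, and perturbed profiles are used only on annuli.\<close>

primrec times_differentiable :: "nat \<Rightarrow> (real \<Rightarrow> real) \<Rightarrow> bool" where
  "times_differentiable 0 f \<longleftrightarrow> True"
| "times_differentiable (Suc n) f \<longleftrightarrow>
     (\<forall>t. f field_differentiable at t) \<and> times_differentiable n (deriv f)"

text \<open>By \<open>smooth_iff\<close> this is the regularity demanded in
  \<open>test_function\<close>. Counting orders with a recursion that strips one derivative at a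
  time lets the closure properties be proved by induction on the order, with the function kept
  arbitrary.\<close>

definition smooth :: "(real \<Rightarrow> real) \<Rightarrow> bool" where
  "smooth f \<longleftrightarrow> (\<forall>n. times_differentiable n f)"

lemma times_differentiable_iff:
  "times_differentiable n f \<longleftrightarrow> (\<forall>m<n. \<forall>t. (deriv ^^ m) f field_differentiable at t)"
  by (induction n arbitrary: f) (auto simp: less_Suc_eq_0_disj funpow_swap1 simp del: funpow.simps(2), auto simp: funpow_swap1)

lemma smooth_iff: "smooth f \<longleftrightarrow> (\<forall>n t. (deriv ^^ n) f field_differentiable at t)"
  unfolding smooth_def times_differentiable_iff by blast

lemma times_differentiable_SucI:
  assumes "\<And>t. (f has_field_derivative f' t) (at t)" "times_differentiable n f'"
  shows "times_differentiable (Suc n) f"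
proof -
  have "deriv f = f'" using assms(1) DERIV_imp_deriv by blast
  then show ?thesis using assms by (auto simp: field_differentiable_def)
qed

lemma times_differentiable_SucD:
  "times_differentiable (Suc n) f \<Longrightarrow> times_differentiable n f"
  unfolding times_differentiable_iff by simp

lemma times_differentiable_DERIV:
  "times_differentiable (Suc n) f \<Longrightarrow> (f has_field_derivative deriv f t) (at t)"
  by (simp add: DERIV_deriv_iff_field_differentiable)

lemma times_differentiable_const: "times_differentiable n (\<lambda>t. c)"
proof (induction n arbitrary: c)
  case (Suc n) show ?case by (rule times_differentiable_SucI[OF DERIV_const Suc])
qed simp

lemma times_differentiable_add:
  "times_differentiable n f \<Longrightarrow> times_differentiable n g \<Longrightarrow> times_differentiable n (\<lambda>t. f t + g t)"
proof (induction n arbitrary: f g)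
  case (Suc n)
  show ?case
    by (rule times_differentiable_SucI[where f' = "\<lambda>t. deriv f t + deriv g t"])
       (use Suc in \<open>auto intro!: derivative_eq_intros simp: DERIV_deriv_iff_field_differentiable\<close>)
qed simp

lemma times_differentiable_mult:
  "times_differentiable n f \<Longrightarrow> times_differentiable n g \<Longrightarrow> times_differentiable n (\<lambda>t. f t * g t)"
proof (induction n arbitrary: f g)
  case (Suc n)
  note [simp del] = times_differentiable.simps(2)
  show ?case
  proof (rule times_differentiable_SucI[where f' = "\<lambda>t. deriv f t * g t + f t * deriv g t"])
    show "((\<lambda>t. f t * g t) has_field_derivative deriv f t * g t + f t * deriv g t) (at t)" for t
      using Suc.prems by (auto intro!: derivative_eq_intros times_differentiable_DERIV)
    show "times_differentiable n (\<lambda>t. deriv f t * g t + f t * deriv g t)"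
      using Suc.prems Suc.prems[THEN times_differentiable_SucD]
      by (intro times_differentiable_add Suc.IH) (simp_all add: times_differentiable.simps(2))
  qed
qed simp

lemma times_differentiable_affine:
  "times_differentiable n f \<Longrightarrow> times_differentiable n (\<lambda>t. f (c * t + e))"
proof (induction n arbitrary: f)
  case (Suc n)
  note [simp del] = times_differentiable.simps(2)
  show ?case
  proof (rule times_differentiable_SucI[where f' = "\<lambda>t. c * deriv f (c * t + e)"])
    show "((\<lambda>t. f (c * t + e)) has_field_derivative c * deriv f (c * t + e)) (at t)" for t
    proof -
      have "((\<lambda>t. c * t + e) has_field_derivative c) (at t)"
        by (auto intro!: derivative_eq_intros)
      then show ?thesis
        using DERIV_chain2[OF times_differentiable_DERIV[OF Suc.prems], of "\<lambda>t. c * t + e" c t UNIV]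
        by (simp add: mult.commute[of "deriv f (c * t + e)"])
    qed
    show "times_differentiable n (\<lambda>t. c * deriv f (c * t + e))"
      using Suc.prems by (intro times_differentiable_mult times_differentiable_const Suc.IH)
        (auto simp: times_differentiable.simps(2))
  qed
qed simp

lemma smooth_const: "smooth (\<lambda>t. c)"
  and smooth_add: "smooth f \<Longrightarrow> smooth g \<Longrightarrow> smooth (\<lambda>t. f t + g t)"
  and smooth_mult: "smooth f \<Longrightarrow> smooth g \<Longrightarrow> smooth (\<lambda>t. f t * g t)"
  and smooth_affine: "smooth f \<Longrightarrow> smooth (\<lambda>t. f (c * t + e))"
  by (simp_all add: smooth_def times_differentiable_const times_differentiable_add
      times_differentiable_mult times_differentiable_affine)

lemma smooth_antiderivative:
  assumes "\<And>t. (f has_field_derivative f' t) (at t)" "smooth f'"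
  shows "smooth f"
  unfolding smooth_def
proof
  fix n show "times_differentiable n f"
    using times_differentiable_SucI[OF assms(1), of n] assms(2) times_differentiable_SucD
    by (auto simp: smooth_def simp del: times_differentiable.simps(2))
qed

lemma smooth_DERIV: "smooth f \<Longrightarrow> (f has_field_derivative deriv f t) (at t)"
  using times_differentiable_DERIV[of 0] by (simp add: smooth_def del: times_differentiable.simps(2))

lemma smooth_deriv: "smooth f \<Longrightarrow> smooth (deriv f)"
  by (metis smooth_def times_differentiable.simps(2))

lemma smooth_continuous: "smooth f \<Longrightarrow> continuous_on S f"
  using DERIV_continuous[OF smooth_DERIV] continuous_at_imp_continuous_on by blast

text \<open>The power of t in the denominator makes the family closed under differentiation: the
  derivative of member k combines members k + 1 and k + 2. Smoothness of all members then follows by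
  one induction.\<close>

definition exp_cutoff :: "nat \<Rightarrow> real \<Rightarrow> real" where
  "exp_cutoff k t = (if 0 < t then exp (- 1 / t) / t ^ k else 0)"

lemma exp_cutoff_tendsto: "(exp_cutoff k \<longlongrightarrow> 0) (at_right 0)"
proof -
  have "((\<lambda>t::real. exp (- 1 / t) / t ^ k) \<longlongrightarrow> 0) (at_right 0)"
    by real_asymp
  then show ?thesis
    by (rule Lim_transform_eventually) (auto simp: exp_cutoff_def eventually_at_filter)
qed

lemma exp_cutoff_DERIV:
  "(exp_cutoff k has_field_derivative exp_cutoff (k + 2) t - real k * exp_cutoff (k + 1) t) (at t)"
proof -
  consider "t > 0" | "t < 0" | "t = 0" by linarith
  then show ?thesis
  proof cases
    case 1
    have "((\<lambda>t. exp (- 1 / t) / t ^ k) has_field_derivative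
        exp_cutoff (k + 2) t - real k * exp_cutoff (k + 1) t) (at t)"
    proof -
      have "((\<lambda>t. exp (- 1 / t)) has_field_derivative exp (- 1 / t) / t\<^sup>2) (at t)"
        using 1 by (auto intro!: derivative_eq_intros simp: field_simps power2_eq_square)
      moreover have "real k * t ^ (k - Suc 0) = real k * t ^ k / t"
        using 1 by (cases k) auto
      then have "((\<lambda>t. t ^ k) has_field_derivative real k * t ^ k / t) (at t)"
        using DERIV_pow[of k t UNIV] by simp
      ultimately have D: "((\<lambda>t. exp (- 1 / t) / t ^ k) has_field_derivative
          (exp (- 1 / t) / t\<^sup>2 * t ^ k - exp (- 1 / t) * (real k * t ^ k / t)) / (t ^ k * t ^ k)) (at t)"
        using 1 by (intro DERIV_divide) auto
      have "(E / t\<^sup>2 * T - E * (real k * T / t)) / (T * T) =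
          E / (T * t\<^sup>2) - real k * (E / (T * t))" if "T \<noteq> 0" for E T
        using 1 that by (simp add: divide_simps power2_eq_square) (simp add: algebra_simps)
      from this[of "t ^ k" "exp (- 1 / t)"]
      have "(exp (- 1 / t) / t\<^sup>2 * t ^ k - exp (- 1 / t) * (real k * t ^ k / t)) / (t ^ k * t ^ k) =
          exp_cutoff (k + 2) t - real k * exp_cutoff (k + 1) t"
        using 1 unfolding exp_cutoff_def power_add by simp
      with D show ?thesis by (rule DERIV_cong)
    qed
    moreover have ev: "\<forall>\<^sub>F s in nhds t. exp_cutoff k s = exp (- 1 / s) / s ^ k"
      by (rule eventually_mono[OF eventually_nhds_in_open[of "{0<..}" t]])
        (use 1 in \<open>simp_all add: exp_cutoff_def\<close>)
    ultimately show ?thesis by (simp only: DERIV_cong_ev[OF refl ev refl])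
  next
    case 2
    have ev: "\<forall>\<^sub>F s in nhds t. exp_cutoff k s = 0"
      by (rule eventually_mono[OF eventually_nhds_in_open[of "{..<0}" t]])
        (use 2 in \<open>simp_all add: exp_cutoff_def\<close>)
    moreover have "((\<lambda>t. 0) has_field_derivative
        exp_cutoff (k + 2) t - real k * exp_cutoff (k + 1) t) (at t)"
      using 2 by (simp add: exp_cutoff_def)
    ultimately show ?thesis by (simp only: DERIV_cong_ev[OF refl ev refl])
  next
    case 3
    \<comment> \<open>For h > 0 the difference quotient at 0 is exactly
      \<open>exp_cutoff (k + 1) h\<close>, so the known limit of that member applies.\<close>
    have r: "((\<lambda>h. (exp_cutoff k (0 + h) - exp_cutoff k 0) / h) \<longlongrightarrow> 0) (at_right 0)"
      by (rule Lim_transform_eventually[OF exp_cutoff_tendsto[of "k + 1"]])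
         (auto simp: exp_cutoff_def eventually_at_filter field_simps)
    have l: "((\<lambda>h. (exp_cutoff k (0 + h) - exp_cutoff k 0) / h) \<longlongrightarrow> 0) (at_left 0)"
      by (rule Lim_transform_eventually[OF tendsto_const])
         (auto simp: exp_cutoff_def eventually_at_filter field_simps)
    have "(exp_cutoff k has_field_derivative 0) (at 0)"
      unfolding DERIV_def using r l by (simp add: filterlim_split_at)
    then show ?thesis using 3 by (simp add: exp_cutoff_def)
  qed
qed

lemma smooth_exp_cutoff: "smooth (exp_cutoff k)"
  unfolding smooth_def
proof
  fix n show "times_differentiable n (exp_cutoff k)"
  proof (induction n arbitrary: k)
    case (Suc n)
    show ?case
    proof (rule times_differentiable_SucI[OF exp_cutoff_DERIV])
      show "times_differentiable n (\<lambda>t. exp_cutoff (k + 2) t - real k * exp_cutoff (k + 1) t)"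
        using times_differentiable_add[OF Suc[of "k + 2"]
            times_differentiable_mult[OF times_differentiable_const[of n "- real k"] Suc[of "k + 1"]]]
        by simp
    qed
  qed simp
qed

text \<open>Not a mollifier: the support stays in [a, b] for every n and only the flanks steepen, so
  the functions tend to the indicator of (a, b) and stay below 1. Testing with them therefore yields
  integrals over intervals in the limit.\<close>

definition bump :: "real \<Rightarrow> real \<Rightarrow> nat \<Rightarrow> real \<Rightarrow> real" where
  "bump a b n t = exp_cutoff 0 (real (Suc n) * (t - a)) * exp_cutoff 0 (real (Suc n) * (b - t))"

lemma smooth_bump: "smooth (bump a b n)"
proof -
  have "smooth (\<lambda>t. exp_cutoff 0 (real (Suc n) * t + (- real (Suc n) * a)) *
      exp_cutoff 0 (- real (Suc n) * t + real (Suc n) * b))"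
    by (intro smooth_mult smooth_affine smooth_exp_cutoff)
  then show ?thesis unfolding bump_def by (simp add: algebra_simps)
qed

lemma exp_cutoff_0_bounds: "0 \<le> exp_cutoff 0 t" "exp_cutoff 0 t \<le> 1"
  by (auto simp: exp_cutoff_def)

lemma bump_bounds: "0 \<le> bump a b n t" "bump a b n t \<le> 1"
  using exp_cutoff_0_bounds by (auto simp: bump_def intro!: mult_le_one)

lemma bump_outside: "t \<notin> {a<..<b} \<Longrightarrow> bump a b n t = 0"
  by (auto simp: bump_def exp_cutoff_def zero_less_mult_iff)

lemma bump_pos: "t \<in> {a<..<b} \<Longrightarrow> 0 < bump a b n t"
  by (auto simp: bump_def exp_cutoff_def zero_less_mult_iff)

lemma bump_tendsto: "(\<lambda>n. bump a b n t) \<longlonglongrightarrow> indicator {a<..<b} t"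
proof (cases "t \<in> {a<..<b}")
  case True
  have *: "(\<lambda>n. exp_cutoff 0 (real (Suc n) * x)) \<longlonglongrightarrow> 1" if "x > 0" for x
  proof -
    have "(\<lambda>n. exp (- 1 / (real (Suc n) * x))) \<longlonglongrightarrow> 1" using that by real_asymp
    then show ?thesis using that by (simp add: exp_cutoff_def)
  qed
  show ?thesis
    unfolding bump_def using tendsto_mult[OF *[of "t - a"] *[of "b - t"]] True by simp
qed (simp add: bump_outside)

subsection \<open>Monotonicity from distributional inequalities\<close>

lemma test_function_iff_smooth:
  "test_function a b \<phi> \<longleftrightarrow> smooth \<phi> \<and>
     compact (closure {t. \<phi> t \<noteq> 0}) \<and> closure {t. \<phi> t \<noteq> 0} \<subseteq> {a<..<b}"
  by (simp add: test_function_def smooth_iff)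

lemma test_functionI:
  assumes "smooth \<phi>" "A < a" "b < B" "\<And>t. t \<notin> {a..b} \<Longrightarrow> \<phi> t = 0"
  shows "test_function A B \<phi>"
proof -
  have sub: "closure {t. \<phi> t \<noteq> 0} \<subseteq> {a..b}"
    using assms(4) by (intro closure_minimal subsetI CollectI) (blast, simp)
  moreover have "compact (closure {t. \<phi> t \<noteq> 0})"
    using sub bounded_subset[OF bounded_closed_interval] by (auto simp: compact_eq_bounded_closed)
  ultimately show ?thesis
    using assms by (auto simp: test_function_iff_smooth)
qed

text \<open>Reduces integrals over (A, B) to a compact subinterval, where local integrability
  suffices. The interval outside which \<phi> vanishes is open, so \<phi> is zero at a and b too and
  boundary terms disappear.\<close>

lemma test_function_support:
  assumes "test_function A B \<phi>" "A < B"
  obtains a b where "A < a" "a < b" "b < B" "\<And>t. t \<notin> {a<..<b} \<Longrightarrow> \<phi> t = 0"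
    "\<And>t. t \<notin> {a<..<b} \<Longrightarrow> deriv \<phi> t = 0"
proof -
  let ?S = "closure {t. \<phi> t \<noteq> 0}"
  have c: "compact ?S" and s: "?S \<subseteq> {A<..<B}" and sm: "smooth \<phi>"
    using assms by (auto simp: test_function_iff_smooth)
  obtain a b where ab: "A < a" "a < b" "b < B" "?S \<subseteq> {a<..<b}"
  proof (cases "?S = {}")
    case True
    obtain a where "A < a" "a < B" using dense assms(2) by blast
    moreover obtain b where "a < b" "b < B" using dense \<open>a < B\<close> by blast
    ultimately show ?thesis by (intro that[of a b]) (simp_all add: True)
  next
    case False
    obtain m where m: "m \<in> ?S" "\<And>t. t \<in> ?S \<Longrightarrow> m \<le> t"
      using compact_attains_inf[OF c False] by blast
    obtain M where M: "M \<in> ?S" "\<And>t. t \<in> ?S \<Longrightarrow> t \<le> M"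
      using compact_attains_sup[OF c False] by blast
    have "A < m" "M < B" using m(1) M(1) s by auto
    obtain a where a: "A < a" "a < m" using dense[OF \<open>A < m\<close>] by blast
    obtain b where b: "M < b" "b < B" using dense[OF \<open>M < B\<close>] by blast
    show ?thesis
    proof (rule that[OF a(1) _ b(2)])
      show "a < b" using a(2) b(1) m(2)[OF M(1)] by linarith
      show "?S \<subseteq> {a<..<b}" using m(2) M(2) a(2) b(1) by fastforce
    qed
  qed
  have z: "\<phi> t = 0" if "t \<notin> ?S" for t
    using that subsetD[OF closure_subset, of t "{t. \<phi> t \<noteq> 0}"] by blast
  have "deriv \<phi> t = 0" if "t \<notin> {a<..<b}" for t
  proof -
    have "t \<in> - ?S" using ab(4) that by blast
    then have "\<forall>\<^sub>F x in nhds t. x \<in> - ?S" by (intro eventually_nhds_in_open) auto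
    then have ev: "\<forall>\<^sub>F x in nhds t. \<phi> x = 0" by (rule eventually_mono) (rule z, erule ComplD)
    have "((\<lambda>_. 0::real) has_field_derivative 0) (at t)" by simp
    then have "(\<phi> has_field_derivative 0) (at t)"
      unfolding DERIV_cong_ev[OF refl ev refl] .
    then show ?thesis by (rule DERIV_imp_deriv)
  qed
  moreover have "\<phi> t = 0" if "t \<notin> {a<..<b}" for t
    using z ab(4) that by blast
  ultimately show ?thesis by (intro that[of a b] ab(1-3)) simp_all
qed

section \<open>Testing with differences of smooth steps\<close>

lemma bump_measurable [measurable]: "bump a b n \<in> borel_measurable lebesgue"
  using smooth_continuous[OF smooth_bump, of UNIV]
  by (intro measurable_completion) (simp add: borel_measurable_continuous_onI)

text \<open>A primitive of the normalized bump. The difference of two such steps has compact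
  support, and its derivative is a difference of two densities of integral 1.\<close>

lemma smooth_step:
  assumes "a < b"
  obtains \<sigma> where "smooth \<sigma>" "(LINT t|lebesgue. bump a b n t) > 0"
    "\<And>t. (\<sigma> has_field_derivative bump a b n t / (LINT t|lebesgue. bump a b n t)) (at t)"
    "\<And>t. t \<le> a \<Longrightarrow> \<sigma> t = 0" "\<And>t. b \<le> t \<Longrightarrow> \<sigma> t = 1" "\<And>t. 0 \<le> \<sigma> t" "\<And>t. \<sigma> t \<le> 1"
proof -
  define S where "S = (LINT t|lebesgue. bump a b n t)"
  have cont: "isCont (bump a b n) x" for x
    using smooth_continuous[OF smooth_bump, of UNIV] continuous_on_eq_continuous_at[OF open_UNIV] by blast
  obtain P where P: "\<And>x. (P has_field_derivative bump a b n x) (at x)"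
    using einterval_antiderivative[of "-\<infinity>" "\<infinity>" "bump a b n"] cont
    by (auto simp: has_real_derivative_iff_has_vector_derivative)
  have S: "S = P b - P a"
  proof -
    have "(LINT t|lborel. bump a b n t * indicator {a..b} t) = P b - P a"
      by (rule integral_FTC_Icc_real[OF less_imp_le[OF assms] P]) (use cont in auto)
    moreover have "bump a b n t * indicator {a..b} t = bump a b n t" for t
      using bump_outside[of t a b n] by (cases "t \<in> {a<..<b}") (auto simp: indicator_def)
    ultimately show ?thesis
      unfolding S_def using cont
      by (subst integral_completion) (auto intro!: borel_measurable_continuous_onI continuous_at_imp_continuous_on)
  qed
  have mono: "P x \<le> P y" if "x \<le> y" for x y
  proof (rule DERIV_nonneg_imp_nondecreasing[OF that, of P])
    show "\<exists>d. (P has_field_derivative d) (at t) \<and> 0 \<le> d" for t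
      using P[of t] bump_bounds(1)[of a b n t] by auto
  qed
  have const: "P x = P y" if "x \<le> y" and z: "\<And>t. x < t \<Longrightarrow> t < y \<Longrightarrow> bump a b n t = 0" for x y
  proof (cases "x = y")
    case False
    have "P y = P x"
    proof (rule DERIV_isconst_end[of x y P])
      show "continuous_on {x..y} P"
        by (intro DERIV_continuous_on[of _ _ "bump a b n"] has_field_derivative_at_within[OF P])
      show "x < y" using that False by simp
      fix t assume t: "x < t" "t < y"
      show "(P has_field_derivative 0) (at t)"
        using P[of t] z[OF t] by simp
    qed
    then show ?thesis by simp
  qed simp
  have Ppos: "P a < P b"
  proof (rule DERIV_pos_imp_increasing_open[OF assms, of P])
    show "continuous_on {a..b} P"
      by (intro DERIV_continuous_on[of _ _ "bump a b n"] has_field_derivative_at_within[OF P])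
    fix t assume "a < t" "t < b"
    then show "\<exists>y. (P has_field_derivative y) (at t) \<and> 0 < y"
      using P[of t] bump_pos[of t a b n] by auto
  qed
  define \<sigma> where "\<sigma> t = (P t - P a) / S" for t
  have d: "(\<sigma> has_field_derivative bump a b n t / S) (at t)" for t
    unfolding \<sigma>_def using Ppos S by (auto intro!: derivative_eq_intros P)
  have z: "\<sigma> t = 0" if "t \<le> a" for t
    using const[OF that] bump_outside[of _ a b n] by (auto simp: \<sigma>_def)
  have o: "\<sigma> t = 1" if "b \<le> t" for t
    using const[OF that] bump_outside[of _ a b n] Ppos S by (auto simp: \<sigma>_def)
  have m: "\<sigma> s \<le> \<sigma> t" if "s \<le> t" for s t
    using mono[OF that] Ppos S by (auto simp: \<sigma>_def divide_right_mono)
  have "smooth \<sigma>"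
    by (rule smooth_antiderivative[OF d])
       (use smooth_mult[OF smooth_bump smooth_const, of a b n "1 / S"] in simp)
  moreover have "0 \<le> \<sigma> t" for t
    using m[of "min t a" t] z[of "min t a"] by simp
  moreover have "\<sigma> t \<le> 1" for t
    using m[of t "max t b"] o[of "max t b"] by simp
  ultimately show ?thesis
    using that[of \<sigma>] d z o Ppos S unfolding S_def by simp
qed

lemma integrable_times_bump:
  assumes "set_integrable lebesgue {a..b} g"
  shows "integrable lebesgue (\<lambda>t. g t * bump a b n t)"
    and "(\<lambda>n. LINT t|lebesgue. g t * bump a b n t) \<longlonglongrightarrow> (LINT t:{a<..<b}|lebesgue. g t)"
proof -
  let ?g = "\<lambda>t. indicator {a..b} t * g t"
  have g: "integrable lebesgue ?g" using assms by (simp add: set_integrable_def)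
  then have [measurable]: "?g \<in> borel_measurable lebesgue" by simp
  have eq: "g t * bump a b n t = ?g t * bump a b n t" for n t
    using bump_outside[of t a b n] by (cases "t \<in> {a<..<b}") (auto simp: indicator_def)
  have bd: "norm (?g t * bump a b n t) \<le> \<bar>?g t\<bar>" for n t
    using bump_bounds[of a b n t] by (auto simp: abs_mult mult_left_le)
  show "integrable lebesgue (\<lambda>t. g t * bump a b n t)"
    unfolding eq by (rule Bochner_Integration.integrable_bound[OF g]) (use bd in auto)
  have "(\<lambda>n. LINT t|lebesgue. ?g t * bump a b n t) \<longlonglongrightarrow> (LINT t|lebesgue. ?g t * indicator {a<..<b} t)"
  proof (rule integral_dominated_convergence[where w = "\<lambda>t. \<bar>?g t\<bar>"])
    show "AE t in lebesgue. (\<lambda>n. ?g t * bump a b n t) \<longlonglongrightarrow> ?g t * indicator {a<..<b} t"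
      by (intro AE_I2 tendsto_mult tendsto_const bump_tendsto)
  qed (use g bd in \<open>auto intro!: integrable_abs
      borel_measurable_times[OF \<open>?g \<in> borel_measurable lebesgue\<close>] borel_measurable_indicator\<close>)
  also have "(LINT t|lebesgue. ?g t * indicator {a<..<b} t) = (LINT t:{a<..<b}|lebesgue. g t)"
    unfolding set_lebesgue_integral_def
    by (intro Bochner_Integration.integral_cong) (auto simp: indicator_def)
  finally show "(\<lambda>n. LINT t|lebesgue. g t * bump a b n t) \<longlonglongrightarrow> (LINT t:{a<..<b}|lebesgue. g t)"
    unfolding eq .
qed

lemma bump_integral_tendsto:
  assumes "a < b"
  shows "(\<lambda>n. LINT t|lebesgue. bump a b n t) \<longlonglongrightarrow> b - a"
proof -
  have "set_integrable lebesgue {a..b} (\<lambda>t. 1::real)"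
    using lmeasurable_interval(1)[of a b] by (simp add: set_integrable_def fmeasurable_def)
  from integrable_times_bump(2)[OF this] show ?thesis
    using assms by (simp add: set_lebesgue_integral_def)
qed

text \<open>The derivative of the test function is the normalized bump on (a, b) minus the one on
  (c, e), so the distributional inequality compares two weighted averages of g. Letting the bumps
  tend to indicators gives plain averages.\<close>

lemma averages_decreasing_of_distr:
  fixes g :: "real \<Rightarrow> real"
  assumes loc: "\<And>a b. A < a \<Longrightarrow> b < B \<Longrightarrow> set_integrable lebesgue {a..b} g"
    and distr: "\<And>\<phi>. test_function A B \<phi> \<Longrightarrow> (\<And>t. 0 \<le> \<phi> t) \<Longrightarrow>
      0 \<le> (LINT t:{A<..<B}|lebesgue. g t * deriv \<phi> t)"
    and ord: "A < a" "a < b" "b \<le> c" "c < e" "e < B"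
  shows "(LINT t:{c<..<e}|lebesgue. g t) / (e - c) \<le> (LINT t:{a<..<b}|lebesgue. g t) / (b - a)"
proof (rule LIMSEQ_le)
  let ?S = "\<lambda>a b n. LINT t|lebesgue. bump a b n t"
  have ga: "set_integrable lebesgue {a..b} g" and gc: "set_integrable lebesgue {c..e} g"
    using ord loc by auto
  show "(\<lambda>n. (LINT t|lebesgue. g t * bump c e n t) / ?S c e n) \<longlonglongrightarrow>
      (LINT t:{c<..<e}|lebesgue. g t) / (e - c)"
    using ord by (intro tendsto_divide integrable_times_bump gc bump_integral_tendsto) auto
  show "(\<lambda>n. (LINT t|lebesgue. g t * bump a b n t) / ?S a b n) \<longlonglongrightarrow>
      (LINT t:{a<..<b}|lebesgue. g t) / (b - a)"
    using ord by (intro tendsto_divide integrable_times_bump ga bump_integral_tendsto) auto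
  have "(LINT t|lebesgue. g t * bump c e n t) / ?S c e n \<le> (LINT t|lebesgue. g t * bump a b n t) / ?S a b n"
    for n
  proof -
    obtain \<sigma> where \<sigma>: "smooth \<sigma>" "?S a b n > 0" "\<And>t. (\<sigma> has_field_derivative bump a b n t / ?S a b n) (at t)"
      "\<And>t. t \<le> a \<Longrightarrow> \<sigma> t = 0" "\<And>t. b \<le> t \<Longrightarrow> \<sigma> t = 1" "\<And>t. 0 \<le> \<sigma> t" "\<And>t. \<sigma> t \<le> 1"
      by (rule smooth_step[OF ord(2), of n]) (rule that)
    obtain \<tau> where \<tau>: "smooth \<tau>" "?S c e n > 0" "\<And>t. (\<tau> has_field_derivative bump c e n t / ?S c e n) (at t)"
      "\<And>t. t \<le> c \<Longrightarrow> \<tau> t = 0" "\<And>t. e \<le> t \<Longrightarrow> \<tau> t = 1" "\<And>t. 0 \<le> \<tau> t" "\<And>t. \<tau> t \<le> 1"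
      by (rule smooth_step[OF ord(4), of n]) (rule that)
    \<comment> \<open>Since b \<le> c, the first step has reached 1 before the second one starts;
      this makes the difference nonnegative. Beyond e both are 1 and cancel.\<close>
    define \<phi> where "\<phi> t = \<sigma> t + (-1) * \<tau> t" for t
    have d: "deriv \<phi> t = bump a b n t / ?S a b n - bump c e n t / ?S c e n" for t
      unfolding \<phi>_def using \<sigma>(3) \<tau>(3) by (intro DERIV_imp_deriv) (auto intro!: derivative_eq_intros)
    have "smooth \<phi>"
      unfolding \<phi>_def using \<sigma>(1) \<tau>(1) by (intro smooth_add smooth_mult smooth_const)
    moreover have "\<phi> t = 0" if "t \<notin> {a..e}" for t
      using that \<sigma>(4,5)[of t] \<tau>(4,5)[of t] ord by (auto simp: \<phi>_def not_le)
    ultimately have "test_function A B \<phi>"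
      using ord by (intro test_functionI) auto
    moreover have "0 \<le> \<phi> t" for t
      using \<sigma>(5,6)[of t] \<tau>(4,7)[of t] ord by (cases "t \<le> c") (auto simp: \<phi>_def)
    ultimately have "0 \<le> (LINT t:{A<..<B}|lebesgue. g t * deriv \<phi> t)"
      by (rule distr)
    also have "\<dots> = (LINT t|lebesgue. g t * bump a b n t / ?S a b n - g t * bump c e n t / ?S c e n)"
      unfolding set_lebesgue_integral_def
    proof (intro Bochner_Integration.integral_cong refl)
      fix t
      have "bump a b n t = 0 \<and> bump c e n t = 0" if "t \<notin> {A<..<B}"
        using that ord by (intro conjI bump_outside) auto
      then show "indicator {A<..<B} t *\<^sub>R (g t * deriv \<phi> t) =
          g t * bump a b n t / ?S a b n - g t * bump c e n t / ?S c e n"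
        by (cases "t \<in> {A<..<B}") (simp_all add: d right_diff_distrib)
    qed
    also have "\<dots> = (LINT t|lebesgue. g t * bump a b n t) / ?S a b n -
        (LINT t|lebesgue. g t * bump c e n t) / ?S c e n"
      using integrable_times_bump(1)[OF ga] integrable_times_bump(1)[OF gc]
      by (subst Bochner_Integration.integral_diff) auto
    finally show ?thesis by simp
  qed
  then show "\<exists>N. \<forall>n\<ge>N. (LINT t|lebesgue. g t * bump c e n t) / ?S c e n \<le>
      (LINT t|lebesgue. g t * bump a b n t) / ?S a b n" by blast
qed

text \<open>The half-lines are stable under intersection and generate the Borel sets. The sets with
  vanishing integral are closed under complements, thanks to \<open>total\<close>, and under
  disjoint unions, so they include all Borel sets.\<close>

lemma AE_zero_of_integral_greaterThan:
  fixes h :: "real \<Rightarrow> real"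
  assumes h: "integrable lebesgue h" and zero: "\<And>x. (LINT t:{x<..}|lebesgue. h t) = 0"
    and total: "(LINT t|lebesgue. h t) = 0"
  shows "AE t in lebesgue. h t = 0"
proof -
  have si: "set_integrable lebesgue E h" if "E \<in> sets borel" for E
    unfolding set_integrable_def using that by (intro integrable_mult_indicator h) auto
  have borel: "(LINT t:E|lebesgue. h t) = 0" if "E \<in> sets borel" for E
  proof -
    have st: "Int_stable (range (greaterThan :: real \<Rightarrow> _))"
    proof (rule Int_stableI, safe)
      fix x y :: real
      have "{x<..} \<inter> {y<..} = {max x y<..}" by auto
      then show "{x<..} \<inter> {y<..} \<in> range greaterThan" by blast
    qed
    have "sets (borel :: real measure) = sigma_sets UNIV (range greaterThan)"
      by (simp add: borel_Ioi)
    with that have E: "E \<in> sigma_sets UNIV (range greaterThan)" and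
      b: "\<And>D. D \<in> sigma_sets UNIV (range greaterThan) \<Longrightarrow> D \<in> sets (borel :: real measure)" by auto
    show ?thesis
    proof (rule sigma_sets_induct_disjoint[OF st _ E, where P = "\<lambda>E. (LINT t:E|lebesgue. h t) = 0"])
      fix D assume D: "D \<in> sigma_sets UNIV (range (greaterThan :: real \<Rightarrow> _))"
        and z: "(LINT t:D|lebesgue. h t) = 0"
      have "(LINT t:UNIV|lebesgue. h t) = (LINT t:D|lebesgue. h t) + (LINT t:UNIV - D|lebesgue. h t)"
        using set_integral_Un[of D "UNIV - D" lebesgue h] si b[OF D] by auto
      then show "(LINT t:UNIV - D|lebesgue. h t) = 0"
        using z total by (simp add: set_lebesgue_integral_def)
    next
      fix D :: "nat \<Rightarrow> real set"
      assume D: "disjoint_family D" "range D \<subseteq> sigma_sets UNIV (range greaterThan)"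
        and z: "\<And>i. (LINT t:D i|lebesgue. h t) = 0"
      have Db: "D i \<in> sets borel" for i using D(2) b by auto
      have "(LINT t:(\<Union>i. D i)|lebesgue. h t) = (\<Sum>i. (LINT t:D i|lebesgue. h t))"
        using Db D(1) by (intro lebesgue_integral_countable_add si sets.countable_UN)
          (auto simp: disjoint_family_on_def)
      then show "(LINT t:(\<Union>i. D i)|lebesgue. h t) = 0" by (simp add: z)
    qed (auto simp: zero set_lebesgue_integral_def[of _ "{}"])
  qed
  \<comment> \<open>The vanishing criterion is applied to \<open>lborel\<close>, hence a Borel
    representative replaces h.\<close>
  obtain h' where h': "h' \<in> borel_measurable lborel" "AE t in lborel. h t = h' t"
    using completion_ex_borel_measurable_real[of h lborel] h by auto
  have ae: "AE t in lebesgue. h t = h' t" using h'(2) by (rule AE_completion)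
  have meas: "h' \<in> borel_measurable lebesgue" using h'(1) by (rule measurable_completion)
  have "integrable lebesgue h'"
  proof (subst integrable_cong_AE[of _ _ h])
    show "AE t in lebesgue. h' t = h t" using ae by eventually_elim simp
  qed (use h meas in auto)
  then have "integrable lborel h'" using h'(1) by (simp add: integrable_completion)
  moreover have "(LINT t:E|lborel. h' t) = 0" if "E \<in> sets lborel" for E
  proof -
    have "(LINT t:E|lborel. h' t) = (LINT t:E|lebesgue. h' t)"
      unfolding set_lebesgue_integral_def using that h'(1)
      by (subst integral_completion) (auto intro!: borel_measurable_times)
    also have "\<dots> = (LINT t:E|lebesgue. h t)"
      unfolding set_lebesgue_integral_def
    proof (intro integral_cong_AE borel_measurable_scaleR borel_measurable_indicator meas)
      show "AE t in lebesgue. indicator E t *\<^sub>R h' t = indicator E t *\<^sub>R h t"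
        using ae by eventually_elim simp
    qed (use that h in auto)
    finally show ?thesis using borel that by simp
  qed
  ultimately have "AE t in lborel. h' t = 0" by (rule sigma_finite_measure.density_zero[OF sigma_finite_lborel])
  then have "AE t in lborel. h t = 0" using h'(2) by eventually_elim simp
  then show ?thesis by (rule AE_completion)
qed

lemma set_integral_interval_eq_integral:
  fixes g :: "real \<Rightarrow> real"
  assumes "set_integrable lebesgue {a..b} g"
  shows "(LINT t:{a<..<b}|lebesgue. g t) = integral {a..b} g"
proof -
  have "set_integrable lebesgue {a<..<b} g"
    by (rule set_integrable_subset[OF assms]) auto
  then show ?thesis
    by (simp add: set_lebesgue_integral_eq_integral integral_open_interval_real)
qed

text \<open>Subintervals with rational endpoints cover (A, B), and there are only countably many of
  them.\<close>

lemma AE_open_interval_exhaust: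
  fixes A B :: real
  assumes "\<And>a b. A < a \<Longrightarrow> a < b \<Longrightarrow> b < B \<Longrightarrow> AE t in M. t \<in> {a<..<b} \<longrightarrow> P t"
  shows "AE t in M. t \<in> {A<..<B} \<longrightarrow> P t"
proof -
  have "AE t in M. A < real_of_rat p' \<longrightarrow> real_of_rat q' < B \<longrightarrow>
      t \<in> {real_of_rat p'<..<real_of_rat q'} \<longrightarrow> P t" for p' q'
    using assms[of "real_of_rat p'" "real_of_rat q'"]
    by (cases "A < real_of_rat p' \<and> real_of_rat p' < real_of_rat q' \<and> real_of_rat q' < B")
       (auto simp: not_less)
  then have "AE t in M. \<forall>p' q'. A < real_of_rat p' \<longrightarrow> real_of_rat q' < B \<longrightarrow>
      t \<in> {real_of_rat p'<..<real_of_rat q'} \<longrightarrow> P t"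
    by (simp add: AE_all_countable)
  then show ?thesis
  proof (rule AE_mp, intro AE_I2 impI)
    fix t assume *: "\<forall>p' q'. A < real_of_rat p' \<longrightarrow> real_of_rat q' < B \<longrightarrow>
      t \<in> {real_of_rat p'<..<real_of_rat q'} \<longrightarrow> P t" and t: "t \<in> {A<..<B}"
    obtain p where "A < real_of_rat p" "real_of_rat p < t"
      using of_rat_dense[of A t] t by auto
    moreover obtain q where "t < real_of_rat q" "real_of_rat q < B"
      using of_rat_dense[of t B] t by auto
    ultimately show "P t" using * by auto
  qed
qed

lemma AE_zero_of_interval_integrals:
  fixes g :: "real \<Rightarrow> real"
  assumes loc: "\<And>a b. A < a \<Longrightarrow> b < B \<Longrightarrow> set_integrable lebesgue {a..b} g"
    and zero: "\<And>a b. A < a \<Longrightarrow> a < b \<Longrightarrow> b < B \<Longrightarrow> integral {a..b} g = 0"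
  shows "AE t in lebesgue. t \<in> {A<..<B} \<longrightarrow> g t = 0"
proof (rule AE_open_interval_exhaust)
  fix a b assume ab: "A < a" "a < b" "b < B"
  let ?h = "\<lambda>t. indicator {a<..<b} t * g t"
  have z: "(LINT t:{x<..<b}|lebesgue. g t) = 0" if "a \<le> x" for x
  proof (cases "x < b")
    case True
    then show ?thesis
      using that ab zero[of x b] loc[of x b] by (simp add: set_integral_interval_eq_integral)
  qed (simp add: set_lebesgue_integral_def)
  have "integrable lebesgue ?h"
    using set_integrable_subset[OF loc[of a b], of "{a<..<b}"] ab
    by (simp add: set_integrable_def greaterThanLessThan_subseteq_atLeastAtMost_iff)
  moreover have "(LINT t:{x<..}|lebesgue. ?h t) = 0" for x
  proof -
    have "indicator {x<..} t *\<^sub>R ?h t = indicator {max a x<..<b} t *\<^sub>R g t" for t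
      by (auto simp: indicator_def)
    then have "(LINT t:{x<..}|lebesgue. ?h t) = (LINT t:{max a x<..<b}|lebesgue. g t)"
      unfolding set_lebesgue_integral_def by (intro Bochner_Integration.integral_cong refl)
    then show ?thesis using z[of "max a x"] by simp
  qed
  moreover have "(LINT t|lebesgue. ?h t) = 0"
    using z[of a] by (simp add: set_lebesgue_integral_def)
  ultimately have "AE t in lebesgue. ?h t = 0" by (rule AE_zero_of_integral_greaterThan)
  then show "AE t in lebesgue. t \<in> {a<..<b} \<longrightarrow> g t = 0"
    by eventually_elim (auto simp: indicator_def split: if_splits)
qed

section \<open>Monotone representatives\<close>

lemma antimono_on_set_integrable:
  fixes G :: "real \<Rightarrow> real"
  assumes "antimono_on {A<..<B} G" "A < a" "b < B"
  shows "set_integrable lebesgue {a..b} G"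
proof (cases "a \<le> b")
  case True
  \<comment> \<open>Clamping the argument to [a, b] gives a function that is monotone on the whole
    line, hence Borel, and agrees with G on [a, b].\<close>
  let ?G = "\<lambda>t. G (max a (min b t))"
  have anti: "G y \<le> G x" if "A < x" "x \<le> y" "y < B" for x y
    using assms(1) that by (auto simp: monotone_on_def)
  have "mono (\<lambda>t. - ?G t)"
    using True assms by (intro monoI) (auto intro!: anti)
  then have "(\<lambda>t. - ?G t) \<in> borel_measurable borel" by (rule borel_measurable_mono)
  then have m: "?G \<in> borel_measurable lebesgue"
    using borel_measurable_uminus_eq by (intro measurable_completion) auto
  have "integrable lebesgue (\<lambda>t. indicator {a..b} t *\<^sub>R (max \<bar>G a\<bar> \<bar>G b\<bar>))"
    using lmeasurable_interval(1)[of a b] by (intro integrable_scaleR_left) (simp add: fmeasurable_def)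
  then have "integrable lebesgue (\<lambda>t. indicator {a..b} t *\<^sub>R ?G t)"
  proof (rule Bochner_Integration.integrable_bound)
    have "\<bar>G t\<bar> \<le> max \<bar>G a\<bar> \<bar>G b\<bar>" if "t \<in> {a..b}" for t
      using anti[of a t] anti[of t b] that assms by auto
    then show "AE t in lebesgue. norm (indicator {a..b} t *\<^sub>R ?G t)
        \<le> norm (indicator {a..b} t *\<^sub>R (max \<bar>G a\<bar> \<bar>G b\<bar>))"
      by (intro AE_I2) (auto simp: indicator_def)
  qed (intro borel_measurable_scaleR borel_measurable_indicator m, simp)
  moreover have "(\<lambda>t. indicator {a..b} t *\<^sub>R ?G t) = (\<lambda>t. indicator {a..b} t *\<^sub>R G t)"
    by (auto simp: indicator_def)
  ultimately show ?thesis by (simp add: set_integrable_def)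
qed (simp add: set_integrable_def)

text \<open>Decreasing averages squeeze the integral of g over [x, y] between the same bounds as
  that of any decreasing function with values G x and G y at the ends. The discrepancy between g and
  G is removed by subdivision.\<close>

lemma antimono_representative:
  fixes g :: "real \<Rightarrow> real"
  assumes loc: "\<And>a b. A < a \<Longrightarrow> b < B \<Longrightarrow> set_integrable lebesgue {a..b} g"
    and avg: "\<And>a b c e. A < a \<Longrightarrow> a < b \<Longrightarrow> b \<le> c \<Longrightarrow> c < e \<Longrightarrow> e < B \<Longrightarrow>
      integral {c..e} g / (e - c) \<le> integral {a..b} g / (b - a)"
  obtains G where "antimono_on {A<..<B} G" "AE t in lebesgue. t \<in> {A<..<B} \<longrightarrow> g t = G t"
proof -
  \<comment> \<open>G x is the supremum of the averages of g over all intervals that start at x or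
    later; an average over an interval just to the left of x bounds them.\<close>
  define P where "P x = {(c, e). x \<le> c \<and> c < e \<and> e < B}" for x
  define a where "a = (\<lambda>(c, e). integral {c..e} g / (e - c))"
  define G where "G x = (SUP p\<in>P x. a p)" for x
  have ne: "P x \<noteq> {}" if "x < B" for x
    using dense[OF that] by (auto simp: P_def)
  have bdd: "bdd_above (a ` P x)" if "A < x" for x
  proof -
    obtain y where "A < y" "y < x" using dense[OF \<open>A < x\<close>] by blast
    then show ?thesis
      using avg by (intro bdd_aboveI2[where M = "a (y, x)"]) (auto simp: P_def a_def)
  qed
  have lower: "integral {x..y} g / (y - x) \<le> G x" if "A < x" "x < y" "y < B" for x y
    unfolding G_def using cSUP_upper[OF _ bdd[OF that(1)], of "(x, y)"] that by (auto simp: P_def a_def)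
  have upper: "G y \<le> integral {x..y} g / (y - x)" if "A < x" "x < y" "y < B" for x y
    unfolding G_def using that ne avg by (intro cSUP_least) (auto simp: P_def a_def)
  have anti: "antimono_on {A<..<B} G"
  proof (rule monotone_onI)
    fix x y assume "x \<in> {A<..<B}" "y \<in> {A<..<B}" "x \<le> y"
    then show "G y \<le> G x"
      unfolding G_def using ne bdd by (intro cSUP_subset_mono) (auto simp: P_def)
  qed
  have locG: "set_integrable lebesgue {a..b} G" if "A < a" "b < B" for a b
    using antimono_on_set_integrable[OF anti that] .
  have on: "g integrable_on {x..y}" "G integrable_on {x..y}" if "A < x" "y < B" for x y
    using loc[OF that] locG[OF that] by (auto simp: set_lebesgue_integral_eq_integral(1))
  have near: "\<bar>integral {x..y} (\<lambda>t. g t - G t)\<bar> \<le> (y - x) * (G x - G y)"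
    if "A < x" "x < y" "y < B" for x y
  proof -
    have le: "G y \<le> G t" "G t \<le> G x" if "t \<in> {x..y}" for t
      using anti that \<open>A < x\<close> \<open>y < B\<close> by (auto simp: monotone_on_def)
    have "integral {x..y} (\<lambda>_. G y) \<le> integral {x..y} G"
      by (intro integral_le on that) (use le in auto)
    moreover have "integral {x..y} G \<le> integral {x..y} (\<lambda>_. G x)"
      by (intro integral_le on that) (use le in auto)
    ultimately have "(y - x) * G y \<le> integral {x..y} G" "integral {x..y} G \<le> (y - x) * G x"
      using that by auto
    moreover have "(y - x) * G y \<le> integral {x..y} g" "integral {x..y} g \<le> (y - x) * G x"
      using lower[OF that] upper[OF that] that by (simp_all add: field_simps)
    ultimately show ?thesis
      using on[OF that(1,3)] by (simp add: integral_diff right_diff_distrib)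
  qed
  have zero: "integral {x..y} (\<lambda>t. g t - G t) = 0" if xy: "A < x" "x < y" "y < B" for x y
  proof -
    let ?D = "\<lambda>s. integral {x..s} (\<lambda>t. g t - G t)"
    \<comment> \<open>On each of n pieces of length h the error is at most h times the drop of G.
      The drops telescope, so the total is h (G x - G y), which vanishes as n grows.\<close>
    have bound: "\<bar>?D y\<bar> \<le> ((y - x) * (G x - G y)) / real n" if n: "0 < n" for n
    proof -
      define h where "h = (y - x) / real n"
      define z where "z i = x + real i * h" for i
      have h: "0 < h" using n xy by (simp add: h_def)
      have z0: "z 0 = x" "z n = y" using n by (auto simp: z_def h_def)
      have zle: "z i \<le> z j" if "i \<le> j" for i j
        using that h by (simp add: z_def mult_right_mono)
      have step: "\<bar>?D (z (Suc i)) - ?D (z i)\<bar> \<le> h * (G (z i) - G (z (Suc i)))" if "i < n" for i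
      proof -
        have r: "x \<le> z i" "z i < z (Suc i)" "z (Suc i) \<le> y"
          using zle[of 0 i] zle[of "Suc i" n] that z0 h by (auto simp: z_def distrib_right)
        have "?D (z i) + integral {z i..z (Suc i)} (\<lambda>t. g t - G t) = ?D (z (Suc i))"
          using r xy by (intro Henstock_Kurzweil_Integration.integral_combine integrable_diff on) auto
        moreover have "z (Suc i) - z i = h" by (simp add: z_def algebra_simps)
        ultimately show ?thesis using near[of "z i" "z (Suc i)"] r xy by (simp add: algebra_simps)
      qed
      have "?D y = (\<Sum>i<n. ?D (z (Suc i)) - ?D (z i))"
        by (subst sum_lessThan_telescope[of "\<lambda>i. ?D (z i)"]) (simp add: z0)
      also have "\<bar>\<dots>\<bar> \<le> (\<Sum>i<n. h * (G (z i) - G (z (Suc i))))"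
        using step by (intro order_trans[OF sum_abs] sum_mono) auto
      also have "\<dots> = h * (G x - G y)"
        using sum_lessThan_telescope'[of "\<lambda>i. G (z i)" n] z0 by (simp flip: sum_distrib_left)
      finally show ?thesis by (simp add: h_def)
    qed
    have "(\<lambda>n. ((y - x) * (G x - G y)) / real n) \<longlonglongrightarrow> 0" by (rule lim_const_over_n)
    then have "\<bar>?D y\<bar> \<le> 0"
      by (rule LIMSEQ_le_const) (use bound in \<open>auto intro!: exI[of _ 1]\<close>)
    then show ?thesis by simp
  qed
  have "AE t in lebesgue. t \<in> {A<..<B} \<longrightarrow> g t - G t = 0"
    by (rule AE_zero_of_interval_integrals) (auto intro!: set_integral_diff loc locG zero)
  then have "AE t in lebesgue. t \<in> {A<..<B} \<longrightarrow> g t = G t" by (simp)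
  then show ?thesis using that anti by blast
qed

lemma antimono_of_distr:
  fixes g :: "real \<Rightarrow> real"
  assumes loc: "\<And>a b. A < a \<Longrightarrow> b < B \<Longrightarrow> set_integrable lebesgue {a..b} g"
    and distr: "\<And>\<phi>. test_function A B \<phi> \<Longrightarrow> (\<And>t. 0 \<le> \<phi> t) \<Longrightarrow>
      0 \<le> (LINT t:{A<..<B}|lebesgue. g t * deriv \<phi> t)"
  obtains G where "antimono_on {A<..<B} G" "AE t in lebesgue. t \<in> {A<..<B} \<longrightarrow> g t = G t"
proof (rule antimono_representative[of A B g])
  fix a b c e assume ord: "A < a" "a < b" "b \<le> c" "c < e" "e < B"
  have "(LINT t:{c<..<e}|lebesgue. g t) / (e - c) \<le> (LINT t:{a<..<b}|lebesgue. g t) / (b - a)"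
    by (rule averages_decreasing_of_distr[of A B g]; fact)
  then show "integral {c..e} g / (e - c) \<le> integral {a..b} g / (b - a)"
    using loc[of a b] loc[of c e] ord by (simp add: set_integral_interval_eq_integral)
qed (erule (1) loc, erule (1) that)

lemma AE_zero_of_test_functions:
  fixes g :: "real \<Rightarrow> real"
  assumes loc: "\<And>a b. A < a \<Longrightarrow> b < B \<Longrightarrow> set_integrable lebesgue {a..b} g"
    and zero: "\<And>\<phi>. test_function A B \<phi> \<Longrightarrow> (LINT t:{A<..<B}|lebesgue. g t * \<phi> t) = 0"
  shows "AE t in lebesgue. t \<in> {A<..<B} \<longrightarrow> g t = 0"
proof (rule AE_zero_of_interval_integrals[of A B g, OF loc])
  fix a b assume ab: "A < a" "a < b" "b < B"
  have "(LINT t|lebesgue. g t * bump a b n t) = 0" for n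
  proof -
    have "indicator {A<..<B} t *\<^sub>R (g t * bump a b n t) = g t * bump a b n t" for t
      using bump_outside[of t a b n] ab by (cases "t \<in> {a<..<b}") auto
    then have "(LINT t:{A<..<B}|lebesgue. g t * bump a b n t) = (LINT t|lebesgue. g t * bump a b n t)"
      unfolding set_lebesgue_integral_def by (intro Bochner_Integration.integral_cong refl)
    moreover have "test_function A B (bump a b n)"
      using ab by (intro test_functionI[OF smooth_bump, of A a b]) (auto intro!: bump_outside)
    ultimately show ?thesis using zero by simp
  qed
  then have "(\<lambda>n. 0) \<longlonglongrightarrow> (LINT t:{a<..<b}|lebesgue. g t)"
    using integrable_times_bump(2)[OF loc[OF ab(1,3)]] by simp
  then show "integral {a..b} g = 0"
    using loc[of a b] ab by (simp add: LIMSEQ_const_iff set_integral_interval_eq_integral)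
qed

subsection \<open>Weak derivatives\<close>

lemma test_function_set_integral:
  fixes h :: "real \<Rightarrow> real"
  assumes "\<And>t. t \<notin> {a<..<b} \<Longrightarrow> h t = 0" "A < a" "b < B"
  shows "set_integrable lebesgue {A<..<B} h \<longleftrightarrow> set_integrable lebesgue {a..b} h"
    and "(LINT t:{A<..<B}|lebesgue. h t) = (LINT t:{a..b}|lebesgue. h t)"
proof -
  have "(\<lambda>t. indicator {A<..<B} t *\<^sub>R h t) = (\<lambda>t. indicator {a..b} t *\<^sub>R h t)"
  proof
    fix t show "indicator {A<..<B} t *\<^sub>R h t = indicator {a..b} t *\<^sub>R h t"
      using assms by (cases "t \<in> {a<..<b}") auto
  qed
  then show "set_integrable lebesgue {A<..<B} h \<longleftrightarrow> set_integrable lebesgue {a..b} h"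
    and "(LINT t:{A<..<B}|lebesgue. h t) = (LINT t:{a..b}|lebesgue. h t)"
    by (simp_all add: set_integrable_def set_lebesgue_integral_def)
qed

lemma set_integrable_times_continuous:
  fixes g \<phi> :: "real \<Rightarrow> real"
  assumes g: "set_integrable lebesgue {a..b} g" and \<phi>: "continuous_on {a..b} \<phi>"
  shows "set_integrable lebesgue {a..b} (\<lambda>t. g t * \<phi> t)"
proof -
  have "bounded (\<phi> ` {a..b})"
    using \<phi> by (intro compact_imp_bounded compact_continuous_image) auto
  moreover have "\<phi> \<in> borel_measurable (lebesgue_on {a..b})"
    by (rule continuous_imp_measurable_on_sets_lebesgue[OF \<phi>]) auto
  ultimately show ?thesis
    using absolutely_integrable_bounded_measurable_product_real[of \<phi> "{a..b}" g] g
    by (simp add: mult.commute)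
qed

lemma set_integrable_times_test_function:
  fixes g :: "real \<Rightarrow> real"
  assumes loc: "\<And>a b. A < a \<Longrightarrow> b < B \<Longrightarrow> set_integrable lebesgue {a..b} g"
    and \<phi>: "test_function A B \<phi>" "A < B"
  shows "set_integrable lebesgue {A<..<B} (\<lambda>t. g t * \<phi> t)"
    and "set_integrable lebesgue {A<..<B} (\<lambda>t. g t * deriv \<phi> t)"
proof -
  obtain a b where ab: "A < a" "a < b" "b < B" "\<And>t. t \<notin> {a<..<b} \<Longrightarrow> \<phi> t = 0"
    "\<And>t. t \<notin> {a<..<b} \<Longrightarrow> deriv \<phi> t = 0"
    by (rule test_function_support[OF \<phi>]) (rule that)
  have sm: "smooth \<phi>" using \<phi>(1) by (simp add: test_function_iff_smooth)
  show "set_integrable lebesgue {A<..<B} (\<lambda>t. g t * \<phi> t)"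
    by (subst test_function_set_integral(1)[of a b _ A B])
      (use ab in \<open>auto intro!: set_integrable_times_continuous loc smooth_continuous sm\<close>)
  show "set_integrable lebesgue {A<..<B} (\<lambda>t. g t * deriv \<phi> t)"
    by (subst test_function_set_integral(1)[of a b _ A B])
      (use ab in \<open>auto intro!: set_integrable_times_continuous loc smooth_continuous smooth_deriv sm\<close>)
qed

lemma integral_by_parts_test_function:
  fixes K k :: "real \<Rightarrow> real"
  assumes K: "\<And>t. A < t \<Longrightarrow> t < B \<Longrightarrow> (K has_field_derivative k t) (at t)"
    and k: "continuous_on {A<..<B} k" and \<phi>: "test_function A B \<phi>" "A < B"
  shows "(LINT t:{A<..<B}|lebesgue. K t * deriv \<phi> t) = - (LINT t:{A<..<B}|lebesgue. k t * \<phi> t)"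
proof -
  obtain a b where ab: "A < a" "a < b" "b < B" "\<And>t. t \<notin> {a<..<b} \<Longrightarrow> \<phi> t = 0"
    "\<And>t. t \<notin> {a<..<b} \<Longrightarrow> deriv \<phi> t = 0"
    by (rule test_function_support[OF \<phi>]) (rule that)
  have sm: "smooth \<phi>" using \<phi>(1) by (simp add: test_function_iff_smooth)
  have "continuous_on {A<..<B} K"
    using K by (intro continuous_at_imp_continuous_on ballI DERIV_isCont[of K "k _"]) auto
  then have locK: "set_integrable lebesgue {a..b} K" and lock: "set_integrable lebesgue {a..b} k"
    using ab k by (auto intro!: absolutely_integrable_continuous_real elim!: continuous_on_subset)
  have i: "set_integrable lebesgue {a..b} (\<lambda>t. K t * deriv \<phi> t)"
    "set_integrable lebesgue {a..b} (\<lambda>t. k t * \<phi> t)"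
    by (intro set_integrable_times_continuous locK lock smooth_continuous smooth_deriv sm)+
  have "((\<lambda>t. K t * deriv \<phi> t + k t * \<phi> t) has_integral K b * \<phi> b - K a * \<phi> a) {a..b}"
  proof (rule fundamental_theorem_of_calculus)
    fix t assume t: "t \<in> {a..b}"
    have "((\<lambda>t. K t * \<phi> t) has_field_derivative k t * \<phi> t + deriv \<phi> t * K t) (at t)"
      using K[of t] t ab smooth_DERIV[OF sm] by (intro DERIV_mult) auto
    then show "((\<lambda>t. K t * \<phi> t) has_vector_derivative K t * deriv \<phi> t + k t * \<phi> t) (at t within {a..b})"
      by (simp add: has_real_derivative_iff_has_vector_derivative has_vector_derivative_at_within algebra_simps)
  qed (use ab in simp)
  then have "integral {a..b} (\<lambda>t. K t * deriv \<phi> t) + integral {a..b} (\<lambda>t. k t * \<phi> t) = 0"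
    using ab(4)[of a] ab(4)[of b] i
    by (subst Henstock_Kurzweil_Integration.integral_add[symmetric])
      (auto simp: set_lebesgue_integral_eq_integral(1) integral_unique)
  then show ?thesis
    using i ab test_function_set_integral(2)[of a b "\<lambda>t. K t * deriv \<phi> t" A B]
      test_function_set_integral(2)[of a b "\<lambda>t. k t * \<phi> t" A B]
    by (simp add: set_lebesgue_integral_eq_integral)
qed

lemma test_function_mono:
  "test_function a b \<phi> \<Longrightarrow> A \<le> a \<Longrightarrow> b \<le> B \<Longrightarrow> test_function A B \<phi>"
  unfolding test_function_def by force

lemma test_function_set_integral_mono:
  assumes "test_function a b \<phi>" "a < b" "A \<le> a" "b \<le> B"
  shows "(LINT t:{A<..<B}|lebesgue. g t * \<phi> t) = (LINT t:{a<..<b}|lebesgue. g t * \<phi> t)"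
    and "(LINT t:{A<..<B}|lebesgue. g t * deriv \<phi> t) = (LINT t:{a<..<b}|lebesgue. g t * deriv \<phi> t)"
proof -
  obtain x y where xy: "a < x" "x < y" "y < b" "\<And>t. t \<notin> {x<..<y} \<Longrightarrow> \<phi> t = 0"
    "\<And>t. t \<notin> {x<..<y} \<Longrightarrow> deriv \<phi> t = 0"
    by (rule test_function_support[OF assms(1,2)]) (rule that)
  show "(LINT t:{A<..<B}|lebesgue. g t * \<phi> t) = (LINT t:{a<..<b}|lebesgue. g t * \<phi> t)"
    using xy assms test_function_set_integral(2)[of x y "\<lambda>t. g t * \<phi> t" A B]
      test_function_set_integral(2)[of x y "\<lambda>t. g t * \<phi> t" a b] by simp
  show "(LINT t:{A<..<B}|lebesgue. g t * deriv \<phi> t) = (LINT t:{a<..<b}|lebesgue. g t * deriv \<phi> t)"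
    using xy assms test_function_set_integral(2)[of x y "\<lambda>t. g t * deriv \<phi> t" A B]
      test_function_set_integral(2)[of x y "\<lambda>t. g t * deriv \<phi> t" a b] by simp
qed

lemma distr_derivD:
  assumes "distr_deriv A B v w"
  shows "A < a \<Longrightarrow> b < B \<Longrightarrow> set_integrable lebesgue {a..b} v"
    and "A < a \<Longrightarrow> b < B \<Longrightarrow> set_integrable lebesgue {a..b} w"
    and "test_function A B \<phi> \<Longrightarrow>
      (LINT t:{A<..<B}|lebesgue. v t * deriv \<phi> t) = - (LINT t:{A<..<B}|lebesgue. w t * \<phi> t)"
proof -
  have li: "set_integrable lebesgue {a..b} u" if "locally_integrable A B u" "A < a" "b < B" for u
  proof -
    have "integrable (lebesgue_on {a..b}) u"
    proof (rule that(1)[unfolded locally_integrable_def, rule_format])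
      show "compact {a..b} \<and> {a..b} \<subseteq> {A<..<B}" using that(2,3) by auto
    qed
    then show ?thesis by (simp add: integrable_restrict_space set_integrable_def)
  qed
  show "A < a \<Longrightarrow> b < B \<Longrightarrow> set_integrable lebesgue {a..b} v"
    and "A < a \<Longrightarrow> b < B \<Longrightarrow> set_integrable lebesgue {a..b} w"
    using assms li by (auto simp: distr_deriv_def)
  show "test_function A B \<phi> \<Longrightarrow>
      (LINT t:{A<..<B}|lebesgue. v t * deriv \<phi> t) = - (LINT t:{A<..<B}|lebesgue. w t * \<phi> t)"
    using assms by (simp add: distr_deriv_def integral_restrict_space set_lebesgue_integral_def)
qed

text \<open>Membership in \<open>W1q_weighted\<close> supplies a derivative for each R' < R
  separately. Uniqueness identifies it with the single w on (0, R), which thereby inherits the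
  weighted integrability.\<close>

lemma distr_deriv_unique:
  assumes v: "distr_deriv A B v w" and v': "distr_deriv a b v w'" and ab: "a < b" "A \<le> a" "b \<le> B"
  shows "AE t in lebesgue. t \<in> {a<..<b} \<longrightarrow> w t = w' t"
proof -
  have w: "set_integrable lebesgue {x..y} w" "set_integrable lebesgue {x..y} w'" if "a < x" "y < b" for x y
    using that ab distr_derivD(2)[OF v] distr_derivD(2)[OF v'] by auto
  have "AE t in lebesgue. t \<in> {a<..<b} \<longrightarrow> w t - w' t = 0"
  proof (rule AE_zero_of_test_functions)
    show "set_integrable lebesgue {x..y} (\<lambda>t. w t - w' t)" if "a < x" "y < b" for x y
      using w[OF that] by (rule set_integral_diff)
    fix \<phi> assume \<phi>: "test_function a b \<phi>"
    have "(LINT t:{a<..<b}|lebesgue. w t * \<phi> t) = (LINT t:{a<..<b}|lebesgue. w' t * \<phi> t)"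
      using distr_derivD(3)[OF v test_function_mono[OF \<phi> ab(2,3)]] distr_derivD(3)[OF v' \<phi>]
        test_function_set_integral_mono[OF \<phi> ab] by simp
    moreover have "set_integrable lebesgue {a<..<b} (\<lambda>t. w t * \<phi> t)"
      by (rule set_integrable_times_test_function(1)[OF w(1) \<phi> ab(1)])
    moreover have "set_integrable lebesgue {a<..<b} (\<lambda>t. w' t * \<phi> t)"
      by (rule set_integrable_times_test_function(1)[OF w(2) \<phi> ab(1)])
    ultimately show "(LINT t:{a<..<b}|lebesgue. (w t - w' t) * \<phi> t) = 0"
      by (simp add: left_diff_distrib)
  qed
  then show ?thesis by simp
qed

text \<open>v - K has distributional derivative w - k \<le> 0. This is the form in which a bound on
  w enters all comparisons.\<close>

lemma antimono_of_distr_deriv_le: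
  assumes v: "distr_deriv A B v w" and ab: "a < b" "A \<le> a" "b \<le> B"
    and K: "\<And>t. a < t \<Longrightarrow> t < b \<Longrightarrow> (K has_field_derivative k t) (at t)"
    and k: "continuous_on {a<..<b} k"
    and le: "AE t in lebesgue. t \<in> {a<..<b} \<longrightarrow> w t \<le> k t"
  obtains G where "antimono_on {a<..<b} G" "AE t in lebesgue. t \<in> {a<..<b} \<longrightarrow> v t - K t = G t"
proof (rule antimono_of_distr[of a b "\<lambda>t. v t - K t"])
  have v_loc: "set_integrable lebesgue {x..y} v" and w_loc: "set_integrable lebesgue {x..y} w"
    if "a < x" "y < b" for x y
    using that ab distr_derivD(1,2)[OF v] by auto
  have "continuous_on {a<..<b} K"
    using K by (intro continuous_at_imp_continuous_on ballI DERIV_isCont[of K "k _"]) auto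
  then have K_loc: "set_integrable lebesgue {x..y} K" and k_loc: "set_integrable lebesgue {x..y} k"
    if "a < x" "y < b" for x y
    using k that by (auto intro!: absolutely_integrable_continuous_real elim!: continuous_on_subset)
  show "set_integrable lebesgue {x..y} (\<lambda>t. v t - K t)" if "a < x" "y < b" for x y
    using v_loc[OF that] K_loc[OF that] by (rule set_integral_diff)
  fix \<phi> assume \<phi>: "test_function a b \<phi>" and pos: "\<And>t. 0 \<le> \<phi> t"
  have "(LINT t:{a<..<b}|lebesgue. (v t - K t) * deriv \<phi> t) =
      (LINT t:{a<..<b}|lebesgue. v t * deriv \<phi> t) - (LINT t:{a<..<b}|lebesgue. K t * deriv \<phi> t)"
    unfolding left_diff_distrib
    by (intro set_integral_diff(2) set_integrable_times_test_function[OF _ \<phi> ab(1)] v_loc K_loc)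
  also have "\<dots> = - (LINT t:{a<..<b}|lebesgue. w t * \<phi> t) + (LINT t:{a<..<b}|lebesgue. k t * \<phi> t)"
    using distr_derivD(3)[OF v test_function_mono[OF \<phi> ab(2,3)]]
      test_function_set_integral_mono[OF \<phi> ab] integral_by_parts_test_function[OF K k \<phi> ab(1)] by simp
  finally have *: "(LINT t:{a<..<b}|lebesgue. (v t - K t) * deriv \<phi> t) =
      - (LINT t:{a<..<b}|lebesgue. w t * \<phi> t) + (LINT t:{a<..<b}|lebesgue. k t * \<phi> t)" .
  have "(LINT t:{a<..<b}|lebesgue. w t * \<phi> t) \<le> (LINT t:{a<..<b}|lebesgue. k t * \<phi> t)"
  proof (rule set_integral_mono_AE)
    show "AE t\<in>{a<..<b} in lebesgue. w t * \<phi> t \<le> k t * \<phi> t"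
      using le by eventually_elim (simp add: mult_right_mono pos)
  qed (intro set_integrable_times_test_function[OF _ \<phi> ab(1)] w_loc k_loc; assumption)+
  then show "0 \<le> (LINT t:{a<..<b}|lebesgue. (v t - K t) * deriv \<phi> t)"
    unfolding * by simp
qed (erule (1) that)

lemma distr_deriv_uminus:
  "distr_deriv A B v w \<Longrightarrow> distr_deriv A B (\<lambda>t. - v t) (\<lambda>t. - w t)"
  by (simp add: distr_deriv_def locally_integrable_def)

lemma AE_interval_ex:
  assumes "AE t in lebesgue. t \<in> {a<..<b::real} \<longrightarrow> P t" "a < b"
  shows "\<exists>t\<in>{a<..<b}. P t"
proof (rule ccontr)
  assume "\<not> ?thesis"
  then have "AE t in lebesgue. t \<notin> {a<..<b}"
    using assms(1) by (auto elim!: eventually_mono)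
  then have "{a<..<b} \<in> null_sets lebesgue"
    using AE_iff_null_sets[of "{a<..<b}" lebesgue] by simp
  then show False using assms(2) by (simp add: null_sets_def)
qed

text \<open>Local integrability speaks of compact subintervals only; measurability on the open
  interval follows by exhaustion.\<close>

lemma distr_deriv_measurable:
  assumes "distr_deriv A B v w"
  shows "(\<lambda>t. indicator {A<..<B} t * v t) \<in> borel_measurable lebesgue"
    and "(\<lambda>t. indicator {A<..<B} t * w t) \<in> borel_measurable lebesgue"
proof -
  have *: "(\<lambda>t. indicator {A<..<B} t * u t) \<in> borel_measurable lebesgue"
    if loc: "\<And>a b. A < a \<Longrightarrow> b < B \<Longrightarrow> set_integrable lebesgue {a..b} u" for u :: "real \<Rightarrow> real"
  proof (rule borel_measurable_LIMSEQ_real)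
    define I where "I n = {A + 1 / real (Suc n)..B - 1 / real (Suc n)}" for n
    show "(\<lambda>t. indicator (I n) t * u t) \<in> borel_measurable lebesgue" for n
      using loc[of "A + 1 / real (Suc n)" "B - 1 / real (Suc n)"]
      by (auto simp: set_integrable_def I_def dest: borel_measurable_integrable)
    fix t
    have "\<forall>\<^sub>F n in sequentially. indicator (I n) t * u t = indicator {A<..<B} t * u t"
    proof (cases "t \<in> {A<..<B}")
      case True
      have "(\<lambda>n. 1 / real (Suc n)) \<longlonglongrightarrow> 0" by real_asymp
      then have "\<forall>\<^sub>F n in sequentially. 1 / real (Suc n) < min (t - A) (B - t)"
        using True by (intro order_tendstoD) auto
      then show ?thesis by eventually_elim (use True in \<open>auto simp: I_def indicator_def\<close>)
    next
      case False
      have "t \<notin> I n" for n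
      proof -
        define e where "e = 1 / real (Suc n)"
        have "0 < e" by (simp add: e_def)
        then show ?thesis using False unfolding I_def e_def[symmetric] by auto
      qed
      then show ?thesis using False by simp
    qed
    then show "(\<lambda>n. indicator (I n) t * u t) \<longlonglongrightarrow> indicator {A<..<B} t * u t"
      by (rule tendsto_eventually)
  qed
  show "(\<lambda>t. indicator {A<..<B} t * v t) \<in> borel_measurable lebesgue"
    by (rule *) (rule distr_derivD(1)[OF assms])
  show "(\<lambda>t. indicator {A<..<B} t * w t) \<in> borel_measurable lebesgue"
    by (rule *) (rule distr_derivD(2)[OF assms])
qed

lemma isCont_real_epsilon:
  fixes h :: "real \<Rightarrow> real"
  assumes "isCont h r" "0 < e"
  shows "\<exists>s>0. \<forall>t. \<bar>t - r\<bar> < s \<longrightarrow> \<bar>h t - h r\<bar> < e"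
  using assms unfolding continuous_at_eps_delta dist_real_def by blast

subsection \<open>The lower semicontinuous regularization\<close>

lemma essinf_AE: "AE t in M. essinf M v \<le> ereal (v t)"
  using esssup_AE[of "\<lambda>s. - ereal (v s)" M]
  by eventually_elim (simp add: essinf_def ereal_uminus_le_reorder)

lemma essinf_greatest:
  assumes "v \<in> borel_measurable M" "AE t in M. c \<le> ereal (v t)"
  shows "c \<le> essinf M v"
proof -
  have "esssup M (\<lambda>s. - ereal (v s)) \<le> - c"
  proof (rule esssup_I)
    show "AE t in M. - ereal (v t) \<le> - c"
      using assms(2) by eventually_elim (simp only: ereal_minus_le_minus)
  qed (use assms(1) in simp)
  then have "- (- c) \<le> - esssup M (\<lambda>s. - ereal (v s))"
    by (simp only: ereal_minus_le_minus)
  then show ?thesis by (simp add: essinf_def)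
qed

locale bounded_measurable_on_interval =
  fixes R M :: real and v :: "real \<Rightarrow> real"
  assumes R: "0 < R"
    and meas: "(\<lambda>t. indicator {0<..<R} t * v t) \<in> borel_measurable lebesgue"
    and bounded: "AE t in lebesgue. t \<in> {0<..<R} \<longrightarrow> \<bar>v t\<bar> \<le> M"
begin

text \<open>On [0, R) the essential bound M makes the regularization finite, so
  \<open>real_of_ereal\<close> loses nothing there; see \<open>ereal_V\<close>.\<close>

definition V :: "real \<Rightarrow> real" where
  "V r = real_of_ereal (lsc_regularization R v r)"

definition nbhd :: "real \<Rightarrow> real \<Rightarrow> real set" where
  "nbhd r S = {r - S<..<r + S} \<inter> {0<..<R}"

lemma nbhd_interval: "nbhd r S = {max (r - S) 0<..<min (r + S) R}"
  by (auto simp: nbhd_def)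

lemma nbhd_nonempty: "r \<in> {0..<R} \<Longrightarrow> 0 < S \<Longrightarrow> max (r - S) 0 < min (r + S) R"
  using R by auto

lemma AE_nbhd: "(AE t in lebesgue_on (nbhd r S). P t) \<longleftrightarrow> (AE t in lebesgue. t \<in> nbhd r S \<longrightarrow> P t)"
  by (subst AE_restrict_space_iff) (simp_all add: nbhd_interval)

lemma nbhd_measurable: "v \<in> borel_measurable (lebesgue_on (nbhd r S))"
proof -
  have "(\<lambda>t. indicator {0<..<R} t * v t) \<in> borel_measurable (lebesgue_on (nbhd r S))"
    using meas by (rule measurable_restrict_space1)
  then show ?thesis
    by (rule measurable_cong[THEN iffD1, rotated]) (auto simp: nbhd_def)
qed

text \<open>Shrinking the neighbourhood can only raise the essential infimum, so the limit exists
  and is a supremum.\<close>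

lemma lsc_regularization_eq_SUP:
  "lsc_regularization R v r = (SUP S\<in>{0<..}. essinf (lebesgue_on (nbhd r S)) v)"
proof -
  let ?m = "\<lambda>S. essinf (lebesgue_on (nbhd r S)) v"
  have anti: "?m S \<le> ?m S'" if "S' \<le> S" for S S'
  proof (rule essinf_greatest[OF nbhd_measurable])
    have "AE t in lebesgue. t \<in> nbhd r S \<longrightarrow> ?m S \<le> ereal (v t)"
      using essinf_AE[of "lebesgue_on (nbhd r S)" v] unfolding AE_nbhd .
    then show "AE t in lebesgue_on (nbhd r S'). ?m S \<le> ereal (v t)"
      unfolding AE_nbhd by eventually_elim (use that in \<open>auto simp: nbhd_def\<close>)
  qed
  have "(?m \<longlongrightarrow> (SUP S\<in>{0<..}. ?m S)) (at_right 0)"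
  proof (rule order_tendstoI)
    fix c assume "c < (SUP S\<in>{0<..}. ?m S)"
    then obtain S where S: "0 < S" "c < ?m S" by (auto simp: less_SUP_iff)
    show "\<forall>\<^sub>F S in at_right 0. c < ?m S"
      unfolding eventually_at_right_field
      by (intro exI[of _ S]) (use S anti in \<open>auto intro: less_le_trans\<close>)
  next
    fix c assume c: "(SUP S\<in>{0<..}. ?m S) < c"
    have "?m S < c" if "0 < S" for S
      using SUP_upper[of S "{0<..}" ?m] that c by (auto intro: le_less_trans)
    then show "\<forall>\<^sub>F S in at_right 0. ?m S < c"
      by (auto simp: eventually_at_filter)
  qed
  then show ?thesis
    unfolding lsc_regularization_def nbhd_def[symmetric] by (intro tendsto_Lim) auto
qed

lemma essinf_nbhd_bounds:
  assumes "r \<in> {0..<R}" "0 < S"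
  shows "- ereal M \<le> essinf (lebesgue_on (nbhd r S)) v" "essinf (lebesgue_on (nbhd r S)) v \<le> ereal M"
proof -
  show "- ereal M \<le> essinf (lebesgue_on (nbhd r S)) v"
  proof (rule essinf_greatest[OF nbhd_measurable])
    show "AE t in lebesgue_on (nbhd r S). - ereal M \<le> ereal (v t)"
      unfolding AE_nbhd using bounded by eventually_elim (auto simp: nbhd_def)
  qed
  have "AE t in lebesgue. t \<in> nbhd r S \<longrightarrow> essinf (lebesgue_on (nbhd r S)) v \<le> ereal M"
    using essinf_AE[of "lebesgue_on (nbhd r S)" v] bounded unfolding AE_nbhd
  proof eventually_elim
    case (elim t)
    show ?case
    proof
      assume "t \<in> nbhd r S"
      then have "essinf (lebesgue_on (nbhd r S)) v \<le> ereal (v t)" "v t \<le> M"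
        using elim by (auto simp: nbhd_def)
      then show "essinf (lebesgue_on (nbhd r S)) v \<le> ereal M"
        by (meson ereal_less_eq(3) order_trans)
    qed
  qed
  from AE_interval_ex[OF this[unfolded nbhd_interval] nbhd_nonempty[OF assms]]
  show "essinf (lebesgue_on (nbhd r S)) v \<le> ereal M"
    by (simp add: nbhd_interval)
qed

lemma ereal_V:
  assumes "r \<in> {0..<R}"
  shows "ereal (V r) = lsc_regularization R v r" "\<bar>V r\<bar> \<le> M"
proof -
  have "- ereal M \<le> lsc_regularization R v r" "lsc_regularization R v r \<le> ereal M"
    unfolding lsc_regularization_eq_SUP using essinf_nbhd_bounds[OF assms]
    by (auto intro: SUP_upper2[of 1] SUP_least)
  then show "ereal (V r) = lsc_regularization R v r" "\<bar>V r\<bar> \<le> M"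
    unfolding V_def by (cases "lsc_regularization R v r"; auto)+
qed

text \<open>With its converse \<open>le_V_if_AE\<close> this translates between values of V and
  almost everywhere bounds on v nearby.\<close>

lemma less_V_AE:
  assumes "r \<in> {0..<R}" "c < V r"
  obtains S where "0 < S" "AE t in lebesgue. t \<in> nbhd r S \<longrightarrow> c \<le> v t"
proof -
  have "ereal c < lsc_regularization R v r"
    using assms ereal_V(1)[OF assms(1)] by (metis ereal_less(2) less_ereal.simps(1))
  then obtain S where S: "0 < S" "ereal c < essinf (lebesgue_on (nbhd r S)) v"
    unfolding lsc_regularization_eq_SUP by (auto simp: less_SUP_iff)
  have "AE t in lebesgue. t \<in> nbhd r S \<longrightarrow> c \<le> v t"
    using essinf_AE[of "lebesgue_on (nbhd r S)" v] unfolding AE_nbhd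
  proof eventually_elim
    case (elim t)
    then show ?case using S(2) by (meson ereal_less_eq(3) less_imp_le order_trans)
  qed
  then show ?thesis using that S(1) by blast
qed

lemma le_V_if_AE:
  assumes "r \<in> {0..<R}" "0 < S" "AE t in lebesgue. t \<in> nbhd r S \<longrightarrow> c \<le> v t"
  shows "c \<le> V r"
proof -
  have "ereal c \<le> essinf (lebesgue_on (nbhd r S)) v"
  proof (rule essinf_greatest[OF nbhd_measurable])
    show "AE t in lebesgue_on (nbhd r S). ereal c \<le> ereal (v t)"
      unfolding AE_nbhd using assms(3) by simp
  qed
  also have "\<dots> \<le> lsc_regularization R v r"
    unfolding lsc_regularization_eq_SUP using assms(2) by (intro SUP_upper) auto
  finally show ?thesis unfolding ereal_V(1)[OF assms(1), symmetric] by simp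
qed

lemma V_lsc:
  assumes "r \<in> {0..<R}" "c < V r"
  obtains S where "0 < S" "\<And>s. s \<in> {0..<R} \<Longrightarrow> \<bar>s - r\<bar> < S \<Longrightarrow> c < V s"
proof -
  \<comment> \<open>An almost everywhere bound returns only a non-strict inequality for V, so
    strictness is kept in reserve.\<close>
  obtain c' where c': "c < c'" "c' < V r" using dense[OF assms(2)] by blast
  obtain S where S: "0 < S" "AE t in lebesgue. t \<in> nbhd r S \<longrightarrow> c' \<le> v t"
    by (rule less_V_AE[OF assms(1) c'(2)])
  have "c < V s" if s: "s \<in> {0..<R}" "\<bar>s - r\<bar> < S / 2" for s
  proof -
    have rs: "r - S / 2 < s" "s < r + S / 2" using s(2) by linarith+
    have "AE t in lebesgue. t \<in> nbhd s (S / 2) \<longrightarrow> c' \<le> v t"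
      using S(2)
    proof eventually_elim
      case (elim t)
      have "t \<in> nbhd s (S / 2) \<Longrightarrow> t \<in> nbhd r S"
        using rs by (auto simp: nbhd_def)
      with elim show ?case by blast
    qed
    from le_V_if_AE[OF s(1) _ this] S(1) c'(1) show ?thesis by simp
  qed
  then show ?thesis using that[of "S / 2"] S(1) by simp
qed

text \<open>V r bounds v from below near r on both sides. A point y just to the right of r thus has
  v y - K y almost at least V r - K r, and the decreasing function G carries this bound to
  everything on the left.\<close>

lemma V_minus_le_AE_left:
  assumes ab: "0 \<le> a" "a < r" "r < b" "b \<le> R"
    and G: "antimono_on {a<..<b} G" "AE t in lebesgue. t \<in> {a<..<b} \<longrightarrow> v t - K t = G t"
    and K: "isCont K r"
  shows "AE t in lebesgue. t \<in> {a<..<r} \<longrightarrow> V r - K r \<le> v t - K t"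
proof -
  have "AE t in lebesgue. t \<in> {a<..<r} \<longrightarrow> V r - K r - e \<le> v t - K t" if "e > 0" for e
  proof -
    obtain S where S: "0 < S" "AE t in lebesgue. t \<in> nbhd r S \<longrightarrow> V r - e / 2 \<le> v t"
      using less_V_AE[of r "V r - e / 2"] ab \<open>e > 0\<close> by auto
    obtain s where s: "0 < s" "\<And>t. \<bar>t - r\<bar> < s \<Longrightarrow> \<bar>K t - K r\<bar> < e / 2"
      using isCont_real_epsilon[OF K, of "e / 2"] \<open>e > 0\<close> by auto
    have "AE t in lebesgue. t \<in> {r<..<min b (r + min S s)} \<longrightarrow> V r - e / 2 \<le> v t \<and> v t - K t = G t"
      using S(2) G(2) by eventually_elim (use ab in \<open>auto simp: nbhd_def\<close>)
    from AE_interval_ex[OF this] obtain y where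
      y: "r < y" "y < b" "y < r + s" "V r - e / 2 \<le> v y" "v y - K y = G y"
      using ab S(1) s(1) by auto
    have "\<bar>K y - K r\<bar> < e / 2" using y by (intro s(2)) auto
    then have "V r - K r - e \<le> G y" using y(4,5) by linarith
    moreover have "G y \<le> G t" if "t \<in> {a<..<r}" for t
      using G(1) that ab y by (auto simp: monotone_on_def)
    ultimately have low: "V r - K r - e \<le> G t" if "t \<in> {a<..<r}" for t
      using that by (blast intro: order_trans)
    show ?thesis
      using G(2)
    proof eventually_elim
      case (elim t)
      then show ?case using low[of t] ab by auto
    qed
  qed
  \<comment> \<open>The exceptional null set depends on the error, so the error runs through a
    countable sequence before the limit is taken.\<close>
  then have "AE t in lebesgue. \<forall>n. t \<in> {a<..<r} \<longrightarrow> V r - K r - 1 / real (Suc n) \<le> v t - K t"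
    unfolding AE_all_countable by simp
  then show ?thesis
  proof eventually_elim
    case (elim t)
    show ?case
    proof
      assume t: "t \<in> {a<..<r}"
      have "(\<lambda>n. c - 1 / real (Suc n)) \<longlonglongrightarrow> c" for c :: real by real_asymp
      from this[of "V r - K r"] show "V r - K r \<le> v t - K t"
        by (rule LIMSEQ_le_const2) (use elim t in auto)
    qed
  qed
qed

text \<open>Mirror image: a point y just to the left of r, and an increasing G that carries the
  bound to the right.\<close>

lemma V_minus_le_AE_right:
  assumes ab: "0 \<le> a" "a < r" "r < b" "b \<le> R"
    and G: "mono_on {a<..<b} G" "AE t in lebesgue. t \<in> {a<..<b} \<longrightarrow> v t - K t = G t"
    and K: "isCont K r"
  shows "AE t in lebesgue. t \<in> {r<..<b} \<longrightarrow> V r - K r \<le> v t - K t"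
proof -
  have "AE t in lebesgue. t \<in> {r<..<b} \<longrightarrow> V r - K r - e \<le> v t - K t" if "e > 0" for e
  proof -
    obtain S where S: "0 < S" "AE t in lebesgue. t \<in> nbhd r S \<longrightarrow> V r - e / 2 \<le> v t"
      using less_V_AE[of r "V r - e / 2"] ab \<open>e > 0\<close> by auto
    obtain s where s: "0 < s" "\<And>t. \<bar>t - r\<bar> < s \<Longrightarrow> \<bar>K t - K r\<bar> < e / 2"
      using isCont_real_epsilon[OF K, of "e / 2"] \<open>e > 0\<close> by auto
    have "AE t in lebesgue. t \<in> {max a (r - min S s)<..<r} \<longrightarrow> V r - e / 2 \<le> v t \<and> v t - K t = G t"
      using S(2) G(2) by eventually_elim (use ab in \<open>auto simp: nbhd_def\<close>)
    from AE_interval_ex[OF this] obtain y where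
      y: "a < y" "y < r" "r - s < y" "V r - e / 2 \<le> v y" "v y - K y = G y"
      using ab S(1) s(1) by auto
    have "\<bar>K y - K r\<bar> < e / 2" using y by (intro s(2)) auto
    then have "V r - K r - e \<le> G y" using y(4,5) by linarith
    moreover have "G y \<le> G t" if "t \<in> {r<..<b}" for t
      using G(1) that ab y by (auto simp: monotone_on_def)
    ultimately have low: "V r - K r - e \<le> G t" if "t \<in> {r<..<b}" for t
      using that by (blast intro: order_trans)
    show ?thesis
      using G(2)
    proof eventually_elim
      case (elim t)
      then show ?case using low[of t] ab by auto
    qed
  qed
  then have "AE t in lebesgue. \<forall>n. t \<in> {r<..<b} \<longrightarrow> V r - K r - 1 / real (Suc n) \<le> v t - K t"
    unfolding AE_all_countable by simp
  then show ?thesis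
  proof eventually_elim
    case (elim t)
    show ?case
    proof
      assume t: "t \<in> {r<..<b}"
      have "(\<lambda>n. c - 1 / real (Suc n)) \<longlonglongrightarrow> c" for c :: real by real_asymp
      from this[of "V r - K r"] show "V r - K r \<le> v t - K t"
        by (rule LIMSEQ_le_const2) (use elim t in auto)
    qed
  qed
qed

text \<open>The two comparison functions make \<open>v\<close> essentially continuous at \<open>r\<close>: the first one
  excludes upward jumps and the second one downward jumps. Hence a bound on one side of \<open>r\<close>
  passes to \<open>V r\<close>.\<close>

lemma le_V_if_one_sided:
  assumes ab: "0 \<le> a" "a < r" "r < b" "b \<le> R"
    and G: "antimono_on {a<..<b} G" "AE t in lebesgue. t \<in> {a<..<b} \<longrightarrow> v t - L t = G t" "isCont L r"
    and G': "mono_on {a<..<b} G'" "AE t in lebesgue. t \<in> {a<..<b} \<longrightarrow> v t - L' t = G' t" "isCont L' r"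
    and K: "isCont K r"
    and side: "a \<le> x" "x < y" "y \<le> b" "r \<in> {x, y}"
      "AE t in lebesgue. t \<in> {x<..<y} \<longrightarrow> c + K t \<le> v t"
  shows "c + K r \<le> V r"
proof -
  have "c + K r - e \<le> V r" if "e > 0" for e
  proof -
    have cont: "\<exists>s>0. \<forall>t. \<bar>t - r\<bar> < s \<longrightarrow> \<bar>h t - h r\<bar> < e / 4" if "isCont h r" for h :: "real \<Rightarrow> real"
      using isCont_real_epsilon[OF that, of "e / 4"] \<open>e > 0\<close> by simp
    obtain s1 s2 s3 where s: "s1 > 0" "s2 > 0" "s3 > 0"
      "\<And>t. \<bar>t - r\<bar> < s1 \<Longrightarrow> \<bar>L t - L r\<bar> < e / 4" "\<And>t. \<bar>t - r\<bar> < s2 \<Longrightarrow> \<bar>L' t - L' r\<bar> < e / 4"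
      "\<And>t. \<bar>t - r\<bar> < s3 \<Longrightarrow> \<bar>K t - K r\<bar> < e / 4"
      using cont[OF G(3)] cont[OF G'(3)] cont[OF K] by auto
    define s where "s = Min {s1, s2, s3, r - a, b - r}"
    have s_pos: "0 < s" using s ab by (simp add: s_def)
    have s_le: "s \<le> s1" "s \<le> s2" "s \<le> s3" "s \<le> r - a" "s \<le> b - r" by (simp_all add: s_def)
    have ae: "AE t in lebesgue. t \<in> {max x (r - s)<..<min y (r + s)} \<longrightarrow>
        c + K t \<le> v t \<and> v t - L t = G t \<and> v t - L' t = G' t"
      using side(5) G(2) G'(2) by eventually_elim (use side ab in auto)
    have "max x (r - s) < min y (r + s)" using side s_pos by auto
    from AE_interval_ex[OF ae this] obtain z where
      "z \<in> {max x (r - s)<..<min y (r + s)}"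
      and z': "c + K z \<le> v z" "v z - L z = G z" "v z - L' z = G' z"
      by blast
    then have z: "r - s < z" "z < r + s" by auto
    have "AE t in lebesgue. t \<in> nbhd r s \<longrightarrow> c + K r - e \<le> v t"
      using G(2) G'(2)
    proof eventually_elim
      case (elim t)
      show ?case
      proof
        assume "t \<in> nbhd r s"
        then have t: "r - s < t" "t < r + s" by (auto simp: nbhd_def)
        then have tz: "t \<in> {a<..<b}" "z \<in> {a<..<b}" using z s_le by auto
        have tr: "\<bar>t - r\<bar> < s" "\<bar>z - r\<bar> < s" using t z by linarith+
        have "\<bar>L t - L r\<bar> < e / 4" "\<bar>L z - L r\<bar> < e / 4"
          by (rule s(4), use tr s_le in linarith)+
        then have "L z - L t \<le> e / 2" by linarith
        moreover have "\<bar>L' t - L' r\<bar> < e / 4" "\<bar>L' z - L' r\<bar> < e / 4"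
          by (rule s(5), use tr s_le in linarith)+
        then have "L' z - L' t \<le> e / 2" by linarith
        moreover have "\<bar>K z - K r\<bar> < e / 4" by (rule s(6), use tr s_le in linarith)
        then have "K r - K z \<le> e / 4" by linarith
        \<comment> \<open>z is a point where the one-sided bound holds. Points to its left are
          controlled by the decreasing G, points to its right by the increasing G', so the bound at
          the single point z spreads to a full neighbourhood of r.\<close>
        moreover have "G z \<le> G t \<or> G' z \<le> G' t"
          using G(1) G'(1) tz by (cases "t \<le> z") (auto simp: monotone_on_def)
        moreover have "v t - L t = G t" "v t - L' t = G' t" using elim tz by auto
        ultimately show "c + K r - e \<le> v t" using z' \<open>e > 0\<close> by linarith
      qed
    qed
    then show ?thesis using ab s_pos by (intro le_V_if_AE) auto
  qed
  note approx = this
  show ?thesis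
  proof (rule field_le_epsilon)
    fix e :: real assume "0 < e"
    from approx[OF this] show "c + K r \<le> V r + e" by linarith
  qed
qed

end

subsection \<open>Signed powers\<close>

text \<open>The odd extension of the power function. With exponent q - 1 it is the nonlinearity of
  the flux (\<open>powr_times_eq_spow\<close>), with exponent 1 / (q - 1) its inverse.\<close>

definition spow :: "real \<Rightarrow> real \<Rightarrow> real" where
  "spow a s = sgn s * \<bar>s\<bar> powr a"

lemma spow_0 [simp]: "spow a 0 = 0"
  by (simp add: spow_def)

text \<open>Both summands are continuous and monotone for a > 0, so continuity and monotonicity of
  \<open>spow\<close> need no analysis at the change of sign.\<close>

lemma spow_eq_max: "spow a s = max 0 s powr a - max 0 (- s) powr a"
  by (cases s "0::real" rule: linorder_cases) (auto simp: spow_def max_def)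

lemma continuous_on_spow [continuous_intros]:
  "0 < a \<Longrightarrow> continuous_on S g \<Longrightarrow> continuous_on S (\<lambda>x. spow a (g x))"
  unfolding spow_eq_max by (intro continuous_intros continuous_on_powr') auto

lemma spow_inverse: "0 < a \<Longrightarrow> spow (1 / a) (spow a s) = s"
  by (cases s "0::real" rule: linorder_cases) (auto simp: spow_def powr_powr abs_mult sgn_mult sgn_real_def)

lemma spow_inverse': "0 < a \<Longrightarrow> spow a (spow (1 / a) s) = s"
  using spow_inverse[of "1 / a" s] by simp

lemma spow_strict_mono:
  assumes "0 < a" "s < t"
  shows "spow a s < spow a t"
proof -
  have mono: "max 0 x powr a \<le> max 0 y powr a" if "x \<le> y" for x y
    using that assms(1) by (intro powr_mono2) auto
  have strict: "max 0 x powr a < max 0 y powr a" if "x < y" "0 < y" for x y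
    using that assms(1) by (intro powr_less_mono2) auto
  show ?thesis
  proof (cases "0 < t")
    case True
    then have "max 0 s powr a < max 0 t powr a" "max 0 (- t) powr a \<le> max 0 (- s) powr a"
      using assms(2) by (intro strict mono; simp)+
    then show ?thesis unfolding spow_eq_max by linarith
  next
    case False
    then have "max 0 s powr a \<le> max 0 t powr a" "max 0 (- t) powr a < max 0 (- s) powr a"
      using assms(2) by (intro strict mono; simp)+
    then show ?thesis unfolding spow_eq_max by linarith
  qed
qed

lemma spow_le_iff: "0 < a \<Longrightarrow> spow a s \<le> spow a t \<longleftrightarrow> s \<le> t"
  using spow_strict_mono[of a s t] spow_strict_mono[of a t s] by (cases s t rule: linorder_cases) auto

lemma spow_less_iff: "0 < a \<Longrightarrow> spow a s < spow a t \<longleftrightarrow> s < t"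
  using spow_le_iff[of a t s] by (simp add: not_le[symmetric])

lemma abs_spow: "\<bar>spow a s\<bar> = \<bar>s\<bar> powr a"
  by (cases "s = 0") (auto simp: spow_def abs_mult abs_sgn_eq)

lemma powr_times_eq_spow: "\<bar>w\<bar> powr (q - 2) * w = spow (q - 1) w"
proof (cases "w = 0")
  case False
  then have "\<bar>w\<bar> powr (q - 1) = \<bar>w\<bar> powr (q - 2) * \<bar>w\<bar>"
    using powr_add[of "\<bar>w\<bar>" "q - 2" 1] by simp
  then show ?thesis by (simp add: spow_def sgn_real_def abs_if mult_ac)
qed simp

lemma spow_DERIV:
  assumes "s \<noteq> 0"
  shows "(spow a has_field_derivative a * \<bar>s\<bar> powr (a - 1)) (at s)"
proof (cases "0 < s")
  case True
  have ev: "\<forall>\<^sub>F x in nhds s. spow a x = x powr a"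
    by (rule eventually_mono[OF eventually_nhds_in_open[of "{0<..}" s]]) (use True in \<open>simp_all add: spow_def\<close>)
  show ?thesis
    unfolding DERIV_cong_ev[OF refl ev refl] using has_real_derivative_powr[OF True, of a] True by simp
next
  case False
  have ev: "\<forall>\<^sub>F x in nhds s. spow a x = - ((- x) powr a)"
    by (rule eventually_mono[OF eventually_nhds_in_open[of "{..<0}" s]])
      (use False assms in \<open>simp_all add: spow_def\<close>)
  have "((\<lambda>x. (- x) powr a) has_field_derivative a * (- s) powr (a - 1) * - 1) (at s)"
    using False assms
    by (intro DERIV_chain2[of "\<lambda>x. x powr a" _ "\<lambda>x. - x"] has_real_derivative_powr) (auto intro!: derivative_eq_intros)
  from DERIV_minus[OF this] show ?thesis
    unfolding DERIV_cong_ev[OF refl ev refl] using False assms by simp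
qed

subsection \<open>The radial equation\<close>

text \<open>Continuity up to the left end a is the point: a primitive starting at the origin must be
  continuous there.\<close>

lemma antiderivative_half_open:
  fixes g :: "real \<Rightarrow> real"
  assumes g: "continuous_on {a..<b} g"
  shows "a < t \<Longrightarrow> t < b \<Longrightarrow> ((\<lambda>r. integral {a..r} g) has_field_derivative g t) (at t)"
    and "continuous_on {a..<b} (\<lambda>r. integral {a..r} g)"
proof -
  have D: "((\<lambda>r. integral {a..r} g) has_field_derivative g t) (at t within {a..c})"
    if "a \<le> t" "t \<le> c" "c < b" for t c
    using that g by (intro integral_has_real_derivative) (auto elim!: continuous_on_subset)
  show "((\<lambda>r. integral {a..r} g) has_field_derivative g t) (at t)" if t: "a < t" "t < b"
  proof -
    obtain c where c: "t < c" "c < b" using dense[OF t(2)] by blast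
    have "((\<lambda>r. integral {a..r} g) has_field_derivative g t) (at t within {a<..<c})"
      by (rule DERIV_subset[OF D[of t c]]) (use t c in auto)
    then show ?thesis using t c by (simp add: at_within_open[of t "{a<..<c}"])
  qed
  show "continuous_on {a..<b} (\<lambda>r. integral {a..r} g)"
    unfolding continuous_on_eq_continuous_within
  proof
    fix t assume t: "t \<in> {a..<b}"
    obtain c where c: "t < c" "c < b" using dense[of t b] t by auto
    have "continuous (at t within {a..c}) (\<lambda>r. integral {a..r} g)"
      using DERIV_continuous[OF D[of t c]] t c by auto
    moreover have "at t within {a..<b} = at t within {a..c}"
      using at_within_nhd[of t "{..<c}" "{a..<b}" "{a..c}"] t c by force
    ultimately show "continuous (at t within {a..<b}) (\<lambda>r. integral {a..r} g)" by simp
  qed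
qed

locale radial_equation =
  fixes \<kappa> q d R :: real and f :: "real \<Rightarrow> real"
  assumes \<kappa>: "0 < \<kappa>" and q: "1 < q" and d: "1 < d" and R: "0 < R" and f: "continuous_on {0..<R} f"
begin

definition source :: "real \<Rightarrow> real" where
  "source t = f (max 0 t) * max 0 t powr (d - 1)"

text \<open>Integrating from \<open>- R\<close> puts the origin in the interior, so F is
  differentiable there as well; the source vanishes on the negative side, so still F 0 = 0.\<close>

definition F :: "real \<Rightarrow> real" where
  "F r = integral {- R..r} source"

definition k :: "real \<Rightarrow> real \<Rightarrow> real" where
  "k C r = spow (1 / (q - 1)) ((C - F r) * r powr (1 - d) / \<kappa>)"

lemma source_nonpos: "t \<le> 0 \<Longrightarrow> source t = 0"
  by (simp add: source_def)

lemma continuous_on_source: "continuous_on {- R..<R} source"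
  unfolding source_def using R d
  by (intro continuous_intros continuous_on_powr' continuous_on_compose2[OF f]) auto

lemma F_nonpos: "t \<le> 0 \<Longrightarrow> F t = 0"
  unfolding F_def using Henstock_Kurzweil_Integration.integral_cong[of "{- R..t}" source "\<lambda>_. 0"]
  by (simp add: source_nonpos)

lemma F_DERIV: "- R < t \<Longrightarrow> t < R \<Longrightarrow> (F has_field_derivative source t) (at t)"
  unfolding F_def[abs_def] by (rule antiderivative_half_open(1)[OF continuous_on_source])

lemma continuous_on_F: "continuous_on {0..<R} F"
  using antiderivative_half_open(2)[OF continuous_on_source] R
  unfolding F_def[abs_def, symmetric] by (auto elim!: continuous_on_subset)

text \<open>The mean value theorem gives one factor r besides the weight
  \<open>r powr (d - 1)\<close>. This beats the singular factor \<open>r powr (1 - d)\<close> in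
  \<open>k 0\<close>.\<close>

lemma F_bound:
  assumes "0 \<le> R'" "R' < R"
  obtains B where "0 \<le> B" "\<And>r. 0 \<le> r \<Longrightarrow> r \<le> R' \<Longrightarrow> \<bar>F r\<bar> \<le> B * r powr d"
proof -
  have "bounded (f ` {0..R'})"
    using f assms by (intro compact_imp_bounded compact_continuous_image) (auto elim!: continuous_on_subset)
  then obtain B where B: "0 < B" "\<And>r. r \<in> {0..R'} \<Longrightarrow> \<bar>f r\<bar> \<le> B"
    by (auto simp: bounded_pos)
  have "\<bar>F r\<bar> \<le> B * r powr d" if r: "0 \<le> r" "r \<le> R'" for r
  proof (cases "r = 0")
    case False
    then have "0 < r" using r by simp
    have "\<exists>z. 0 < z \<and> z < r \<and> F r - F 0 = (r - 0) * source z"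
      using assms r by (intro MVT2[OF \<open>0 < r\<close>] F_DERIV) auto
    then obtain z where z: "0 < z" "z < r" "F r = r * source z"
      using F_nonpos[of 0] by auto
    have "\<bar>source z\<bar> \<le> B * r powr (d - 1)"
      unfolding source_def using z r B d
      by (auto simp: abs_mult intro!: mult_mono powr_mono2)
    then have "\<bar>F r\<bar> \<le> r * (B * r powr (d - 1))"
      using z \<open>0 < r\<close> by (simp add: abs_mult)
    also have "\<dots> = B * r powr d"
      using powr_add[of r 1 "d - 1"] \<open>0 < r\<close> by simp
    finally show ?thesis .
  qed (simp add: F_nonpos)
  then show ?thesis using that B(1) less_imp_le by blast
qed

lemma flux_k:
  assumes "0 < r"
  shows "\<kappa> * spow (q - 1) (k C r) * r powr (d - 1) = C - F r"
proof -
  have "spow (q - 1) (k C r) = (C - F r) * r powr (1 - d) / \<kappa>"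
    unfolding k_def using q by (intro spow_inverse') simp
  moreover have "r powr (1 - d) * r powr (d - 1) = 1"
    using assms powr_add[of r "1 - d" "d - 1"] by simp
  ultimately show ?thesis using \<kappa> by simp
qed

text \<open>The flux is strictly increasing in the slope, so slopes are compared with
  \<open>k C\<close> exactly as flux plus F is compared with the constant C.\<close>

lemma le_k_iff:
  assumes "0 < r"
  shows "w \<le> k C r \<longleftrightarrow> \<kappa> * (\<bar>w\<bar> powr (q - 2) * w) * r powr (d - 1) \<le> C - F r"
    and "k C r \<le> w \<longleftrightarrow> C - F r \<le> \<kappa> * (\<bar>w\<bar> powr (q - 2) * w) * r powr (d - 1)"
  unfolding powr_times_eq_spow flux_k[OF assms, symmetric]
  using assms \<kappa> q by (simp_all add: spow_le_iff)

lemma k_strict_mono: "0 < r \<Longrightarrow> C < C' \<Longrightarrow> k C r < k C' r"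
  unfolding k_def using q \<kappa> by (simp add: spow_less_iff divide_strict_right_mono)

text \<open>Joint continuity is needed for uniform smallness of the change of \<open>k C\<close>
  when C is perturbed.\<close>

lemma continuous_on_k2: "continuous_on (UNIV \<times> {0<..<R}) (\<lambda>(C, r). k C r)"
proof -
  have "continuous_on (UNIV \<times> {0<..<R}) (\<lambda>x. F (snd x))"
    by (rule continuous_on_compose2[OF continuous_on_F]) (auto intro!: continuous_intros)
  then show ?thesis
    unfolding k_def case_prod_beta using q \<kappa> by (intro continuous_intros) auto
qed

lemma continuous_on_k: "continuous_on {0<..<R} (k C)"
proof -
  have "continuous_on {0<..<R} (\<lambda>r. (C, r))" by (intro continuous_intros)
  from continuous_on_compose2[OF continuous_on_k2 this] show ?thesis by auto
qed

text \<open>For C = 0 the numerator is O(r^d) by \<open>F_bound\<close>, so the argument of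
  \<open>spow\<close> is O(r) and tends to 0, which is also its value at the origin.\<close>

lemma continuous_on_k_0: "continuous_on {0..<R} (k 0)"
proof -
  let ?T = "\<lambda>r. (0 - F r) * r powr (1 - d) / \<kappa>"
  have "continuous_on {0..<R} ?T"
    unfolding continuous_on_eq_continuous_within
  proof
    fix r assume r: "r \<in> {0..<R}"
    show "continuous (at r within {0..<R}) ?T"
    proof (cases "r = 0")
      case True
      obtain B where B: "0 \<le> B" "\<And>r. 0 \<le> r \<Longrightarrow> r \<le> R / 2 \<Longrightarrow> \<bar>F r\<bar> \<le> B * r powr d"
        using F_bound[of "R / 2"] R by auto
      have bd: "norm (?T t) \<le> B * t / \<kappa>" if "0 < t" "t \<le> R / 2" for t
      proof -
        have "\<bar>F t\<bar> * t powr (1 - d) \<le> B * t powr d * t powr (1 - d)"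
          using B that by (intro mult_right_mono) auto
        also have "\<dots> = B * t" using powr_add[of t d "1 - d"] that by simp
        finally show ?thesis using \<kappa> by (simp add: abs_mult divide_right_mono)
      qed
      have "(?T \<longlongrightarrow> 0) (at 0 within {0..<R})"
      proof (rule Lim_null_comparison)
        show "\<forall>\<^sub>F t in at 0 within {0..<R}. norm (?T t) \<le> B * t / \<kappa>"
          unfolding eventually_at using R bd by (intro exI[of _ "R / 2"]) (auto simp: dist_real_def)
        show "((\<lambda>t. B * t / \<kappa>) \<longlongrightarrow> 0) (at 0 within {0..<R})"
          using \<kappa> by (auto intro!: tendsto_eq_intros)
      qed
      then show ?thesis using True using \<kappa> by (simp add: continuous_within F_nonpos)
    next
      case False
      have "continuous (at r within {0..<R}) F"
        using continuous_on_F r by (simp add: continuous_on_eq_continuous_within)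
      then show ?thesis
        by (intro continuous_intros) (auto simp: False less_imp_neq[OF \<kappa>, symmetric])
    qed
  qed
  then show ?thesis
    unfolding k_def[abs_def] by (rule continuous_on_spow[rotated]) (use q in simp)
qed

lemma ex_antiderivative_k:
  obtains K where "\<And>t. 0 < t \<Longrightarrow> t < R \<Longrightarrow> (K has_field_derivative k C t) (at t)"
proof -
  have "\<And>x. 0 < x \<Longrightarrow> x < R \<Longrightarrow> isCont (k C) x"
    using continuous_on_k[of C] by (simp add: continuous_on_eq_continuous_at)
  then show ?thesis
    using einterval_antiderivative[of 0 "ereal R" "k C"] R that
    by (auto simp: has_real_derivative_iff_has_vector_derivative zero_ereal_def)
qed

text \<open>The equation comes from differentiating flux plus F = C. The slope must not vanish
  because the inverse power \<open>spow (1 / (q - 1))\<close> fails to be differentiable at 0 if q >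
  2.\<close>

lemma k_equation:
  assumes r: "0 < r" "r < R" and nz: "k C r \<noteq> 0"
  obtains k' where "(k C has_field_derivative k') (at r)"
    "\<kappa> * \<bar>k C r\<bar> powr (q - 2) * ((q - 1) * k' + (d - 1) / r * k C r) = - f r"
proof -
  define T where "T t = (C - F t) * t powr (1 - d) / \<kappa>" for t
  define T' where "T' = - f r / \<kappa> - (d - 1) * T r / r"
  have Tr: "T r \<noteq> 0" using nz by (auto simp: k_def T_def)
  have "((\<lambda>t. C - F t) has_field_derivative - source r) (at r)"
    using F_DERIV[of r] r by (auto intro!: derivative_eq_intros)
  from DERIV_cdivide[OF DERIV_mult[OF this has_real_derivative_powr[OF r(1), of "1 - d"]], of \<kappa>]
  have "(T has_field_derivative (- source r * r powr (1 - d) + (1 - d) * r powr (1 - d - 1) * (C - F r)) / \<kappa>) (at r)"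
    unfolding T_def .
  moreover have "r powr (1 - d - 1) = r powr (1 - d) / r"
    using r powr_diff[of r "1 - d" 1] by simp
  moreover have "source r * r powr (1 - d) = f r"
    using r powr_add[of r "d - 1" "1 - d"] by (simp add: source_def)
  then have "(- source r * X + (1 - d) * (X / r) * (C - F r)) / \<kappa> =
      - f r / \<kappa> - (d - 1) * ((C - F r) * X / \<kappa>) / r" if "X = r powr (1 - d)" for X
    unfolding that[symmetric] using r \<kappa> by (simp add: field_simps)
  from this[OF refl] have "(- source r * r powr (1 - d) + (1 - d) * (r powr (1 - d) / r) * (C - F r)) / \<kappa> = T'"
    unfolding T'_def T_def .
  ultimately have T: "(T has_field_derivative T') (at r)" by (simp only:)
  define a where "a = 1 / (q - 1)"
  have kT: "k C = (\<lambda>t. spow a (T t))" by (auto simp: k_def T_def a_def)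
  have D: "(k C has_field_derivative a * \<bar>T r\<bar> powr (a - 1) * T') (at r)"
    unfolding kT by (rule DERIV_chain2[OF spow_DERIV[OF Tr] T])
  have "\<bar>k C r\<bar> powr (q - 2) * k C r = T r"
    unfolding powr_times_eq_spow kT a_def using q by (intro spow_inverse') simp
  moreover have "\<bar>k C r\<bar> powr (q - 2) * \<bar>T r\<bar> powr (a - 1) = 1"
  proof -
    \<comment> \<open>The exponents cancel because a (q - 1) = 1: the derivative of the inverse
      power undoes the factor |k|^(q-2).\<close>
    have "a * (q - 2) + (a - 1) = 0" using q by (simp add: a_def field_simps)
    then show ?thesis
      unfolding kT abs_spow powr_powr powr_add[symmetric] using Tr by simp
  qed
  moreover have "\<kappa> * P * ((q - 1) * (a * Q * T') + (d - 1) / r * y) = - f r"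
    if "P * y = T r" "P * Q = 1" for P Q y
  proof -
    have "\<kappa> * P * ((q - 1) * (a * Q * T') + (d - 1) / r * y) =
        \<kappa> * (((q - 1) * a) * (P * Q) * T' + (d - 1) / r * (P * y))"
      by (simp add: algebra_simps)
    also have "(q - 1) * a = 1" using q by (simp add: a_def)
    finally show ?thesis unfolding that T'_def using \<kappa> r by (simp add: field_simps)
  qed
  ultimately show ?thesis using that[OF D] by blast
qed

end

subsection \<open>Comparison with solutions of the radial equation\<close>

context radial_equation
begin

text \<open>The flux and the source are extended by zero to \<open>(- R, 0]\<close>, because test functions need
  not vanish at \<open>0\<close>: on \<open>(- R, R)\<close>, the flux plus \<open>F\<close> is nonincreasing, and it vanishes on the
  left of \<open>0\<close>, hence it is nonpositive on \<open>(0, R)\<close>.\<close>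

definition flux :: "(real \<Rightarrow> real) \<Rightarrow> real \<Rightarrow> real" where
  "flux w t = (if 0 < t then \<kappa> * (\<bar>w t\<bar> powr (q - 2) * w t) * t powr (d - 1) else 0)"

text \<open>Integrability of w on compact subsets of (0, R) is not enough, since [a, b] may contain
  the origin. The weighted bound on |w|^q up to 0 is used here, through |w|^(q-1) \<le> 1 +
  |w|^q.\<close>

lemma flux_set_integrable:
  assumes ws: "weak_supersolution \<kappa> q d R f v" and w: "distr_deriv 0 R v w"
    and ab: "- R < a" "b < R"
  shows "set_integrable lebesgue {a..b} (flux w)"
proof -
  define R' where "R' = (max b 0 + R) / 2"
  have R': "0 < R'" "R' < R" "b < R'" using ab R by (auto simp: R'_def)
  have "v \<in> W1q_weighted q d R'" using ws R' by (simp add: weak_supersolution_def)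
  then obtain w' where w': "w' \<in> Lq_weighted q d R'" "distr_deriv 0 R' v w'"
    by (auto simp: W1q_weighted_def)
  have ae: "AE t in lebesgue. t \<in> {0<..<R'} \<longrightarrow> w t = w' t"
    using R' by (intro distr_deriv_unique[OF w w'(2)]) auto
  \<comment> \<open>w is known to be measurable only on (0, R); cutting it off gives a function
    measurable on the line.\<close>
  define w0 where "w0 t = indicator {0<..<R} t * w t" for t
  have [measurable]: "w0 \<in> borel_measurable lebesgue"
    using distr_deriv_measurable(2)[OF w] by (simp add: w0_def[abs_def])
  have [measurable]: "(\<lambda>t::real. t) \<in> borel_measurable lebesgue"
    by (intro measurable_completion) simp
  have [measurable]: "{a..b} \<in> sets lebesgue" by simp
  have eq: "(\<lambda>t. indicator {a..b} t *\<^sub>R flux w t) =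
      (\<lambda>t. indicator {a..b} t * (\<kappa> * (\<bar>w0 t\<bar> powr (q - 2) * w0 t) * max 0 t powr (d - 1)))"
    using ab by (auto simp: flux_def w0_def indicator_def max_def)
  have meas: "(\<lambda>t. indicator {a..b} t *\<^sub>R flux w t) \<in> borel_measurable lebesgue"
    unfolding eq by measurable
  let ?B = "\<lambda>t. \<kappa> * (indicator {0<..<R'} t * R' powr (d - 1)
      + indicator {0<..<R'} t * (\<bar>w' t\<bar> powr q * t powr (d - 1)))"
  have "integrable lebesgue ?B"
  proof (intro integrable_mult_right Bochner_Integration.integrable_add)
    show "integrable lebesgue (\<lambda>t. indicator {0<..<R'} t * R' powr (d - 1))"
      using lmeasurable_interval(2)[of 0 R'] by (intro integrable_mult_left) (simp add: fmeasurable_def)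
    show "integrable lebesgue (\<lambda>t. indicator {0<..<R'} t * (\<bar>w' t\<bar> powr q * t powr (d - 1)))"
      using w'(1) by (simp add: Lq_weighted_def integrable_restrict_space)
  qed
  then show ?thesis
    unfolding set_integrable_def
  proof (rule Bochner_Integration.integrable_bound[OF _ meas])
    show "AE t in lebesgue. norm (indicator {a..b} t *\<^sub>R flux w t) \<le> norm (?B t)"
      using ae
    proof eventually_elim
      case (elim t)
      show ?case
      proof (cases "t \<in> {a..b} \<and> 0 < t")
        case True
        then have t: "t \<in> {0<..<R'}" using R' by auto
        have "\<bar>w' t\<bar> powr (q - 1) \<le> 1 + \<bar>w' t\<bar> powr q"
        proof (cases "\<bar>w' t\<bar> \<le> 1")
          case True
          then have "\<bar>w' t\<bar> powr (q - 1) \<le> 1" using q by (intro powr_le1) auto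
          then show ?thesis by (simp add: add_increasing2)
        next
          case False
          then have "\<bar>w' t\<bar> powr (q - 1) \<le> \<bar>w' t\<bar> powr q" by (intro powr_mono) auto
          then show ?thesis by simp
        qed
        then have "\<bar>w' t\<bar> powr (q - 1) * t powr (d - 1) \<le> (1 + \<bar>w' t\<bar> powr q) * t powr (d - 1)"
          by (intro mult_right_mono) auto
        also have "\<dots> \<le> R' powr (d - 1) + \<bar>w' t\<bar> powr q * t powr (d - 1)"
          using t d by (simp add: distrib_right powr_mono2)
        finally have "\<kappa> * (\<bar>w' t\<bar> powr (q - 1) * t powr (d - 1)) \<le>
            \<kappa> * (R' powr (d - 1) + \<bar>w' t\<bar> powr q * t powr (d - 1))"
          using \<kappa> by (intro mult_left_mono) auto
        moreover have "norm (indicator {a..b} t *\<^sub>R flux w t) = \<kappa> * (\<bar>w' t\<bar> powr (q - 1) * t powr (d - 1))"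
          using True elim t \<kappa> unfolding flux_def powr_times_eq_spow by (simp add: abs_mult abs_spow)
        ultimately show ?thesis using t by simp
      qed (auto simp: flux_def)
    qed
  qed
qed

lemma supersolution_flux:
  assumes ws: "weak_supersolution \<kappa> q d R f v"
  obtains w H where "distr_deriv 0 R v w" "antimono_on {0<..<R} H"
    "\<And>t. t \<in> {0<..<R} \<Longrightarrow> H t \<le> 0"
    "AE t in lebesgue. t \<in> {0<..<R} \<longrightarrow>
       \<kappa> * (\<bar>w t\<bar> powr (q - 2) * w t) * t powr (d - 1) + F t = H t"
proof -
  obtain w where w: "distr_deriv 0 R v w" and
    ineq: "\<And>\<phi>. test_function (- R) R \<phi> \<Longrightarrow> (\<And>t. 0 \<le> \<phi> t) \<Longrightarrow> 0 \<le> (LINT r|lebesgue_on {0<..<R}.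
                  \<kappa> * (\<bar>w r\<bar> powr (q - 2) * w r) * deriv \<phi> r * r powr (d - 1)
                  - \<phi> r * f r * r powr (d - 1))"
    using ws by (auto simp: weak_supersolution_def)
  have cF: "continuous_on {- R<..<R} F"
    using F_DERIV by (intro continuous_at_imp_continuous_on ballI DERIV_isCont[of F "source _"]) auto
  have cs: "continuous_on {- R<..<R} source"
    by (rule continuous_on_subset[OF continuous_on_source]) auto
  have loc: "set_integrable lebesgue {a..b} (flux w)" "set_integrable lebesgue {a..b} F"
    "set_integrable lebesgue {a..b} source" if "- R < a" "b < R" for a b
  proof -
    have "{a..b} \<subseteq> {- R<..<R}" using that by auto
    then show "set_integrable lebesgue {a..b} F" "set_integrable lebesgue {a..b} source"
      using continuous_on_subset[OF cF] continuous_on_subset[OF cs]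
      by (auto intro!: absolutely_integrable_continuous_real)
  qed (rule flux_set_integrable[OF ws w that])
  obtain H where H: "antimono_on {- R<..<R} H"
    "AE t in lebesgue. t \<in> {- R<..<R} \<longrightarrow> flux w t + F t = H t"
  proof (rule antimono_of_distr[of "- R" R "\<lambda>t. flux w t + F t"])
    show "set_integrable lebesgue {a..b} (\<lambda>t. flux w t + F t)" if "- R < a" "b < R" for a b
      using loc(1,2)[OF that] by (rule set_integral_add)
    fix \<phi> assume \<phi>: "test_function (- R) R \<phi>" and pos: "\<And>t. 0 \<le> \<phi> t"
    have lt: "- R < R" using R by simp
    have int: "set_integrable lebesgue {- R<..<R} (\<lambda>t. flux w t * deriv \<phi> t)"
      "set_integrable lebesgue {- R<..<R} (\<lambda>t. F t * deriv \<phi> t)"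
      "set_integrable lebesgue {- R<..<R} (\<lambda>t. source t * \<phi> t)"
      by (rule set_integrable_times_test_function[OF _ \<phi> lt]; rule loc; assumption)+
    have "(LINT t:{- R<..<R}|lebesgue. (flux w t + F t) * deriv \<phi> t) =
        (LINT t:{- R<..<R}|lebesgue. flux w t * deriv \<phi> t) + (LINT t:{- R<..<R}|lebesgue. F t * deriv \<phi> t)"
      unfolding distrib_right by (rule set_integral_add(2)[OF int(1,2)])
    \<comment> \<open>Integration by parts moves the source onto F, so that the weak inequality
      becomes a sign condition on flux plus F against \<phi>' alone.\<close>
    also have "(LINT t:{- R<..<R}|lebesgue. F t * deriv \<phi> t) = - (LINT t:{- R<..<R}|lebesgue. source t * \<phi> t)"
      by (rule integral_by_parts_test_function[OF F_DERIV cs \<phi> lt])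
    also have "(LINT t:{- R<..<R}|lebesgue. flux w t * deriv \<phi> t) + - (LINT t:{- R<..<R}|lebesgue. source t * \<phi> t)
        = (LINT t:{- R<..<R}|lebesgue. flux w t * deriv \<phi> t - source t * \<phi> t)"
      using set_integral_diff(2)[OF int(1,3)] by simp
    also have "\<dots> = (LINT r|lebesgue_on {0<..<R}.
                  \<kappa> * (\<bar>w r\<bar> powr (q - 2) * w r) * deriv \<phi> r * r powr (d - 1)
                  - \<phi> r * f r * r powr (d - 1))"
      unfolding set_lebesgue_integral_def using R
      by (subst integral_restrict_space)
        (auto intro!: Bochner_Integration.integral_cong simp: indicator_def flux_def source_def)
    finally show "0 \<le> (LINT t:{- R<..<R}|lebesgue. (flux w t + F t) * deriv \<phi> t)"
      using ineq[OF \<phi> pos] by simp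
  qed (erule (1) that)
  have "H t \<le> 0" if t: "t \<in> {0<..<R}" for t
  proof -
    have "AE t in lebesgue. t \<in> {- R<..<0} \<longrightarrow> H t = 0"
      using H(2) by eventually_elim (use R in \<open>auto simp: flux_def F_nonpos\<close>)
    then obtain s where "s \<in> {- R<..<0}" "H s = 0"
      using AE_interval_ex[of "- R" 0 "\<lambda>t. H t = 0"] R by auto
    then show ?thesis using monotone_onD[OF H(1), of s t] t R by auto
  qed
  moreover have "antimono_on {0<..<R} H"
    using H(1) R by (auto simp: monotone_on_def)
  moreover have "AE t in lebesgue. t \<in> {0<..<R} \<longrightarrow>
       \<kappa> * (\<bar>w t\<bar> powr (q - 2) * w t) * t powr (d - 1) + F t = H t"
    using H(2) by eventually_elim (use R in \<open>auto simp: flux_def\<close>)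
  ultimately show ?thesis using that w by blast
qed

end

section \<open>Comparison of the regularization with radial solutions\<close>

locale radial_supersolution = radial_equation + bounded_measurable_on_interval R M v for M v +
  fixes w H :: "real \<Rightarrow> real"
  assumes w: "distr_deriv 0 R v w"
    and H_antimono: "antimono_on {0<..<R} H" and H_nonpos: "\<And>t. t \<in> {0<..<R} \<Longrightarrow> H t \<le> 0"
    and H_flux: "AE t in lebesgue. t \<in> {0<..<R} \<longrightarrow>
       \<kappa> * (\<bar>w t\<bar> powr (q - 2) * w t) * t powr (d - 1) + F t = H t"
begin

lemma w_le_k:
  assumes "0 \<le> a" "\<And>t. a < t \<Longrightarrow> t < R \<Longrightarrow> H t \<le> C"
  shows "AE t in lebesgue. t \<in> {a<..<R} \<longrightarrow> w t \<le> k C t"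
  using H_flux
proof eventually_elim
  case (elim t)
  show ?case
  proof
    assume t: "t \<in> {a<..<R}"
    then show "w t \<le> k C t"
      using elim assms(2)[of t] assms(1) by (subst le_k_iff(1)) auto
  qed
qed

lemma k_le_w:
  assumes "b \<le> R" "\<And>t. 0 < t \<Longrightarrow> t < b \<Longrightarrow> C \<le> H t"
  shows "AE t in lebesgue. t \<in> {0<..<b} \<longrightarrow> k C t \<le> w t"
  using H_flux
proof eventually_elim
  case (elim t)
  show ?case
  proof
    assume t: "t \<in> {0<..<b}"
    then show "k C t \<le> w t"
      using elim assms(2)[of t] assms(1) by (subst le_k_iff(2)) auto
  qed
qed

lemma v_minus_antimono:
  assumes a: "0 \<le> a" "a < R" "\<And>t. a < t \<Longrightarrow> t < R \<Longrightarrow> H t \<le> C"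
    and K: "\<And>t. 0 < t \<Longrightarrow> t < R \<Longrightarrow> (K has_field_derivative k C t) (at t)"
  shows "\<exists>G. antimono_on {a<..<R} G \<and> (AE t in lebesgue. t \<in> {a<..<R} \<longrightarrow> v t - K t = G t)"
proof (rule antimono_of_distr_deriv_le[OF w, of a R K "k C"])
  show "AE t in lebesgue. t \<in> {a<..<R} \<longrightarrow> w t \<le> k C t"
    using a by (intro w_le_k)
  show "continuous_on {a<..<R} (k C)"
    using continuous_on_k by (rule continuous_on_subset) (use a in auto)
  show "(K has_field_derivative k C t) (at t)" if "a < t" "t < R" for t
    using that a by (intro K) auto
  show "a < R" "0 \<le> a" "R \<le> R" using a by simp_all
qed blast

lemma v_minus_mono:
  assumes b: "0 < b" "b \<le> R" "\<And>t. 0 < t \<Longrightarrow> t < b \<Longrightarrow> C \<le> H t"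
    and K: "\<And>t. 0 < t \<Longrightarrow> t < R \<Longrightarrow> (K has_field_derivative k C t) (at t)"
  shows "\<exists>G. mono_on {0<..<b} G \<and> (AE t in lebesgue. t \<in> {0<..<b} \<longrightarrow> v t - K t = G t)"
proof (rule antimono_of_distr_deriv_le[OF distr_deriv_uminus[OF w], of 0 b "\<lambda>t. - K t" "\<lambda>t. - k C t"])
  show "AE t in lebesgue. t \<in> {0<..<b} \<longrightarrow> - w t \<le> - k C t"
    using k_le_w[OF b(2,3)] by simp
  show "continuous_on {0<..<b} (\<lambda>t. - k C t)"
    using continuous_on_k by (intro continuous_on_minus) (rule continuous_on_subset, use b in auto)
  show "((\<lambda>t. - K t) has_field_derivative - k C t) (at t)" if "0 < t" "t < b" for t
    using that b by (intro DERIV_minus K) auto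
  fix G assume G: "antimono_on {0<..<b} G" "AE t in lebesgue. t \<in> {0<..<b} \<longrightarrow> - v t - - K t = G t"
  show "\<exists>G. mono_on {0<..<b} G \<and> (AE t in lebesgue. t \<in> {0<..<b} \<longrightarrow> v t - K t = G t)"
  proof (intro exI[of _ "\<lambda>t. - G t"] conjI)
    show "mono_on {0<..<b} (\<lambda>t. - G t)" using G(1) by (auto simp: monotone_on_def)
    show "AE t in lebesgue. t \<in> {0<..<b} \<longrightarrow> v t - K t = - G t"
      using G(2) by eventually_elim auto
  qed
qed (use b in simp_all)

text \<open>With C = H r0, the difference v - K decreases on the right of r0 and increases on the
  left. This compares V r with v almost everywhere between r and r0;
  \<open>le_V_if_one_sided\<close> then passes to V r0 itself.\<close>

lemma V_comparison:
  assumes r0: "r0 \<in> {0<..<R}" and r: "r \<in> {0<..<R}"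
    and K: "\<And>t. 0 < t \<Longrightarrow> t < R \<Longrightarrow> (K has_field_derivative k (H r0) t) (at t)"
  shows "V r - V r0 \<le> K r - K r0"
proof -
  have H_le: "H t \<le> H s" if "0 < s" "s \<le> t" "t < R" for s t
    using H_antimono that by (auto simp: monotone_on_def)
  define a b where "a = r0 / 2" and "b = (r0 + R) / 2"
  have ab: "0 < a" "a < r0" "r0 < b" "b < R" using r0 by (auto simp: a_def b_def)
  \<comment> \<open>H a bounds H from above on the right of a, and H b bounds it from below on the
    left of b. So v - L decreases and v - L' increases, both on a full neighbourhood of r0, as the
    passage to V r0 requires.\<close>
  obtain L where L: "\<And>t. 0 < t \<Longrightarrow> t < R \<Longrightarrow> (L has_field_derivative k (H a) t) (at t)"
    by (rule ex_antiderivative_k) (rule that)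
  obtain L' where L': "\<And>t. 0 < t \<Longrightarrow> t < R \<Longrightarrow> (L' has_field_derivative k (H b) t) (at t)"
    by (rule ex_antiderivative_k) (rule that)
  have cont: "isCont K t" "isCont L t" "isCont L' t" if "0 < t" "t < R" for t
    using K[OF that] L[OF that] L'[OF that] by (auto intro: DERIV_isCont)
  have "\<exists>G. antimono_on {a<..<R} G \<and> (AE t in lebesgue. t \<in> {a<..<R} \<longrightarrow> v t - L t = G t)"
    by (rule v_minus_antimono[OF _ _ _ L, of a]) (use ab in \<open>auto intro: H_le\<close>)
  then obtain G where G: "antimono_on {a<..<R} G" "AE t in lebesgue. t \<in> {a<..<R} \<longrightarrow> v t - L t = G t"
    by blast
  have "\<exists>G'. mono_on {0<..<b} G' \<and> (AE t in lebesgue. t \<in> {0<..<b} \<longrightarrow> v t - L' t = G' t)"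
    by (rule v_minus_mono[OF _ _ _ L', of b]) (use ab in \<open>auto intro: H_le\<close>)
  then obtain G' where G': "mono_on {0<..<b} G'" "AE t in lebesgue. t \<in> {0<..<b} \<longrightarrow> v t - L' t = G' t"
    by blast
  have near: "antimono_on {a<..<b} G" "AE t in lebesgue. t \<in> {a<..<b} \<longrightarrow> v t - L t = G t" "isCont L r0"
    "mono_on {a<..<b} G'" "AE t in lebesgue. t \<in> {a<..<b} \<longrightarrow> v t - L' t = G' t" "isCont L' r0"
    "isCont K r0"
  proof -
    show "antimono_on {a<..<b} G" using G(1) ab by (auto simp: monotone_on_def)
    show "mono_on {a<..<b} G'" using G'(1) ab by (auto simp: monotone_on_def)
    show "AE t in lebesgue. t \<in> {a<..<b} \<longrightarrow> v t - L t = G t"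
      using G(2) by eventually_elim (use ab in auto)
    show "AE t in lebesgue. t \<in> {a<..<b} \<longrightarrow> v t - L' t = G' t"
      using G'(2) by eventually_elim (use ab in auto)
  qed (use cont r0 in auto)
  note join = le_V_if_one_sided[OF _ _ _ _ near, of _ _ "V r - K r"]
  consider "r = r0" | "r0 < r" | "r < r0" by linarith
  then have "V r - K r + K r0 \<le> V r0"
  proof cases
    case 2
    have "\<exists>g. antimono_on {r0<..<R} g \<and> (AE t in lebesgue. t \<in> {r0<..<R} \<longrightarrow> v t - K t = g t)"
      by (rule v_minus_antimono[OF _ _ _ K, of r0]) (use r0 in \<open>auto intro: H_le\<close>)
    then obtain g where g: "antimono_on {r0<..<R} g" "AE t in lebesgue. t \<in> {r0<..<R} \<longrightarrow> v t - K t = g t"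
      by blast
    have "AE t in lebesgue. t \<in> {r0<..<r} \<longrightarrow> V r - K r \<le> v t - K t"
      using r r0 2 cont by (intro V_minus_le_AE_left[OF _ _ _ _ g]) auto
    then have "AE t in lebesgue. t \<in> {r0<..<min r b} \<longrightarrow> V r - K r + K t \<le> v t"
      by eventually_elim auto
    then show ?thesis
      using ab 2 by (intro join[of r0 "min r b"]) auto
  next
    case 3
    have "\<exists>g. mono_on {0<..<r0} g \<and> (AE t in lebesgue. t \<in> {0<..<r0} \<longrightarrow> v t - K t = g t)"
      by (rule v_minus_mono[OF _ _ _ K, of r0]) (use r0 in \<open>auto intro: H_le\<close>)
    then obtain g where g: "mono_on {0<..<r0} g" "AE t in lebesgue. t \<in> {0<..<r0} \<longrightarrow> v t - K t = g t"
      by blast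
    have "AE t in lebesgue. t \<in> {r<..<r0} \<longrightarrow> V r - K r \<le> v t - K t"
      using r r0 3 cont by (intro V_minus_le_AE_right[OF _ _ _ _ g]) auto
    then have "AE t in lebesgue. t \<in> {max r a<..<r0} \<longrightarrow> V r - K r + K t \<le> v t"
      by eventually_elim auto
    then show ?thesis
      using ab 3 by (intro join[of "max r a" r0]) auto
  qed simp
  then show ?thesis by simp
qed

text \<open>H \<le> 0 permits C = 0 on all of (0, R). Neighbourhoods of the origin in (0, R) are
  one-sided, so the almost everywhere bound and the continuity of K at 0 already control V
  0.\<close>

lemma V_comparison_0:
  assumes r: "r \<in> {0<..<R}"
  shows "V r - V 0 \<le> integral {0..r} (k 0)"
proof -
  define K where "K s = integral {0..s} (k 0)" for s
  have K: "(K has_field_derivative k 0 t) (at t)" if "0 < t" "t < R" for t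
    unfolding K_def[abs_def] by (rule antiderivative_half_open(1)[OF continuous_on_k_0 that])
  have cont: "continuous_on {0..<R} K"
    unfolding K_def[abs_def] by (rule antiderivative_half_open(2)[OF continuous_on_k_0])
  have "\<exists>G. antimono_on {0<..<R} G \<and> (AE t in lebesgue. t \<in> {0<..<R} \<longrightarrow> v t - K t = G t)"
    by (rule v_minus_antimono[OF _ _ _ K, of 0]) (use R H_nonpos in \<open>auto\<close>)
  then obtain G where G: "antimono_on {0<..<R} G" "AE t in lebesgue. t \<in> {0<..<R} \<longrightarrow> v t - K t = G t"
    by blast
  have ae: "AE t in lebesgue. t \<in> {0<..<r} \<longrightarrow> V r - K r \<le> v t - K t"
    using r K by (intro V_minus_le_AE_left[OF _ _ _ _ G]) (auto intro: DERIV_isCont)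
  have "V r - K r - e \<le> V 0" if "0 < e" for e
  proof -
    have "K 0 = 0" by (simp add: K_def)
    then obtain s where s: "0 < s" "\<And>t. t \<in> {0..<R} \<Longrightarrow> \<bar>t\<bar> < s \<Longrightarrow> \<bar>K t\<bar> < e"
      using cont[unfolded continuous_on_iff, rule_format, of 0 e] R \<open>0 < e\<close>
      by (auto simp: dist_real_def)
    show ?thesis
    proof (rule le_V_if_AE)
      show "AE t in lebesgue. t \<in> nbhd 0 (min s r) \<longrightarrow> V r - K r - e \<le> v t"
        using ae
      proof eventually_elim
        case (elim t)
        show ?case
        proof
          assume t: "t \<in> nbhd 0 (min s r)"
          then have "\<bar>K t\<bar> < e" by (intro s(2)) (auto simp: nbhd_def)
          with elim t show "V r - K r - e \<le> v t" by (auto simp: nbhd_def)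
        qed
      qed
    qed (use R s r in auto)
  qed
  note approx = this
  have "V r - K r \<le> V 0"
  proof (rule field_le_epsilon)
    fix e :: real assume "0 < e"
    from approx[OF this] show "V r - K r \<le> V 0 + e" by linarith
  qed
  then show ?thesis by (simp add: K_def)
qed

end

subsection \<open>Touching by radial functions\<close>

text \<open>The second derivative is required only at the point itself: if it were positive, g'
  would be positive just to the right and g would increase there.\<close>

lemma second_derivative_at_local_max:
  fixes g :: "real \<Rightarrow> real"
  assumes g: "\<forall>\<^sub>F t in nhds 0. (g has_field_derivative g' t) (at t)"
    and max: "\<forall>\<^sub>F t in nhds 0. g t \<le> g 0"
  shows "g' 0 = 0" and "(g' has_field_derivative g'') (at 0) \<Longrightarrow> g'' \<le> 0"
proof -
  obtain e where e: "0 < e" "\<And>t. \<bar>t\<bar> < e \<Longrightarrow> (g has_field_derivative g' t) (at t) \<and> g t \<le> g 0"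
    using eventually_conj[OF g max] by (auto simp: eventually_nhds_metric dist_real_def)
  show z: "g' 0 = 0"
    using e by (intro DERIV_local_max[of g "g' 0" 0 e]) auto
  assume g'': "(g' has_field_derivative g'') (at 0)"
  show "g'' \<le> 0"
  proof (rule ccontr)
    assume "\<not> g'' \<le> 0"
    then obtain c where c: "0 < c" "\<And>h. 0 < h \<Longrightarrow> h < c \<Longrightarrow> g' 0 < g' (0 + h)"
      using DERIV_pos_inc_right[OF g''] by auto
    define t where "t = min e c / 2"
    have t: "0 < t" "t < e" "t < c" using e(1) c(1) by (auto simp: t_def)
    have "g 0 < g t"
    proof (rule DERIV_pos_imp_increasing_open[OF t(1)])
      fix x assume x: "0 < x" "x < t"
      then show "\<exists>y. (g has_field_derivative y) (at x) \<and> 0 < y"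
        using e(2)[of x] c(2)[of x] z t by (intro exI[of _ "g' x"]) auto
    next
      have "isCont g x" if "x \<in> {0..t}" for x
        using e(2)[of x] that t by (auto intro: DERIV_isCont)
      then show "continuous_on {0..t} g" by (simp add: continuous_at_imp_continuous_on)
    qed
    then show False using e(2)[of t] t by auto
  qed
qed

section \<open>Derivatives along lines\<close>

lemma frechet_derivative_eq_grad:
  fixes h :: "real ^ 'n \<Rightarrow> real"
  assumes "h differentiable at z"
  shows "frechet_derivative h (at z) \<xi> = grad h z \<bullet> \<xi>"
proof -
  have lin: "linear (frechet_derivative h (at z))"
    using assms by (rule linear_frechet_derivative)
  have "frechet_derivative h (at z) \<xi> = frechet_derivative h (at z) (\<Sum>i\<in>UNIV. (\<xi> $ i) *\<^sub>R axis i 1)"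
    using basis_expansion[of \<xi>] by (simp add: scalar_mult_eq_scaleR)
  also have "\<dots> = (\<Sum>i\<in>UNIV. (\<xi> $ i) * partial_deriv i h z)"
    by (simp add: linear_sum[OF lin] linear_cmul[OF lin] partial_deriv_def)
  finally show ?thesis by (simp add: inner_vec_def grad_def mult.commute)
qed

lemma DERIV_along_line:
  fixes h :: "real ^ 'n \<Rightarrow> real"
  assumes "h differentiable at (y + t *\<^sub>R \<xi>)"
  shows "((\<lambda>s. h (y + s *\<^sub>R \<xi>)) has_field_derivative grad h (y + t *\<^sub>R \<xi>) \<bullet> \<xi>) (at t)"
proof -
  let ?z = "y + t *\<^sub>R \<xi>"
  have h: "(h has_derivative frechet_derivative h (at ?z)) (at ?z)"
    using assms by (simp add: frechet_derivative_works)
  have l: "((\<lambda>s. y + s *\<^sub>R \<xi>) has_derivative (\<lambda>s. s *\<^sub>R \<xi>)) (at t)"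
    by (auto intro!: derivative_eq_intros)
  have "((\<lambda>s. h (y + s *\<^sub>R \<xi>)) has_derivative (\<lambda>s. frechet_derivative h (at ?z) (s *\<^sub>R \<xi>))) (at t)"
    using has_derivative_compose[OF l h] .
  then show ?thesis
    unfolding has_field_derivative_def frechet_derivative_eq_grad[OF assms]
    by (simp add: mult.commute[of _ "grad h ?z \<bullet> \<xi>"])
qed

lemma DERIV_norm_along_line:
  fixes y \<xi> :: "'a::real_inner"
  assumes "y + t *\<^sub>R \<xi> \<noteq> 0"
  shows "((\<lambda>s. norm (y + s *\<^sub>R \<xi>)) has_field_derivative ((y + t *\<^sub>R \<xi>) \<bullet> \<xi>) / norm (y + t *\<^sub>R \<xi>)) (at t)"
proof -
  have D: "((\<lambda>s. (y + s *\<^sub>R \<xi>) \<bullet> (y + s *\<^sub>R \<xi>)) has_field_derivative 2 * ((y + t *\<^sub>R \<xi>) \<bullet> \<xi>)) (at t)"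
    unfolding has_field_derivative_def
    by (auto intro!: derivative_eq_intros simp: inner_commute algebra_simps)
  have "0 < (y + t *\<^sub>R \<xi>) \<bullet> (y + t *\<^sub>R \<xi>)" using assms by (intro iffD2[OF inner_gt_zero_iff])
  note sqrt_D = DERIV_chain2[where f = sqrt and g = "\<lambda>s. (y + s *\<^sub>R \<xi>) \<bullet> (y + s *\<^sub>R \<xi>)", OF DERIV_real_sqrt[OF this] D]
  have "inverse s / 2 * (2 * x) = x / s" for s x :: real
    by (cases "s = 0") (simp_all add: field_simps)
  from DERIV_cong[OF sqrt_D this]
  show ?thesis unfolding norm_eq_sqrt_inner .
qed

text \<open>The maximum is assumed only in the inner context below, because the derivative formula
  is also applied at a boundary point, in order to exclude it.\<close>

locale touching =
  fixes U :: "(real ^ 'n) set" and \<phi> :: "real ^ 'n \<Rightarrow> real" and y :: "real ^ 'n" and K k :: "real \<Rightarrow> real"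
  assumes U: "open U" "y \<in> U" and C2: "C2_on U \<phi>" and y: "y \<noteq> 0"
    and K: "\<forall>\<^sub>F r in nhds (norm y). (K has_field_derivative k r) (at r)"
begin

lemma line_nhds: "\<forall>\<^sub>F z in nhds y. P z \<Longrightarrow> \<forall>\<^sub>F t in nhds 0. P (y + t *\<^sub>R \<xi>)"
proof -
  assume "\<forall>\<^sub>F z in nhds y. P z"
  moreover have "((\<lambda>t. y + t *\<^sub>R \<xi>) \<longlongrightarrow> y + 0 *\<^sub>R \<xi>) (nhds 0)"
    by (intro tendsto_intros filterlim_ident)
  ultimately show ?thesis by (auto elim: eventually_compose_filterlim)
qed

lemma DERIV_difference:
  "\<forall>\<^sub>F t in nhds 0. ((\<lambda>t. \<phi> (y + t *\<^sub>R \<xi>) - K (norm (y + t *\<^sub>R \<xi>))) has_field_derivative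
     grad \<phi> (y + t *\<^sub>R \<xi>) \<bullet> \<xi> - k (norm (y + t *\<^sub>R \<xi>)) * (((y + t *\<^sub>R \<xi>) \<bullet> \<xi>) / norm (y + t *\<^sub>R \<xi>))) (at t)"
proof -
  have "(norm \<longlongrightarrow> norm y) (nhds y)" by (intro tendsto_intros filterlim_ident)
  then have "\<forall>\<^sub>F z in nhds y. (K has_field_derivative k (norm z)) (at (norm z))"
    by (rule eventually_compose_filterlim[OF K])
  moreover have "\<forall>\<^sub>F z in nhds y. z \<in> U" using U by (rule eventually_nhds_in_open)
  moreover have "\<forall>\<^sub>F z in nhds y. z \<noteq> 0" using y by (intro t1_space_nhds)
  ultimately have "\<forall>\<^sub>F z in nhds y. (K has_field_derivative k (norm z)) (at (norm z)) \<and> z \<in> U \<and> z \<noteq> 0"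
    by eventually_elim simp
  from line_nhds[OF this, of \<xi>] show ?thesis
  proof eventually_elim
    case (elim t)
    then have "\<phi> differentiable at (y + t *\<^sub>R \<xi>)"
      using C2 U(1) by (auto simp: C2_on_def differentiable_on_eq_differentiable_at)
    then show ?case
      using elim by (intro DERIV_diff DERIV_along_line DERIV_chain2[of K] DERIV_norm_along_line) auto
  qed
qed

context
  assumes max: "\<forall>\<^sub>F z in nhds y. \<phi> z - K (norm z) \<le> \<phi> y - K (norm y)"
begin

lemma max_line: "\<forall>\<^sub>F t in nhds 0. \<phi> (y + t *\<^sub>R \<xi>) - K (norm (y + t *\<^sub>R \<xi>)) \<le> \<phi> (y + 0 *\<^sub>R \<xi>) - K (norm (y + 0 *\<^sub>R \<xi>))"
  using line_nhds[OF max, of \<xi>] by simp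

lemma grad_eq: "grad \<phi> y = (k (norm y) / norm y) *\<^sub>R y"
proof -
  have "grad \<phi> y \<bullet> \<xi> = ((k (norm y) / norm y) *\<^sub>R y) \<bullet> \<xi>" for \<xi>
    using second_derivative_at_local_max(1)[OF DERIV_difference max_line, of \<xi>] by simp
  then show ?thesis by (metis vector_eq_rdot)
qed

text \<open>The right side is the Hessian of K(|x|) as a quadratic form: eigenvalue k' in the radial
  direction, k / |y| in the tangential ones. The bound is the second derivative test along the line
  with direction \<xi>.\<close>

lemma hessian_le:
  assumes k: "(k has_field_derivative k') (at (norm y))"
  shows "(\<Sum>j\<in>UNIV. \<Sum>i\<in>UNIV. \<xi> $ j * \<xi> $ i * partial_deriv i (partial_deriv j \<phi>) y) \<le>
    k' * (y \<bullet> \<xi> / norm y)\<^sup>2 + k (norm y) / norm y * (\<xi> \<bullet> \<xi> - (y \<bullet> \<xi> / norm y)\<^sup>2)"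
proof -
  let ?z = "\<lambda>t. y + t *\<^sub>R \<xi>"
  let ?H = "\<Sum>j\<in>UNIV. \<Sum>i\<in>UNIV. \<xi> $ j * \<xi> $ i * partial_deriv i (partial_deriv j \<phi>) y"
  let ?n = "norm y"
  have pd: "partial_deriv j \<phi> differentiable at (?z 0)" for j
    using C2 U by (auto simp: C2_on_def differentiable_on_eq_differentiable_at)
  have "((\<lambda>t. \<Sum>j\<in>UNIV. partial_deriv j \<phi> (?z t) * \<xi> $ j) has_field_derivative
      (\<Sum>j\<in>UNIV. (grad (partial_deriv j \<phi>) (?z 0) \<bullet> \<xi>) * \<xi> $ j)) (at 0)"
    by (intro DERIV_sum DERIV_cmult_right DERIV_along_line pd)
  moreover have "(\<Sum>j\<in>UNIV. (grad (partial_deriv j \<phi>) (?z 0) \<bullet> \<xi>) * \<xi> $ j) = ?H"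
    by (simp add: inner_vec_def grad_def sum_distrib_right sum_distrib_left mult_ac)
  ultimately have g: "((\<lambda>t. grad \<phi> (?z t) \<bullet> \<xi>) has_field_derivative ?H) (at 0)"
    by (simp add: inner_vec_def grad_def)
  have n: "((\<lambda>t. norm (?z t)) has_field_derivative (y \<bullet> \<xi>) / ?n) (at 0)"
    using DERIV_norm_along_line[of y 0 \<xi>] y by simp
  have kn: "((\<lambda>t. k (norm (?z t))) has_field_derivative k' * ((y \<bullet> \<xi>) / ?n)) (at 0)"
    using DERIV_chain2[OF _ n, of k k'] k by simp
  have i: "((\<lambda>t. ?z t \<bullet> \<xi>) has_field_derivative \<xi> \<bullet> \<xi>) (at 0)"
    unfolding has_field_derivative_def by (auto intro!: derivative_eq_intros simp: mult.commute)
  have "((\<lambda>t. (?z t \<bullet> \<xi>) / norm (?z t)) has_field_derivative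
      (\<xi> \<bullet> \<xi> * norm (?z 0) - (?z 0 \<bullet> \<xi>) * ((y \<bullet> \<xi>) / ?n)) / (norm (?z 0) * norm (?z 0))) (at 0)"
    using y by (intro DERIV_divide[OF i n]) simp
  from DERIV_diff[OF g DERIV_mult[OF kn this]]
  have D: "((\<lambda>t. grad \<phi> (?z t) \<bullet> \<xi> - k (norm (?z t)) * ((?z t \<bullet> \<xi>) / norm (?z t))) has_field_derivative
      ?H - (k' * ((y \<bullet> \<xi>) / ?n) * ((y \<bullet> \<xi>) / ?n) +
        (\<xi> \<bullet> \<xi> * ?n - (y \<bullet> \<xi>) * ((y \<bullet> \<xi>) / ?n)) / (?n * ?n) * k ?n)) (at 0)"
    by simp
  have "?H - (k' * ((y \<bullet> \<xi>) / ?n) * ((y \<bullet> \<xi>) / ?n) +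
        (\<xi> \<bullet> \<xi> * ?n - (y \<bullet> \<xi>) * ((y \<bullet> \<xi>) / ?n)) / (?n * ?n) * k ?n) \<le> 0"
    by (rule second_derivative_at_local_max(2)[OF DERIV_difference max_line D])
  moreover have "(X * m - Y * (Y / m)) / (m * m) * c = c / m * (X - (Y / m)\<^sup>2)" if "m \<noteq> 0" for X Y m c :: real
    using that by (simp add: field_simps power2_eq_square)
  ultimately show ?thesis
    using y by (simp add: power2_eq_square)
qed

text \<open>The matrix of second-order coefficients of the normalized \<open>p\<close>-Laplacian is
  \<open>I + (p - 2) e e\<^sup>T\<close>, the square of \<open>I + (sqrt (p - 1) - 1) e e\<^sup>T\<close>, where \<open>e = y / norm y\<close>.
  The Hessians are therefore compared along the columns of the latter matrix.\<close>

lemma normalized_p_laplacian_le: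
  assumes k: "(k has_field_derivative k') (at (norm y))" and p: "1 < p" and nz: "grad \<phi> y \<noteq> 0"
  shows "normalized_p_laplacian p \<phi> y \<le> (p - 1) * k' + (real CARD('n) - 1) * k (norm y) / norm y"
proof -
  define e where "e = y /\<^sub>R norm y"
  define c where "c = sqrt (p - 1) - 1"
  define b where "b l = axis l 1 + (c * e $ l) *\<^sub>R e" for l :: 'n
  define D where "D i j = partial_deriv i (partial_deriv j \<phi>) y" for i j
  have e: "e \<bullet> e = 1" using y by (simp add: e_def dot_square_norm power2_eq_square)
  have esum: "(\<Sum>l\<in>UNIV. e $ l * e $ l) = 1" using e by (simp add: inner_vec_def)
  have c: "c\<^sup>2 + 2 * c = p - 2"
    using p by (simp add: c_def power2_eq_square algebra_simps)
  have bl: "b l $ j = (if l = j then 1 else 0) + c * e $ l * e $ j" for l j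
    by (simp add: b_def axis_def)
  have be: "e \<bullet> b l = (1 + c) * e $ l" for l
    using e by (simp add: b_def inner_add_right inner_axis algebra_simps)
  have bb: "b l \<bullet> b l = 1 + (p - 2) * (e $ l)\<^sup>2" for l
  proof -
    have "b l \<bullet> b l = 1 + (c\<^sup>2 + 2 * c) * (e $ l)\<^sup>2"
      using e by (simp add: b_def inner_add_right inner_add_left inner_axis inner_axis' power2_eq_square
          inner_axis_axis algebra_simps)
    then show ?thesis unfolding c .
  qed
  \<comment> \<open>The matrix with rows b l is symmetric, and its square has the coefficients of
    the operator since (1 + c)^2 = p - 1. Summing the Hessian bounds over all b l therefore produces
    the operator.\<close>
  have cols: "(\<Sum>l\<in>UNIV. b l $ j * b l $ i) = (if j = i then 1 else 0) + (p - 2) * (e $ j * e $ i)" for i j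
  proof -
    have "(\<Sum>l\<in>UNIV. b l $ j * b l $ i) =
        (\<Sum>l\<in>UNIV. (if l = j then if j = i then 1 else 0 else 0) + (if l = j then c * e $ j * e $ i else 0)
          + (if l = i then c * e $ j * e $ i else 0) + c\<^sup>2 * e $ j * e $ i * (e $ l * e $ l))"
      by (intro sum.cong) (auto simp: bl algebra_simps power2_eq_square)
    also have "\<dots> = (if j = i then 1 else 0) + (c\<^sup>2 + 2 * c) * (e $ j * e $ i)"
      unfolding sum.distrib sum_distrib_left[symmetric] esum by (simp add: algebra_simps)
    finally show ?thesis unfolding c .
  qed
  have "(\<Sum>l\<in>UNIV. \<Sum>j\<in>UNIV. \<Sum>i\<in>UNIV. b l $ j * b l $ i * D i j) \<le>
      (\<Sum>l\<in>UNIV. k' * (y \<bullet> b l / norm y)\<^sup>2 + k (norm y) / norm y * (b l \<bullet> b l - (y \<bullet> b l / norm y)\<^sup>2))"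
    unfolding D_def by (intro sum_mono hessian_le k)
  also have "\<dots> = (\<Sum>l\<in>UNIV. (p - 1) * k' * (e $ l * e $ l)
      + k (norm y) / norm y * (1 - (e $ l * e $ l)))"
  proof (intro sum.cong refl)
    fix l
    have "y \<bullet> b l / norm y = e \<bullet> b l" by (simp add: e_def divide_inverse mult.commute)
    then have sq: "(y \<bullet> b l / norm y)\<^sup>2 = (p - 1) * (e $ l * e $ l)"
      using p by (simp add: be c_def power_mult_distrib power2_eq_square)
    show "k' * (y \<bullet> b l / norm y)\<^sup>2 + k (norm y) / norm y * (b l \<bullet> b l - (y \<bullet> b l / norm y)\<^sup>2) =
        (p - 1) * k' * (e $ l * e $ l) + k (norm y) / norm y * (1 - (e $ l * e $ l))"
      unfolding sq bb by (simp add: power2_eq_square algebra_simps)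
  qed
  also have "\<dots> = (p - 1) * k' + k (norm y) / norm y * (real CARD('n) - 1)"
    unfolding sum.distrib sum_distrib_left[symmetric] sum_subtractf esum by simp
  finally have "(\<Sum>l\<in>UNIV. \<Sum>j\<in>UNIV. \<Sum>i\<in>UNIV. b l $ j * b l $ i * D i j) \<le>
      (p - 1) * k' + k (norm y) / norm y * (real CARD('n) - 1)" .
  moreover have "(\<Sum>l\<in>UNIV. \<Sum>j\<in>UNIV. \<Sum>i\<in>UNIV. b l $ j * b l $ i * D i j) =
      (\<Sum>j\<in>UNIV. \<Sum>i\<in>UNIV. ((if j = i then 1 else 0) + (p - 2) * (e $ j * e $ i)) * D i j)"
    unfolding cols[symmetric] sum_distrib_right
    by (rule trans[OF sum.swap], rule sum.cong[OF refl], rule sum.swap)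
  moreover have "(\<Sum>j\<in>UNIV. \<Sum>i\<in>UNIV. ((if j = i then 1 else 0) + (p - 2) * (e $ j * e $ i)) * D i j) =
      normalized_p_laplacian p \<phi> y"
  proof -
    \<comment> \<open>The gradient is k times e; as k is nonzero, its normalization cancels k and
      leaves the direction e up to sign.\<close>
    have k0: "k (norm y) \<noteq> 0" using nz grad_eq by auto
    have g: "grad \<phi> y = k (norm y) *\<^sub>R e" by (simp add: grad_eq e_def divide_inverse)
    then have ng: "(norm (grad \<phi> y))\<^sup>2 = (k (norm y))\<^sup>2"
      using e by (simp add: power_mult_distrib power2_norm_eq_inner)
    have pd: "partial_deriv i \<phi> y = k (norm y) * e $ i" for i
      using g by (simp add: grad_def vec_eq_iff)
    have "(p - 2) / (k (norm y))\<^sup>2 * (\<Sum>i\<in>UNIV. \<Sum>j\<in>UNIV. D i j * (k (norm y) * e $ i) * (k (norm y) * e $ j))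
        = (\<Sum>j\<in>UNIV. \<Sum>i\<in>UNIV. (p - 2) * (e $ j * e $ i) * D i j)"
      unfolding sum_distrib_left
      by (rule trans[OF sum.swap], rule sum.cong[OF refl], rule sum.cong[OF refl])
        (use k0 in \<open>simp add: power2_eq_square\<close>)
    note quad = this
    have diag: "(\<Sum>i\<in>UNIV. (if j = i then 1 else 0) * D i j) = D j j" for j
    proof -
      have "(\<Sum>i\<in>UNIV. (if j = i then 1 else 0) * D i j) = (\<Sum>i\<in>UNIV. if j = i then D i j else 0)"
        by (intro sum.cong refl) simp
      then show ?thesis by simp
    qed
    have "normalized_p_laplacian p \<phi> y =
        (\<Sum>i\<in>UNIV. D i i) + (\<Sum>j\<in>UNIV. \<Sum>i\<in>UNIV. (p - 2) * (e $ j * e $ i) * D i j)"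
      unfolding quad[symmetric] unfolding normalized_p_laplacian_def laplacian_def ng pd D_def by (rule refl)
    then show ?thesis
      unfolding distrib_right sum.distrib diag by simp
  qed
  ultimately show ?thesis by (simp add: mult.commute)
qed

end

end

section \<open>Perturbing the constant of integration\<close>

context radial_equation
begin

text \<open>Any primitive will do: only differences of its values and maxima of functions involving
  it are used, so its additive constant is immaterial.\<close>

definition antiderivative_k :: "real \<Rightarrow> real \<Rightarrow> real" where
  "antiderivative_k C = (SOME K. \<forall>t. 0 < t \<and> t < R \<longrightarrow> (K has_field_derivative k C t) (at t))"

lemma antiderivative_k_DERIV:
  assumes "0 < t" "t < R"
  shows "(antiderivative_k C has_field_derivative k C t) (at t)"
proof -
  have "\<exists>K. \<forall>t. 0 < t \<and> t < R \<longrightarrow> (K has_field_derivative k C t) (at t)"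
    by (rule ex_antiderivative_k[of C]) blast
  from someI_ex[OF this] show ?thesis using assms unfolding antiderivative_k_def by blast
qed

text \<open>The additive constants for C and C + s are unrelated, so closeness is stated for
  increments. It follows from uniform continuity of k in both variables on a compact
  rectangle.\<close>

lemma antiderivative_k_near:
  assumes ab: "0 < a" "a \<le> b" "b < R" and \<eta>: "0 < \<eta>"
  obtains s0 where "0 < s0" "\<And>s r1 r2. \<bar>s\<bar> < s0 \<Longrightarrow> r1 \<in> {a..b} \<Longrightarrow> r2 \<in> {a..b} \<Longrightarrow>
    (antiderivative_k (C + s) r1 - antiderivative_k (C + s) r2) <
    (antiderivative_k C r1 - antiderivative_k C r2) + \<eta>"
proof -
  \<comment> \<open>The summand 1 keeps the denominator positive when a = b and makes the final
    inequality strict.\<close>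
  define \<eta>' where "\<eta>' = \<eta> / (b - a + 1)"
  have \<eta>': "0 < \<eta>'" "\<eta>' * (b - a) < \<eta>"
  proof -
    show "0 < \<eta>'" using \<eta> ab by (simp add: \<eta>'_def)
    then have "\<eta>' * (b - a) < \<eta>' * (b - a + 1)" by simp
    then show "\<eta>' * (b - a) < \<eta>" using ab by (simp add: \<eta>'_def)
  qed
  let ?S = "{C - 1..C + 1} \<times> {a..b}"
  have "uniformly_continuous_on ?S (\<lambda>(C, r). k C r)"
    by (intro compact_uniformly_continuous continuous_on_subset[OF continuous_on_k2] compact_Times)
      (use ab in auto)
  then obtain \<delta> where \<delta>: "0 < \<delta>"
    "\<And>x x'. x \<in> ?S \<Longrightarrow> x' \<in> ?S \<Longrightarrow> dist x' x < \<delta> \<Longrightarrow>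
      dist ((\<lambda>(C, r). k C r) x') ((\<lambda>(C, r). k C r) x) < \<eta>'"
    using \<eta>' unfolding uniformly_continuous_on_def by meson
  have close: "\<bar>k (C + s) r - k C r\<bar> < \<eta>'" if "\<bar>s\<bar> < min 1 \<delta>" "r \<in> {a..b}" for s r
  proof -
    have "- 1 \<le> s" "s \<le> 1" using that by linarith+
    then show ?thesis
      using \<delta>(2)[of "(C, r)" "(C + s, r)"] that by (auto simp: dist_Pair_Pair dist_real_def)
  qed
  show ?thesis
  proof (rule that[of "min 1 \<delta>"])
    show "0 < min 1 \<delta>" using \<delta> by simp
    fix s r1 r2 assume s: "\<bar>s\<bar> < min 1 \<delta>" and r: "r1 \<in> {a..b}" "r2 \<in> {a..b}"
    let ?h = "\<lambda>r. antiderivative_k (C + s) r - antiderivative_k C r"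
    have "norm (?h r1 - ?h r2) \<le> \<eta>' * norm (r1 - r2)"
    proof (rule field_differentiable_bound[of "{a..b}" ?h "\<lambda>r. k (C + s) r - k C r"])
      show "(?h has_field_derivative k (C + s) r - k C r) (at r within {a..b})" if "r \<in> {a..b}" for r
      proof -
        have "0 < r" "r < R" using that ab by auto
        then show ?thesis
          by (intro has_field_derivative_at_within[OF DERIV_diff[OF antiderivative_k_DERIV antiderivative_k_DERIV]])
      qed
      show "norm (k (C + s) r - k C r) \<le> \<eta>'" if "r \<in> {a..b}" for r
        using close[OF s that] by simp
    qed (use r in auto)
    also have "\<dots> \<le> \<eta>' * (b - a)"
      using r \<eta>' by (intro mult_left_mono) auto
    finally have "\<bar>?h r1 - ?h r2\<bar> < \<eta>" using \<eta>'(2) by simp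
    then show "(antiderivative_k (C + s) r1 - antiderivative_k (C + s) r2) <
      (antiderivative_k C r1 - antiderivative_k C r2) + \<eta>" by linarith
  qed
qed

text \<open>With a negative constant the flux does not vanish at the origin while the weight does,
  so the slope must tend to -\<infinity>.\<close>

lemma k_unbounded_below:
  assumes "0 < s" "0 < b"
  obtains a where "0 < a" "a < b" "a < R" "k (- s) a < - L"
proof -
  \<comment> \<open>Any fixed slope below -L serves: its flux plus F tends to 0 > -s at the origin,
    which puts \<open>k (- s)\<close> below it.\<close>
  define w where "w = - \<bar>L\<bar> - 1"
  have "isCont F 0"
    using F_DERIV[of 0] R by (auto intro: DERIV_isCont)
  then have "(F \<longlongrightarrow> 0) (at_right 0)"
    using F_nonpos[of 0] by (simp add: isCont_def filterlim_at_split)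
  moreover have "((\<lambda>a. a powr (d - 1)) \<longlongrightarrow> 0) (at_right 0)"
    using d by (intro tendsto_eq_intros) (auto simp: eventually_at_filter)
  ultimately have "((\<lambda>a. \<kappa> * (\<bar>w\<bar> powr (q - 2) * w) * a powr (d - 1) + F a) \<longlongrightarrow>
      \<kappa> * (\<bar>w\<bar> powr (q - 2) * w) * 0 + 0) (at_right 0)"
    by (intro tendsto_intros)
  then have "\<forall>\<^sub>F a in at_right 0. - s < \<kappa> * (\<bar>w\<bar> powr (q - 2) * w) * a powr (d - 1) + F a"
    by (rule order_tendstoD) (use assms in simp)
  moreover have "\<forall>\<^sub>F a in at_right 0. a < min b R"
    using assms R by (intro eventually_at_rightI[of 0 "min b R"]) auto
  moreover have "\<forall>\<^sub>F a in at_right 0. (0::real) < a"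
    by (rule eventually_at_right_less)
  ultimately have "\<forall>\<^sub>F a in at_right 0. 0 < a \<and> a < b \<and> a < R \<and> k (- s) a < - L"
  proof eventually_elim
    case (elim a)
    then have "k (- s) a \<le> w" by (subst le_k_iff(2)) auto
    then show ?case using elim by (auto simp: w_def)
  qed
  then have "\<exists>a. 0 < a \<and> a < b \<and> a < R \<and> k (- s) a < - L"
    by (rule eventually_happens'[rotated]) simp
  then show ?thesis using that by blast
qed

lemma touching_antiderivative_k:
  assumes "open U" "y \<in> U" "C2_on U \<phi>" "y \<noteq> 0" "norm y < R"
  shows "touching U \<phi> y (antiderivative_k C) (k C)"
proof
  have "\<forall>\<^sub>F r in nhds (norm y). r \<in> {0<..<R}"
    using assms by (intro eventually_nhds_in_open) auto
  then show "\<forall>\<^sub>F r in nhds (norm y). (antiderivative_k C has_field_derivative k C r) (at r)"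
    by eventually_elim (simp add: antiderivative_k_DERIV)
qed (use assms in auto)

text \<open>The two relations between \<kappa>, q, d and p, N turn the Hessian bound into the left
  side of \<open>k_equation\<close>. The nonzero gradient also ensures that k is nonzero, hence
  differentiable at that radius.\<close>

lemma source_le_operator:
  fixes \<phi> :: "real ^ 'n \<Rightarrow> real"
  assumes U: "open U" "y \<in> U" "C2_on U \<phi>" and y: "y \<noteq> 0" "norm y < R"
    and max: "\<forall>\<^sub>F z in nhds y. \<phi> z - antiderivative_k C (norm z) \<le> \<phi> y - antiderivative_k C (norm y)"
    and nz: "grad \<phi> y \<noteq> 0" and p: "1 < p"
    and \<kappa>q: "\<kappa> * (q - 1) = p - 1" and \<kappa>d: "\<kappa> * (d - 1) = real CARD('n) - 1"
  shows "f (norm y) \<le> - (norm (grad \<phi> y) powr (q - 2) * normalized_p_laplacian p \<phi> y)"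
proof -
  interpret T: touching U \<phi> y "antiderivative_k C" "k C"
    using U y by (rule touching_antiderivative_k)
  let ?k = "k C (norm y)"
  have g: "grad \<phi> y = (?k / norm y) *\<^sub>R y" using max by (rule T.grad_eq)
  then have k0: "?k \<noteq> 0" using nz by auto
  have ng: "norm (grad \<phi> y) = \<bar>?k\<bar>" using y by (simp add: g)
  obtain k' where k': "(k C has_field_derivative k') (at (norm y))"
    "\<kappa> * \<bar>?k\<bar> powr (q - 2) * ((q - 1) * k' + (d - 1) / norm y * ?k) = - f (norm y)"
    by (rule k_equation[of "norm y" C, OF _ y(2) k0], use y(1) in simp, rule that)
  have "normalized_p_laplacian p \<phi> y \<le> (p - 1) * k' + (real CARD('n) - 1) * ?k / norm y"
    by (rule T.normalized_p_laplacian_le[OF max k'(1) p nz])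
  then have "\<bar>?k\<bar> powr (q - 2) * normalized_p_laplacian p \<phi> y \<le>
      \<bar>?k\<bar> powr (q - 2) * ((p - 1) * k' + (real CARD('n) - 1) * ?k / norm y)"
    by (intro mult_left_mono) auto
  also have "\<dots> = - f (norm y)"
    unfolding k'(2)[symmetric] \<kappa>q[symmetric] \<kappa>d[symmetric] by (simp add: algebra_simps)
  finally show ?thesis unfolding ng by simp
qed

end

subsection \<open>The viscosity inequality\<close>

lemma C2_on_continuous:
  assumes "C2_on U \<phi>" "S \<subseteq> U"
  shows "continuous_on S \<phi>" "continuous_on S (grad \<phi>)"
proof -
  have "\<phi> differentiable_on U" using assms(1) by (simp add: C2_on_def)
  from continuous_on_subset[OF differentiable_imp_continuous_on[OF this] assms(2)]
  show "continuous_on S \<phi>" .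
  have "continuous_on U (partial_deriv i \<phi>)" for i
    using assms by (auto simp: C2_on_def intro: differentiable_imp_continuous_on)
  then have "continuous_on S (partial_deriv i \<phi>)" for i
    using assms(2) by (rule continuous_on_subset)
  then show "continuous_on S (grad \<phi>)"
    unfolding grad_def[abs_def] by (intro continuous_on_vec_lambda)
qed

context radial_supersolution
begin

lemma continuous_on_antiderivative_k:
  assumes "\<And>x. x \<in> S \<Longrightarrow> 0 < norm x \<and> norm x < R"
  shows "continuous_on S (\<lambda>x :: real ^ 'n. antiderivative_k C (norm x))"
proof (rule continuous_on_compose2[of "{0<..<R}" "antiderivative_k C" S norm])
  show "continuous_on {0<..<R} (antiderivative_k C)"
    using antiderivative_k_DERIV by (intro continuous_at_imp_continuous_on ballI DERIV_isCont) auto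
  show "continuous_on S norm" by (intro continuous_intros)
qed (use assms in auto)

text \<open>The perturbation \<open>s\<close> of the constant of integration serves only to move the maximum away
  from \<open>x0\<close>: there the gradient of \<open>\<phi>\<close> may vanish and the test functions give no information.\<close>

lemma touching_point_off_origin:
  fixes \<phi> :: "real ^ 'n \<Rightarrow> real" and x0 :: "real ^ 'n"
  assumes U: "open U" "C2_on U \<phi>" and x0: "x0 \<noteq> 0" and \<rho>: "0 < \<rho>" "cball x0 \<rho> \<subseteq> U"
    and inside: "\<rho> < norm x0" "norm x0 + \<rho> < R"
    and below: "\<phi> x0 = V (norm x0)" "\<And>x. x \<in> cball x0 \<rho> \<Longrightarrow> x \<noteq> x0 \<Longrightarrow> \<phi> x < V (norm x)"
    and grad: "\<And>x. x \<in> cball x0 \<rho> \<Longrightarrow> x \<noteq> x0 \<Longrightarrow> grad \<phi> x \<noteq> 0"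
    and p: "1 < p" and \<kappa>q: "\<kappa> * (q - 1) = p - 1" and \<kappa>d: "\<kappa> * (d - 1) = real CARD('n) - 1"
  obtains y where "y \<in> ball x0 \<rho>" "y \<noteq> x0"
    "f (norm y) \<le> - (norm (grad \<phi> y) powr (q - 2) * normalized_p_laplacian p \<phi> y)"
proof -
  define r0 where "r0 = norm x0"
  have r0: "r0 \<in> {0<..<R}" using x0 inside \<rho> by (auto simp: r0_def)
  define C where "C = H r0"
  let ?K = antiderivative_k
  have norm_in: "norm x \<in> {r0 - \<rho>..r0 + \<rho>}" if "x \<in> cball x0 \<rho>" for x
    using that norm_triangle_ineq2[of x x0] norm_triangle_ineq2[of x0 x]
    by (auto simp: r0_def dist_norm norm_minus_commute)
  have norm_R: "0 < norm x \<and> norm x < R" if "x \<in> cball x0 \<rho>" for x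
    using norm_in[OF that] inside by (auto simp: r0_def)
  have strict: "\<phi> x - (?K C (norm x) - ?K C r0) < V r0" if "x \<in> cball x0 \<rho>" "x \<noteq> x0" for x
  proof -
    have "V (norm x) - V r0 \<le> ?K C (norm x) - ?K C r0"
      using V_comparison[OF r0, of "norm x" "?K C"] norm_R[OF that(1)] antiderivative_k_DERIV
      by (simp add: C_def)
    then show ?thesis using below(2)[OF that] by linarith
  qed
  have cont: "continuous_on (cball x0 \<rho>) (\<lambda>x. \<phi> x - (?K C' (norm x) - ?K C' r0))" for C'
    by (intro continuous_intros C2_on_continuous(1)[OF U(2) \<rho>(2)] continuous_on_antiderivative_k norm_R)
  \<comment> \<open>Touching is strict, so by compactness of the sphere it leaves a gap \<delta>,
    which the perturbation must not exhaust.\<close>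
  obtain \<delta> where \<delta>: "0 < \<delta>" "\<And>x. x \<in> sphere x0 \<rho> \<Longrightarrow> \<phi> x - (?K C (norm x) - ?K C r0) \<le> V r0 - \<delta>"
  proof (cases "sphere x0 \<rho> = {}")
    case True
    then show ?thesis using that[of 1] by simp
  next
    case False
    have "continuous_on (sphere x0 \<rho>) (\<lambda>x. \<phi> x - (?K C (norm x) - ?K C r0))"
      by (rule continuous_on_subset[OF cont]) auto
    from continuous_attains_sup[OF compact_sphere False this] obtain m where m: "m \<in> sphere x0 \<rho>" "\<And>x. x \<in> sphere x0 \<rho> \<Longrightarrow>
        \<phi> x - (?K C (norm x) - ?K C r0) \<le> \<phi> m - (?K C (norm m) - ?K C r0)"
      by blast
    show ?thesis
      using that[of "V r0 - (\<phi> m - (?K C (norm m) - ?K C r0))"] strict[of m] m \<rho>(1) by auto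
  qed
  have "0 < r0 - \<rho>" "r0 - \<rho> \<le> r0 + \<rho>" "r0 + \<rho> < R"
    using inside \<rho> by (simp_all add: r0_def)
  note near = antiderivative_k_near[OF this \<delta>(1), of C]
  obtain s0 where s0: "0 < s0" "\<And>s r1 r2. \<bar>s\<bar> < s0 \<Longrightarrow> r1 \<in> {r0 - \<rho>..r0 + \<rho>} \<Longrightarrow> r2 \<in> {r0 - \<rho>..r0 + \<rho>} \<Longrightarrow>
    (?K (C + s) r1 - ?K (C + s) r2) < (?K C r1 - ?K C r2) + \<delta>"
    by (rule near) (rule that)
  \<comment> \<open>A maximum at x0 would force the gradient of \<phi> to equal that of the
    perturbed radial function. As k is strictly increasing in C, this can happen for at most one of
    two distinct perturbations.\<close>
  have "\<exists>s\<in>{s0 / 2, s0 / 3}. grad \<phi> x0 \<noteq> (k (C + s) r0 / r0) *\<^sub>R x0"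
  proof (rule ccontr)
    assume "\<not> ?thesis"
    then have "(k (C + s0 / 2) r0 / r0) *\<^sub>R x0 = (k (C + s0 / 3) r0 / r0) *\<^sub>R x0" by simp
    then have "k (C + s0 / 2) r0 = k (C + s0 / 3) r0" using x0 r0 by simp
    moreover have "k (C + s0 / 3) r0 < k (C + s0 / 2) r0" using r0 s0 by (intro k_strict_mono) auto
    ultimately show False by simp
  qed
  then obtain s where s': "s \<in> {s0 / 2, s0 / 3}" and s_grad: "grad \<phi> x0 \<noteq> (k (C + s) r0 / r0) *\<^sub>R x0" ..
  have "\<bar>s\<bar> < s0" using s' s0(1) by auto
  note s = this s_grad
  let ?\<Phi> = "\<lambda>x. \<phi> x - (?K (C + s) (norm x) - ?K (C + s) r0)"
  have "cball x0 \<rho> \<noteq> {}" using \<rho> by simp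
  from continuous_attains_sup[OF compact_cball this cont[of "C + s"]]
  obtain y where y: "y \<in> cball x0 \<rho>" "\<And>x. x \<in> cball x0 \<rho> \<Longrightarrow> ?\<Phi> x \<le> ?\<Phi> y"
    by blast
  have "y \<notin> sphere x0 \<rho>"
  proof
    assume "y \<in> sphere x0 \<rho>"
    then have "\<phi> y - (?K C (norm y) - ?K C r0) \<le> V r0 - \<delta>" by (rule \<delta>(2))
    \<comment> \<open>The perturbation gains less than \<delta> on the sphere, so the value there
      remains below the value at x0.\<close>
    moreover have "?K (C + s) r0 - ?K (C + s) (norm y) < ?K C r0 - ?K C (norm y) + \<delta>"
      using s(1) norm_in[OF y(1)] \<rho> by (intro s0(2)) auto
    ultimately have "?\<Phi> y < V r0" by linarith
    also have "V r0 = ?\<Phi> x0" using below(1) by (simp add: r0_def)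
    finally show False using y(2)[of x0] \<rho> by simp
  qed
  then have yb: "y \<in> ball x0 \<rho>" using y(1) by auto
  have "\<forall>\<^sub>F z in nhds y. z \<in> ball x0 \<rho>" using yb by (intro eventually_nhds_in_open) auto
  then have max: "\<forall>\<^sub>F z in nhds y. \<phi> z - ?K (C + s) (norm z) \<le> \<phi> y - ?K (C + s) (norm y)"
  proof eventually_elim
    case (elim z)
    then show ?case using y(2)[of z] by simp
  qed
  have yU: "y \<in> U" "y \<noteq> 0" "norm y < R" using y(1) \<rho>(2) norm_R[OF y(1)] by auto
  interpret T: touching U \<phi> y "?K (C + s)" "k (C + s)"
    using U yU by (intro touching_antiderivative_k)
  have "y \<noteq> x0" using T.grad_eq[OF max] s(2) by (auto simp: r0_def)
  moreover have "f (norm y) \<le> - (norm (grad \<phi> y) powr (q - 2) * normalized_p_laplacian p \<phi> y)"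
    by (rule source_le_operator[OF U(1) yU(1) U(2) yU(2,3) max grad[OF y(1) \<open>y \<noteq> x0\<close>] p \<kappa>q \<kappa>d])
  ultimately show ?thesis using that yb by blast
qed

text \<open>At the origin, the perturbation is negative, so that the perturbed radial solution has
  derivative \<open>- \<infinity>\<close> at \<open>0\<close> and a maximum cannot lie near \<open>0\<close>.\<close>

lemma touching_point_near_origin:
  fixes \<phi> :: "real ^ 'n \<Rightarrow> real"
  assumes U: "open U" "C2_on U \<phi>" and \<rho>: "0 < \<rho>" "cball 0 \<rho> \<subseteq> U" "\<rho> < R"
    and below: "\<phi> 0 = V 0" "\<And>x. x \<in> cball 0 \<rho> \<Longrightarrow> x \<noteq> 0 \<Longrightarrow> \<phi> x < V (norm x)"
    and grad: "\<And>x. x \<in> cball 0 \<rho> \<Longrightarrow> x \<noteq> 0 \<Longrightarrow> grad \<phi> x \<noteq> 0"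
    and p: "1 < p" and \<kappa>q: "\<kappa> * (q - 1) = p - 1" and \<kappa>d: "\<kappa> * (d - 1) = real CARD('n) - 1"
  obtains y where "y \<in> ball 0 \<rho>" "y \<noteq> 0"
    "f (norm y) \<le> - (norm (grad \<phi> y) powr (q - 2) * normalized_p_laplacian p \<phi> y)"
proof -
  let ?K = antiderivative_k
  define K0 where "K0 r = integral {0..r} (k 0)" for r
  have K0_cont: "continuous_on {0..<R} K0"
    unfolding K0_def[abs_def] by (rule antiderivative_half_open(2)[OF continuous_on_k_0])
  have K0: "(K0 has_field_derivative k 0 t) (at t)" if "0 < t" "t < R" for t
    unfolding K0_def[abs_def] by (rule antiderivative_half_open(1)[OF continuous_on_k_0 that])
  \<comment> \<open>\<open>K0\<close> starts at the origin and serves the comparison there; it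
    differs from the arbitrary primitive for C = 0 by a constant, so increments may be
    exchanged.\<close>
  have K0_diff: "K0 r1 - K0 r2 = ?K 0 r1 - ?K 0 r2" if "r1 \<in> {0<..<R}" "r2 \<in> {0<..<R}" for r1 r2
  proof -
    have D: "((\<lambda>r. K0 r - ?K 0 r) has_field_derivative 0) (at r within {0<..<R})" if "r \<in> {0<..<R}" for r
      using DERIV_diff[OF K0[of r] antiderivative_k_DERIV[of r 0]] that
      by (simp add: has_field_derivative_at_within)
    have "\<exists>c. \<forall>r\<in>{0<..<R}. K0 r - ?K 0 r = c"
      by (rule has_field_derivative_zero_constant[OF _ D]) auto
    then obtain c where "\<And>r. r \<in> {0<..<R} \<Longrightarrow> K0 r - ?K 0 r = c" by blast
    from this[OF that(1)] this[OF that(2)] show ?thesis by linarith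
  qed
  have strict: "\<phi> x < V 0 + K0 (norm x)" if "x \<in> cball 0 \<rho>" "x \<noteq> 0" for x
  proof -
    have "V (norm x) - V 0 \<le> K0 (norm x)"
      unfolding K0_def by (rule V_comparison_0) (use that \<rho> in auto)
    then show ?thesis using below(2)[OF that] by linarith
  qed
  have \<phi>_cont: "continuous_on (cball 0 \<rho>) \<phi>" and grad_cont: "continuous_on (cball 0 \<rho>) (grad \<phi>)"
    by (rule C2_on_continuous[OF U(2) \<rho>(2)])+
  define e :: "real ^ 'n" where "e = axis undefined 1"
  have e: "norm e = 1" by (simp add: e_def)
  have sphere: "\<rho> *\<^sub>R e \<in> sphere 0 \<rho>" using e \<rho> by simp
  obtain \<delta> where \<delta>: "0 < \<delta>" "\<And>x. x \<in> sphere 0 \<rho> \<Longrightarrow> \<phi> x \<le> V 0 + K0 \<rho> - \<delta>"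
  proof -
    have c: "continuous_on (sphere 0 \<rho>) \<phi>" by (rule continuous_on_subset[OF \<phi>_cont]) auto
    have "sphere (0 :: real ^ 'n) \<rho> \<noteq> {}" using sphere by blast
    from continuous_attains_sup[OF compact_sphere this c] obtain m where m: "m \<in> sphere 0 \<rho>" "\<And>x. x \<in> sphere 0 \<rho> \<Longrightarrow> \<phi> x \<le> \<phi> m"
      by blast
    show ?thesis
      using that[of "V 0 + K0 \<rho> - \<phi> m"] strict[of m] m \<rho>(1) by auto
  qed
  \<comment> \<open>The perturbed primitive may be unbounded at the origin, so the reference value
    at 0 is replaced by one at a nearby point on a ray, at a cost below \<delta> / 2.\<close>
  obtain r1 where r1: "0 < r1" "r1 < \<rho>" "V 0 - \<delta> / 2 < \<phi> (r1 *\<^sub>R e) - K0 r1"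
  proof -
    have "continuous_on {0..\<rho>} (\<lambda>r. \<phi> (r *\<^sub>R e) - K0 r)"
      using e \<rho> by (intro continuous_intros continuous_on_compose2[OF \<phi>_cont]
          continuous_on_subset[OF K0_cont]) auto
    from this[unfolded continuous_on_iff, rule_format, of 0 "\<delta> / 2"] \<rho> \<delta>
    obtain t where t: "0 < t" "\<And>r. r \<in> {0..\<rho>} \<Longrightarrow> dist r 0 < t \<Longrightarrow>
        dist (\<phi> (r *\<^sub>R e) - K0 r) (\<phi> (0 *\<^sub>R e) - K0 0) < \<delta> / 2"
      by (auto simp del: scaleR_zero_left)
    define r where "r = min t \<rho> / 2"
    have r: "0 < r" "r < t" "r < \<rho>" using t \<rho> by (auto simp: r_def)
    have "K0 0 = 0" by (simp add: K0_def)
    then have "\<bar>\<phi> (r *\<^sub>R e) - K0 r - V 0\<bar> < \<delta> / 2"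
      using t(2)[of r] r below(1) by (simp add: dist_real_def)
    then have "V 0 - \<delta> / 2 < \<phi> (r *\<^sub>R e) - K0 r" by linarith
    then show ?thesis using that r by blast
  qed
  have "r1 \<le> \<rho>" "0 < \<delta> / 2" using r1 \<delta> by simp_all
  \<comment> \<open>The other half of the gap pays for the perturbation. Closeness is required only
    on [r1, \<rho>], so the inner radius can be chosen after s.\<close>
  note near = antiderivative_k_near[OF r1(1) this(1) \<rho>(3) this(2), of 0]
  obtain s0 where s0: "0 < s0" "\<And>s t1 t2. \<bar>s\<bar> < s0 \<Longrightarrow> t1 \<in> {r1..\<rho>} \<Longrightarrow> t2 \<in> {r1..\<rho>} \<Longrightarrow>
    (?K (0 + s) t1 - ?K (0 + s) t2) < (?K 0 t1 - ?K 0 t2) + \<delta> / 2"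
    by (rule near) (rule that)
  define s where "s = - s0 / 2"
  have s: "s < 0" "\<bar>s\<bar> < s0" using s0 by (auto simp: s_def)
  have "compact (grad \<phi> ` cball 0 \<rho>)" by (intro compact_continuous_image grad_cont compact_cball)
  from compact_imp_bounded[OF this]
  obtain L where L: "\<And>x. x \<in> cball 0 \<rho> \<Longrightarrow> norm (grad \<phi> x) \<le> L"
    unfolding bounded_iff by blast
  obtain a where a: "0 < a" "a < r1" "k s a < - L"
    by (rule k_unbounded_below[of "- s" r1 L]) (use s r1 that in simp_all)
  \<comment> \<open>The outer sphere will be excluded by the gap \<delta>, the inner one by the
    steep slope at a; the maximum over A then lies in the open annulus.\<close>
  define A where "A = {x :: real ^ 'n. a \<le> norm x \<and> norm x \<le> \<rho>}"
  have A_cball: "x \<in> cball 0 \<rho>" if "x \<in> A" for x using that by (simp add: A_def)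
  have "A = cball 0 \<rho> - ball 0 a" by (auto simp: A_def)
  then have "compact A" by (simp add: compact_diff)
  let ?\<Phi> = "\<lambda>x. \<phi> x - ?K s (norm x)"
  have "continuous_on A ?\<Phi>"
    using A_cball a \<rho> by (intro continuous_intros continuous_on_subset[OF \<phi>_cont]
        continuous_on_antiderivative_k) (auto simp: A_def)
  note \<Phi>_cont = this
  have rA: "r1 *\<^sub>R e \<in> A" using e r1 a by (simp add: A_def)
  then have "A \<noteq> {}" by blast
  from continuous_attains_sup[OF \<open>compact A\<close> this \<Phi>_cont] obtain y where y: "y \<in> A" "\<And>x. x \<in> A \<Longrightarrow> ?\<Phi> x \<le> ?\<Phi> y"
    by blast
  have y_ne: "y \<noteq> 0" using y(1) a by (auto simp: A_def)
  have y_R: "norm y < R" using y(1) \<rho> by (auto simp: A_def)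
  have yU: "y \<in> U" using A_cball[OF y(1)] \<rho>(2) by auto
  interpret T: touching U \<phi> y "?K s" "k s"
    using U yU y_ne y_R by (intro touching_antiderivative_k)
  have "norm y \<noteq> \<rho>"
  proof
    assume n: "norm y = \<rho>"
    have "?K s r1 - ?K s \<rho> < K0 r1 - K0 \<rho> + \<delta> / 2"
      using s0(2)[of s r1 \<rho>] s(2) r1 \<rho> K0_diff[of r1 \<rho>] by simp
    moreover have "\<phi> y \<le> V 0 + K0 \<rho> - \<delta>" using \<delta>(2)[of y] n by simp
    ultimately have "?\<Phi> y < \<phi> (r1 *\<^sub>R e) - ?K s r1" using n r1(3) by simp
    then show False using y(2)[OF rA] e r1(1) by simp
  qed
  moreover have "norm y \<noteq> a"
  proof
    assume n: "norm y = a"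
    \<comment> \<open>On the inner sphere, moving outward changes the function at rate grad \<phi>
      \<cdot> \<xi> - k s a, which is positive since k s a lies below -L. So a maximum there is
      impossible.\<close>
    define \<xi> where "\<xi> = y /\<^sub>R a"
    have y\<xi>: "y \<bullet> \<xi> = a" "norm \<xi> = 1"
      using n a by (simp_all add: \<xi>_def dot_square_norm power2_eq_square)
    have D: "((\<lambda>t. ?\<Phi> (y + t *\<^sub>R \<xi>)) has_field_derivative grad \<phi> y \<bullet> \<xi> - k s a) (at 0)"
      using eventually_nhds_x_imp_x[OF T.DERIV_difference[of \<xi>]] n y\<xi> a by simp
    have "\<bar>grad \<phi> y \<bullet> \<xi>\<bar> \<le> L"
      using Cauchy_Schwarz_ineq2[of "grad \<phi> y" \<xi>] y\<xi>(2) L[OF A_cball[OF y(1)]] by simp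
    then have "0 < grad \<phi> y \<bullet> \<xi> - k s a" using a(3) by linarith
    from DERIV_pos_inc_right[OF D this] obtain c where
      c: "0 < c" "\<And>h. 0 < h \<Longrightarrow> h < c \<Longrightarrow> ?\<Phi> y < ?\<Phi> (y + h *\<^sub>R \<xi>)"
      by auto
    define h where "h = min c (\<rho> - a) / 2"
    have h: "0 < h" "h < c" "a + h \<le> \<rho>" using c a r1 by (auto simp: h_def min_def field_simps)
    have "y + h *\<^sub>R \<xi> = (1 + h / a) *\<^sub>R y"
      by (simp add: \<xi>_def scaleR_left_distrib divide_inverse)
    then have "norm (y + h *\<^sub>R \<xi>) = a + h"
      using n h a by (simp add: field_simps)
    then have "y + h *\<^sub>R \<xi> \<in> A" using h by (simp add: A_def)
    from y(2)[OF this] c(2)[OF h(1,2)] show False by linarith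
  qed
  ultimately have y_in: "a < norm y" "norm y < \<rho>" using y(1) by (auto simp: A_def)
  have "open {x :: real ^ 'n. a < norm x \<and> norm x < \<rho>}"
    by (intro open_Collect_conj open_Collect_less continuous_intros)
  then have "\<forall>\<^sub>F z in nhds y. z \<in> {x. a < norm x \<and> norm x < \<rho>}"
    using y_in by (intro eventually_nhds_in_open) auto
  then have max: "\<forall>\<^sub>F z in nhds y. ?\<Phi> z \<le> ?\<Phi> y"
    by eventually_elim (use y(2) in \<open>auto simp: A_def\<close>)
  have "f (norm y) \<le> - (norm (grad \<phi> y) powr (q - 2) * normalized_p_laplacian p \<phi> y)"
    by (rule source_le_operator[OF U(1) yU U(2) y_ne y_R max grad[OF A_cball[OF y(1)] y_ne] p \<kappa>q \<kappa>d])
  then show ?thesis using that[of y] y_in(2) y_ne by simp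
qed

end

theorem theorem3p1:
  fixes p q R \<kappa> d :: real and f v :: "real \<Rightarrow> real" and u :: "real ^ 'n \<Rightarrow> real"
  assumes "2 \<le> CARD('n)"
    and "1 < p" and "1 < q" and "0 < R"
    and "continuous_on {0..<R} f"
    and "\<kappa> = (p - 1) / (q - 1)"
    and "d = (real CARD('n) - 1) * (q - 1) / (p - 1) + 1"
    and "ess_bounded R v"
    and "weak_supersolution \<kappa> q d R f v"
    and "\<And>x. x \<in> ball 0 R \<Longrightarrow> u x = real_of_ereal (lsc_regularization R v (norm x))"
  shows "viscosity_supersolution p q R f u"
proof -
  have N: "0 < real CARD('n) - 1" using assms(1) by simp
  interpret radial_equation \<kappa> q d R f
    by unfold_locales (use assms N in simp_all)
  obtain w H where wH: "distr_deriv 0 R v w" "antimono_on {0<..<R} H"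
    "\<And>t. t \<in> {0<..<R} \<Longrightarrow> H t \<le> 0"
    "AE t in lebesgue. t \<in> {0<..<R} \<longrightarrow>
       \<kappa> * (\<bar>w t\<bar> powr (q - 2) * w t) * t powr (d - 1) + F t = H t"
    by (rule supersolution_flux[OF assms(9)]) (rule that)
  obtain M where M: "AE t in lebesgue. t \<in> {0<..<R} \<longrightarrow> \<bar>v t\<bar> \<le> M"
    using assms(8) by (auto simp: ess_bounded_def AE_restrict_space_iff)
  interpret radial_supersolution \<kappa> q d R f M v w H
    by unfold_locales (fact assms(4) M distr_deriv_measurable(1)[OF wH(1)] wH)+
  have \<kappa>q: "\<kappa> * (q - 1) = p - 1" using assms(3,6) by simp
  have \<kappa>d: "\<kappa> * (d - 1) = real CARD('n) - 1" using assms(2,3,6,7) by simp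
  have u: "u x = V (norm x)" if "x \<in> ball 0 R" for x
    using assms(10)[OF that] by (simp add: V_def)
  show ?thesis
    unfolding viscosity_supersolution_def
  proof (intro conjI ballI allI impI)
    have "norm (u x) \<le> M" if "x \<in> ball 0 R" for x
      using u[OF that] ereal_V(2)[of "norm x"] that by simp
    then show "bounded (u ` ball 0 R)" unfolding bounded_iff by blast
    show "lower_semicontinuous_on (ball 0 R) u"
      unfolding lower_semicontinuous_on_def
    proof (intro ballI allI impI)
      fix x c assume x: "x \<in> ball 0 R" and c: "c < u x"
      obtain S where S: "0 < S" "\<And>s. s \<in> {0..<R} \<Longrightarrow> \<bar>s - norm x\<bar> < S \<Longrightarrow> c < V s"
        by (rule V_lsc[of "norm x" c]) (use x c u that in auto)
      have "c < u z" if "z \<in> ball 0 R" "dist z x < S" for z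
      proof -
        have "\<bar>norm z - norm x\<bar> < S"
          using norm_triangle_ineq3[of z x] that(2) by (simp add: dist_norm)
        then show ?thesis using u[OF that(1)] S(2)[of "norm z"] that(1) by simp
      qed
      then show "\<forall>\<^sub>F z in at x within ball 0 R. c < u z"
        unfolding eventually_at using S(1) by blast
    qed
  next
    fix x0 :: "real ^ 'n" and \<phi> :: "real ^ 'n \<Rightarrow> real"
    assume x0: "x0 \<in> ball 0 R" and
      "(\<exists>U. open U \<and> x0 \<in> U \<and> C2_on U \<phi>) \<and> touches_below_at \<phi> u x0 \<and>
        (\<forall>\<^sub>F x in at x0. grad \<phi> x \<noteq> 0)"
    then obtain U where U: "open U" "x0 \<in> U" "C2_on U \<phi>" and touch: "\<phi> x0 = u x0"
      and ev: "\<forall>\<^sub>F x in at x0. \<phi> x < u x" "\<forall>\<^sub>F x in at x0. grad \<phi> x \<noteq> 0"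
      by (auto simp: touches_below_at_def)
    obtain \<rho>0 where \<rho>0: "0 < \<rho>0" "\<And>x. dist x x0 < \<rho>0 \<Longrightarrow> x \<noteq> x0 \<Longrightarrow> \<phi> x < u x \<and> grad \<phi> x \<noteq> 0"
      using eventually_conj[OF ev] by (auto simp: eventually_at)
    obtain \<rho>U where \<rho>U: "0 < \<rho>U" "cball x0 \<rho>U \<subseteq> U"
      using U open_contains_cball by blast
    let ?G = "\<lambda>y. - (norm (grad \<phi> y) powr (q - 2) * normalized_p_laplacian p \<phi> y)"
    \<comment> \<open>The limsup over y \<noteq> x0 needs the inequality only at points arbitrarily
      near x0.\<close>
    have ex: "\<exists>y. y \<noteq> x0 \<and> dist y x0 < e \<and> norm y < R \<and> f (norm y) \<le> ?G y" if "0 < e" for e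
    proof -
      \<comment> \<open>The factor 1/2 makes the closed ball fit strictly inside all constraints.
        For x0 = 0 the last one, which keeps the ball away from the origin, is replaced by the dummy
        value 1.\<close>
      define \<rho> where "\<rho> = Min {e, \<rho>0, \<rho>U, R - norm x0, if x0 = 0 then 1 else norm x0} / 2"
      have \<rho>: "0 < \<rho>" using that \<rho>0 \<rho>U x0 by (simp add: \<rho>_def)
      have "2 * \<rho> \<le> m" if "m \<in> {e, \<rho>0, \<rho>U, R - norm x0, if x0 = 0 then 1 else norm x0}" for m
      proof -
        have "Min {e, \<rho>0, \<rho>U, R - norm x0, if x0 = 0 then 1 else norm x0} \<le> m"
          by (rule Min_le[OF _ that]) simp
        then show ?thesis unfolding \<rho>_def by linarith
      qed
      then have \<rho>_le: "2 * \<rho> \<le> e" "2 * \<rho> \<le> \<rho>0" "2 * \<rho> \<le> \<rho>U" "2 * \<rho> \<le> R - norm x0"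
        "x0 \<noteq> 0 \<Longrightarrow> 2 * \<rho> \<le> norm x0" by auto
      have cU: "cball x0 \<rho> \<subseteq> U" using \<rho>U(2) \<rho>_le(3) \<rho> by (auto simp: subset_iff)
      have in_R: "x \<in> ball 0 R" if "x \<in> cball x0 \<rho>" for x
        using that norm_triangle_sub[of x x0] \<rho>_le(4) \<rho> by (simp add: dist_norm norm_minus_commute)
      have near: "\<phi> x < V (norm x)" "grad \<phi> x \<noteq> 0" if "x \<in> cball x0 \<rho>" "x \<noteq> x0" for x
        using \<rho>0(2)[of x] that \<rho>_le(2) \<rho> u[OF in_R[OF that(1)]] by (auto simp: dist_commute)
      have \<phi>0: "\<phi> x0 = V (norm x0)" using touch u[OF x0] by simp
      obtain y where y: "y \<in> ball x0 \<rho>" "y \<noteq> x0" "f (norm y) \<le> ?G y"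
      proof (cases "x0 = 0")
        case True
        show ?thesis
        proof (rule touching_point_near_origin[OF U(1,3) \<rho> _ _ _ _ _ assms(2) \<kappa>q \<kappa>d])
          show "cball 0 \<rho> \<subseteq> U" using cU True by simp
          show "\<rho> < R" using \<rho>_le(4) \<rho> True by simp
          show "\<phi> 0 = V 0" using \<phi>0 True by simp
          show "\<phi> x < V (norm x)" "grad \<phi> x \<noteq> 0" if "x \<in> cball 0 \<rho>" "x \<noteq> 0" for x
            using near[of x] that True by auto
        qed (use that True in auto)
      next
        case False
        show ?thesis
        proof (rule touching_point_off_origin[OF U(1,3) False \<rho> cU _ _ \<phi>0 near assms(2) \<kappa>q \<kappa>d])
          show "\<rho> < norm x0" "norm x0 + \<rho> < R" using \<rho>_le(4) \<rho>_le(5)[OF False] \<rho> by auto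
        qed (use that in auto)
      qed
      then show ?thesis
        using in_R[of y] \<rho>_le(1) \<rho> by (intro exI[of _ y]) (auto simp: dist_commute)
    qed
    \<comment> \<open>The inequality holds with f at |y|; continuity of f moves it to |x0|.\<close>
    have "ereal (f (norm x0)) \<le> Limsup (at x0) (\<lambda>y. ereal (?G y))"
    proof (rule ccontr)
      assume "\<not> ?thesis"
      then have "Limsup (at x0) (\<lambda>y. ereal (?G y)) < ereal (f (norm x0))" by (simp only: not_le)
      from ereal_dense2[OF this]
      obtain c where c: "Limsup (at x0) (\<lambda>y. ereal (?G y)) < ereal c" "c < f (norm x0)"
        by auto
      have "\<forall>\<^sub>F y in at x0. ereal (?G y) < ereal c" by (rule Limsup_lessD[OF c(1)])
      then obtain e1 where e1: "0 < e1" "\<And>y. y \<noteq> x0 \<Longrightarrow> dist y x0 < e1 \<Longrightarrow> ?G y < c"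
        by (auto simp: eventually_at)
      obtain e2 where e2: "0 < e2" "\<And>r. r \<in> {0..<R} \<Longrightarrow> dist r (norm x0) < e2 \<Longrightarrow>
          dist (f r) (f (norm x0)) < f (norm x0) - c"
        using assms(5)[unfolded continuous_on_iff, rule_format, of "norm x0" "f (norm x0) - c"] x0 c(2)
        by auto
      obtain y where y: "y \<noteq> x0" "dist y x0 < min e1 e2" "norm y < R" "f (norm y) \<le> ?G y"
        using ex[of "min e1 e2"] e1(1) e2(1) by auto
      have "\<bar>norm y - norm x0\<bar> < e2"
        using norm_triangle_ineq3[of y x0] y(2) by (simp add: dist_norm)
      then have "c < f (norm y)"
        using e2(2)[of "norm y"] y(3) by (simp add: dist_real_def)
      moreover have "?G y < c" using e1(2)[of y] y by simp
      ultimately show False using y(4) by linarith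
    qed
    then show "0 \<le> Limsup (at x0) (\<lambda>y. ereal (?G y)) - ereal (f (norm x0))"
      by (rule ereal_diff_positive)
  qed
qed

end
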